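(* Let $n\ge1$, $a,b\in\mathbb{R}$ with $a\neq0$ and $b>0$, and $T>0$. Let $u$ be a real-valued solution of $$u_{tt}-\frac{\Delta u}{\left(a\int_{\mathbb{R}^n}|\nabla u|^2\,dx+b\right)^2}=0\quad\text{in }\mathbb{R}^n\times[0,T)$$ such that $u\in C^k([0,T);H^{3-k}(\mathbb{R}^n))$ for $k=0,1$, where in the case $a<0$ it is also assumed that $\|\nabla u(\cdot,t)\|^2<\frac{b}{|a|}$ for all $t\in[0,T)$. Suppose that $$I_1\le\frac{1}{6|ab|}.$$ Then for all $t\in[0,T)$ one has $$\frac b2\le q\le\frac32\,b,$$ $$\frac23\,I_2\le q\,\|\nabla u_t\|^2+\frac{\|\Delta u\|^2}{q}\le 2\,I_2,$$ $$\frac23\,I_3\le q\,\|\Delta u_t\|^2+\frac{\|\nabla(\Delta u)\|^2}{q}\le 2\,I_3.$$ In particular, the $L^2$-norms $\|\partial_x^\alpha\partial_t^k u(\cdot,t)\|$, for all multi-indices $\alpha$ and integers $k\ge0$ with $1\le|\alpha|+k\le3$, are uniformly bounded in $[0,T)$, independently of $T>0$; that is, they are bounded for all $t\in[0,T)$ by a constant that depends only on $n,a,b$ and the initial data $u(\cdot,0),u_t(\cdot,0)$, and not on $t$ or $T$.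
   Context: $\|\cdot\|$ denotes the $L^2(\mathbb{R}^n)$ norm in the space variable $x$; $\nabla,\Delta$ act in $x$; subscripts $t$ and primes denote time derivatives. Set $s(t):=\|\nabla u(\cdot,t)\|^2$ and $q(t):=a\,s(t)+b$. The functionals are $$I_1:=\|u_t\|^2+\int_0^{\|\nabla u\|^2}\frac{d\sigma}{(a\sigma+b)^2}=\|u_t\|^2+\frac1b\,\frac{\|\nabla u\|^2}{a\|\nabla u\|^2+b},$$ $$I_2:=q\,\|\nabla u_t\|^2+\frac{\|\Delta u\|^2}{q}-a\left(\int_{\mathbb{R}^n}\nabla u\cdot\nabla u_t\,dx\right)^2,$$ $$I_3:=q\,\|\Delta u_t\|^2+\frac{\|\nabla(\Delta u)\|^2}{q}-q'\int_{\mathbb{R}^n}\Delta u\,\Delta u_t\,dx+\frac18\,(q')^2\left(q\,\|\nabla u_t\|^2+\frac{\|\Delta u\|^2}{q}\right)-\frac{a}{16}\left(\frac{a^2(s')^4}{4}+q^2(s'')^2\right).$$ For solutions as in the claim, $I_1$, $I_2$ and $I_3$ are constant in $t\in[0,T)$, so the condition on $I_1$ is a condition on its constant value. Moreover $s'=2\int_{\mathbb{R}^n}\nabla u\cdot\nabla u_t\,dx$ and $s''=2\|\nabla u_t\|^2-\frac{2}{q^2}\|\Delta u\|^2$. *)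

theory Defs
  imports "HOL-Analysis.Analysis"
begin

section \<open>Sobolev spaces on Euclidean space\<close>

text \<open>
  Elements of \<open>L\<^sup>2\<close> and \<open>H\<^sup>m\<close> are represented by functions; all notions below are invariant under
  changing a representative on a null set.  A multi-index is a list of coordinate indices: the list
  \<open>[i\<^sub>1, \<dots>, i\<^sub>k]\<close> stands for the derivative \<open>\<partial>\<^sub>i\<^sub>1 \<dots> \<partial>\<^sub>i\<^sub>k\<close>, so the order of a multi-index is the length
  of the list, and every classical multi-index is represented (by several lists if its order
  exceeds 1, all of them giving the same derivative).
\<close>

definition partial_deriv :: "'n \<Rightarrow> (real^'n \<Rightarrow> real) \<Rightarrow> real^'n \<Rightarrow> real" where
  "partial_deriv i f x = frechet_derivative f (at x) (axis i 1)"

definition partial_derivs :: "'n list \<Rightarrow> (real^'n \<Rightarrow> real) \<Rightarrow> real^'n \<Rightarrow> real" where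
  "partial_derivs \<alpha> f = foldr partial_deriv \<alpha> f"

definition test_function :: "(real^'n \<Rightarrow> real) \<Rightarrow> bool" where
  "test_function \<phi> \<longleftrightarrow>
     (\<forall>\<alpha> x. partial_derivs \<alpha> \<phi> differentiable (at x)) \<and> compact (closure {x. \<phi> x \<noteq> 0})"

definition L2 :: "(real^'n \<Rightarrow> real) \<Rightarrow> bool" where
  "L2 f \<longleftrightarrow> f \<in> borel_measurable lebesgue \<and> integrable lebesgue (\<lambda>x. (f x)\<^sup>2)"

text \<open>The norm is only meaningful for square integrable functions, since the Bochner integral of a
  non-integrable function is 0; membership is therefore always required separately.\<close>

definition L2norm :: "(real^'n \<Rightarrow> 'b::real_normed_vector) \<Rightarrow> real" where
  "L2norm f = sqrt (\<integral>x. (norm (f x))\<^sup>2 \<partial>lebesgue)"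

definition is_weak_deriv :: "'n list \<Rightarrow> (real^'n \<Rightarrow> real) \<Rightarrow> (real^'n \<Rightarrow> real) \<Rightarrow> bool" where
  "is_weak_deriv \<alpha> f g \<longleftrightarrow>
     (\<forall>\<phi>. test_function \<phi> \<longrightarrow>
        (\<integral>x. f x * partial_derivs \<alpha> \<phi> x \<partial>lebesgue) = (-1) ^ length \<alpha> * (\<integral>x. g x * \<phi> x \<partial>lebesgue))"

definition has_weak_deriv_L2 :: "'n list \<Rightarrow> (real^'n \<Rightarrow> real) \<Rightarrow> bool" where
  "has_weak_deriv_L2 \<alpha> f \<longleftrightarrow> (\<exists>g. L2 g \<and> is_weak_deriv \<alpha> f g)"

text \<open>A representative of the weak derivative (unique almost everywhere when it exists).\<close>

definition weak_deriv :: "'n list \<Rightarrow> (real^'n \<Rightarrow> real) \<Rightarrow> real^'n \<Rightarrow> real" where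
  "weak_deriv \<alpha> f = (SOME g. L2 g \<and> is_weak_deriv \<alpha> f g)"

definition in_H :: "nat \<Rightarrow> (real^'n \<Rightarrow> real) \<Rightarrow> bool" where
  "in_H m f \<longleftrightarrow> L2 f \<and> (\<forall>\<alpha>. length \<alpha> \<le> m \<longrightarrow> has_weak_deriv_L2 \<alpha> f)"

definition Hnorm :: "nat \<Rightarrow> (real^'n \<Rightarrow> real) \<Rightarrow> real" where
  "Hnorm m f = sqrt (\<Sum>\<alpha> | length \<alpha> \<le> m. (L2norm (weak_deriv \<alpha> f))\<^sup>2)"

definition grad :: "(real^'n \<Rightarrow> real) \<Rightarrow> real^'n \<Rightarrow> real^'n" where
  "grad f x = (\<chi> i. weak_deriv [i] f x)"

definition lap :: "(real^'n \<Rightarrow> real) \<Rightarrow> real^'n \<Rightarrow> real" where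
  "lap f x = (\<Sum>i\<in>UNIV. weak_deriv [i, i] f x)"

section \<open>Time regularity\<close>

text \<open>
  Time-dependent functions are maps \<open>u :: real \<Rightarrow> real^'n \<Rightarrow> real\<close> considered on \<open>[0, T)\<close>.  Limits in
  time are taken along \<open>at t within {0..}\<close>; for \<open>t \<in> [0, T)\<close> this is the same filter as
  \<open>at t within {0..<T}\<close>, i.e. two-sided for \<open>t > 0\<close> and one-sided at \<open>t = 0\<close>, and values of \<open>u\<close> at
  times beyond \<open>T\<close> play no role.
\<close>

definition has_time_deriv ::
    "nat \<Rightarrow> (real \<Rightarrow> real^'n \<Rightarrow> real) \<Rightarrow> real \<Rightarrow> (real^'n \<Rightarrow> real) \<Rightarrow> bool" where
  "has_time_deriv m u t v \<longleftrightarrow>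
     in_H m (u t) \<and> (\<forall>\<^sub>F \<tau> in at t within {0..}. in_H m (u \<tau>)) \<and> in_H m v \<and>
     ((\<lambda>\<tau>. Hnorm m (\<lambda>x. (u \<tau> x - u t x) / (\<tau> - t) - v x)) \<longlongrightarrow> 0) (at t within {0..})"

primrec C_H :: "nat \<Rightarrow> nat \<Rightarrow> real \<Rightarrow> (real \<Rightarrow> real^'n \<Rightarrow> real) \<Rightarrow> bool" where
  "C_H 0 m T u \<longleftrightarrow>
     (\<forall>t\<in>{0..<T}. in_H m (u t) \<and>
        ((\<lambda>\<tau>. Hnorm m (\<lambda>x. u \<tau> x - u t x)) \<longlongrightarrow> 0) (at t within {0..}))"
| "C_H (Suc k) m T u \<longleftrightarrow>
     (\<exists>v. (\<forall>t\<in>{0..<T}. has_time_deriv m u t (v t)) \<and> C_H k m T v)"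

text \<open>The time derivative as an \<open>L\<^sup>2\<close>-limit of difference quotients; by uniqueness it coincides almost
  everywhere with the \<open>H\<^sup>m\<close>-valued derivative whenever the latter exists.\<close>

definition dt :: "(real \<Rightarrow> real^'n \<Rightarrow> real) \<Rightarrow> real \<Rightarrow> real^'n \<Rightarrow> real" where
  "dt u t = (SOME v. has_time_deriv 0 u t v)"

definition prime_t :: "(real \<Rightarrow> real) \<Rightarrow> real \<Rightarrow> real" where
  "prime_t f t = vector_derivative f (at t within {0..})"

section \<open>The Kirchhoff equation and its functionals\<close>

definition s_fun :: "(real \<Rightarrow> real^'n \<Rightarrow> real) \<Rightarrow> real \<Rightarrow> real" where
  "s_fun u t = (L2norm (grad (u t)))\<^sup>2"

definition q_fun :: "real \<Rightarrow> real \<Rightarrow> (real \<Rightarrow> real^'n \<Rightarrow> real) \<Rightarrow> real \<Rightarrow> real" where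
  "q_fun a b u t = a * s_fun u t + b"

definition I1 :: "real \<Rightarrow> real \<Rightarrow> (real \<Rightarrow> real^'n \<Rightarrow> real) \<Rightarrow> real \<Rightarrow> real" where
  "I1 a b u t = (L2norm (dt u t))\<^sup>2 + integral {0..s_fun u t} (\<lambda>\<sigma>. 1 / (a * \<sigma> + b)\<^sup>2)"

definition E2 :: "real \<Rightarrow> real \<Rightarrow> (real \<Rightarrow> real^'n \<Rightarrow> real) \<Rightarrow> real \<Rightarrow> real" where
  "E2 a b u t =
     q_fun a b u t * (L2norm (grad (dt u t)))\<^sup>2 + (L2norm (lap (u t)))\<^sup>2 / q_fun a b u t"

definition I2 :: "real \<Rightarrow> real \<Rightarrow> (real \<Rightarrow> real^'n \<Rightarrow> real) \<Rightarrow> real \<Rightarrow> real" where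
  "I2 a b u t =
     E2 a b u t - a * (\<integral>x. grad (u t) x \<bullet> grad (dt u t) x \<partial>lebesgue)\<^sup>2"

definition E3 :: "real \<Rightarrow> real \<Rightarrow> (real \<Rightarrow> real^'n \<Rightarrow> real) \<Rightarrow> real \<Rightarrow> real" where
  "E3 a b u t =
     q_fun a b u t * (L2norm (lap (dt u t)))\<^sup>2 + (L2norm (grad (lap (u t))))\<^sup>2 / q_fun a b u t"

definition I3 :: "real \<Rightarrow> real \<Rightarrow> (real \<Rightarrow> real^'n \<Rightarrow> real) \<Rightarrow> real \<Rightarrow> real" where
  "I3 a b u t =
     E3 a b u t
     - prime_t (q_fun a b u) t * (\<integral>x. lap (u t) x * lap (dt u t) x \<partial>lebesgue)
     + 1 / 8 * (prime_t (q_fun a b u) t)\<^sup>2 * E2 a b u t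
     - a / 16 * (a\<^sup>2 * (prime_t (s_fun u) t) ^ 4 / 4
                 + (q_fun a b u t)\<^sup>2 * (prime_t (prime_t (s_fun u)) t)\<^sup>2)"

text \<open>
  Solutions \<open>u \<in> C\<^sup>k([0, T); H\<^sup>3\<^sup>-\<^sup>k)\<close>, \<open>k = 0, 1\<close>.  No regularity of \<open>u\<^sub>t\<^sub>t\<close> is presupposed: the equation
  is required in the sense of distributions in \<open>x\<close>, i.e. after testing against \<open>\<phi> \<in> C\<^sub>c\<^sup>\<infinity>\<close>.
\<close>

definition kirchhoff_solution ::
    "real \<Rightarrow> real \<Rightarrow> real \<Rightarrow> (real \<Rightarrow> real^'n \<Rightarrow> real) \<Rightarrow> bool" where
  "kirchhoff_solution a b T u \<longleftrightarrow>
     (\<forall>k\<le>1. C_H k (3 - k) T u) \<and>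
     (a < 0 \<longrightarrow> (\<forall>t\<in>{0..<T}. (L2norm (grad (u t)))\<^sup>2 < b / \<bar>a\<bar>)) \<and>
     (\<forall>\<phi>. test_function \<phi> \<longrightarrow> (\<forall>t\<in>{0..<T}.
        ((\<lambda>\<tau>. \<integral>x. dt u \<tau> x * \<phi> x \<partial>lebesgue) has_real_derivative
         (\<integral>x. lap (u t) x / (a * (\<integral>y. (norm (grad (u t) y))\<^sup>2 \<partial>lebesgue) + b)\<^sup>2 * \<phi> x \<partial>lebesgue))
        (at t within {0..})))"

end

theory Submission
  imports Defs
begin

text \<open>
  Multiplying the equation by suitable combinations of \<open>u\<close>, \<open>u\<^sub>t\<close> and their derivatives shows that
  \<open>I\<^sub>1\<close>, \<open>I\<^sub>2\<close> and \<open>I\<^sub>3\<close> do not change in time.  Each of \<open>I\<^sub>2\<close>, \<open>I\<^sub>3\<close> is a positive energy plus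
  corrections without a sign, and the bound on \<open>I\<^sub>1\<close> makes the corrections small: it gives
  \<open>\<bar>a\<bar> \<parallel>\<nabla>u\<parallel>\<^sup>2 \<le> q / 6\<close> and \<open>\<bar>a\<bar> \<parallel>u\<^sub>t\<parallel>\<^sup>2 \<le> 1 / (6 b)\<close>, hence \<open>\<bar>q - b\<bar> \<le> q / 6\<close>, while
  integration by parts gives the interpolation inequalities
  \<open>\<parallel>\<nabla>u\<^sub>t\<parallel>\<^sup>2 \<le> \<parallel>u\<^sub>t\<parallel> \<parallel>\<Delta>u\<^sub>t\<parallel>\<close> and \<open>\<parallel>\<Delta>u\<parallel>\<^sup>2 \<le> \<parallel>\<nabla>u\<parallel> \<parallel>\<nabla>\<Delta>u\<parallel>\<close>.  Together they bound every correction by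
  a small multiple of the energy (\<open>normalized_bounds\<close>).  So the energies stay comparable with
  their initial values, which the initial data determine, and they control all derivatives of
  total order one to three; the derivatives of \<open>u\<^sub>t\<^sub>t\<close> and \<open>u\<^sub>t\<^sub>t\<^sub>t\<close> are read off from the equation.

  The delicate point is the conservation of \<open>I\<^sub>3\<close>: its energy contains derivatives of the highest
  order that the solution has, so it cannot simply be differentiated in time.  The function
  \<open>v = \<Sum>\<^sub>i D\<^sub>i\<^sup>h \<partial>\<^sub>i u\<close>, where \<open>D\<^sub>i\<^sup>h\<close> is a difference quotient, replaces \<open>\<Delta>u\<close>.  It is one order smoother and
  solves the linear wave equation \<open>v\<^sub>t\<^sub>t = \<Delta>v / q\<^sup>2\<close>; in the time derivative of
  \<open>q \<parallel>v\<^sub>t\<parallel>\<^sup>2 + \<parallel>\<nabla>v\<parallel>\<^sup>2 / q - q' \<langle>v, v\<^sub>t\<rangle>\<close> all quadratic terms of highest order cancel and only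
  \<open>- q'' \<langle>v, v\<^sub>t\<rangle>\<close> is left.  This expression passes to the limit \<open>h \<rightarrow> 0\<close>, where it balances the
  derivative of the remaining terms of \<open>I\<^sub>3\<close> (\<open>I3_conserved\<close>).

  The calculus of weak derivatives rests on one principle (\<open>strong_derivative_of_weak\<close>): a curve in
  \<open>L\<^sup>2\<close> whose pairings with test functions are differentiable, with derivatives coming from a
  norm-continuous curve, is differentiable in norm.  It needs only that test functions are dense.
  Applied to the curve of translates of \<open>F\<close> in the direction \<open>i\<close>, it says that the weak derivative
  \<open>\<partial>\<^sub>i F\<close> is the velocity of this curve.  Integration by parts is then the derivative of the
  identity \<open>\<langle>\<tau>\<^sub>s F, \<tau>\<^sub>s G\<rangle> = \<langle>F, G\<rangle>\<close>, and mixed derivatives commute because translations commute with weak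
  derivatives.  Applied to \<open>u\<^sub>t\<close>, it turns the distributional equation into an equation in \<open>L\<^sup>2\<close>.
\<close>

section \<open>The Hilbert space of square integrable functions\<close>

definition L2_eq :: "(real^'n \<Rightarrow> real) \<Rightarrow> (real^'n \<Rightarrow> real) \<Rightarrow> bool" where
  "L2_eq f g \<longleftrightarrow> L2 f \<and> L2 g \<and> (AE x in lebesgue. f x = g x)"

lemma L2_integrable_mult:
  assumes "L2 f" "L2 g" shows "integrable lebesgue (\<lambda>x. f x * g x)"
proof (rule Bochner_Integration.integrable_bound)
  show "integrable lebesgue (\<lambda>x. (f x)\<^sup>2 + (g x)\<^sup>2)"
    using assms by (auto simp: L2_def)
  show "(\<lambda>x. f x * g x) \<in> borel_measurable lebesgue"
    using assms by (auto simp: L2_def)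
  have "norm (a * b) \<le> norm (a\<^sup>2 + b\<^sup>2)" for a b :: real
  proof -
    have "0 \<le> (\<bar>a\<bar> - \<bar>b\<bar>)\<^sup>2" by simp
    then have "2 * (\<bar>a\<bar> * \<bar>b\<bar>) \<le> a\<^sup>2 + b\<^sup>2" by (simp add: power2_diff)
    moreover have "0 \<le> \<bar>a\<bar> * \<bar>b\<bar>" by simp
    ultimately have "\<bar>a\<bar> * \<bar>b\<bar> \<le> a\<^sup>2 + b\<^sup>2" by linarith
    then show ?thesis by (simp add: abs_mult)
  qed
  then show "AE x in lebesgue. norm (f x * g x) \<le> norm ((f x)\<^sup>2 + (g x)\<^sup>2)" by simp
qed

lemma L2_zero: "L2 (\<lambda>x. 0)" by (simp add: L2_def)

lemma L2_add: assumes "L2 f" "L2 g" shows "L2 (\<lambda>x. f x + g x)"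
proof -
  have "integrable lebesgue (\<lambda>x. (f x)\<^sup>2 + (g x)\<^sup>2 + 2 * (f x * g x))"
    using L2_integrable_mult[OF assms] assms by (auto simp: L2_def)
  then show ?thesis
    using assms borel_measurable_add[of f lebesgue g] by (simp add: L2_def power2_sum mult.assoc)
qed

lemma L2_scale: assumes "L2 f" shows "L2 (\<lambda>x. c * f x)"
  using assms borel_measurable_times[of "\<lambda>x. c" lebesgue f] by (simp add: L2_def power_mult_distrib)

lemma L2_minus: assumes "L2 f" shows "L2 (\<lambda>x. - f x)"
  using assms by (simp add: L2_def)

lemma L2_diff: assumes "L2 f" "L2 g" shows "L2 (\<lambda>x. f x - g x)"
  using L2_add[OF assms(1) L2_minus[OF assms(2)]] by simp

lemma L2_sum: "(\<And>i. i \<in> A \<Longrightarrow> L2 (f i)) \<Longrightarrow> L2 (\<lambda>x. \<Sum>i\<in>A. f i x)"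
  by (induction A rule: infinite_finite_induct) (auto intro: L2_zero L2_add)

lemma L2_AE_cong:
  assumes "L2 f" "AE x in lebesgue. f x = g x" shows "L2 g"
proof -
  have g: "g \<in> borel_measurable lebesgue"
    using borel_measurable_AE[of f g] assms by (auto simp: L2_def)
  have "integrable lebesgue (\<lambda>x. (f x)\<^sup>2) = integrable lebesgue (\<lambda>x. (g x)\<^sup>2)"
    using assms g by (intro integrable_cong_AE) (auto simp: L2_def)
  then show ?thesis using assms g by (simp add: L2_def)
qed

text \<open>Passing to classes modulo null sets gives a real inner product space, so that the library's
  norms, limits and vector derivatives apply to curves of square integrable functions.\<close>

quotient_type 'n l2 = "real^'n \<Rightarrow> real" / partial: L2_eq
proof (rule part_equivpI)
  show "\<exists>f :: real^'n \<Rightarrow> real. L2_eq f f"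
    using L2_zero by (auto simp: L2_eq_def)
  show "symp (L2_eq :: (real^'n \<Rightarrow> real) \<Rightarrow> _)"
  proof (rule sympI)
    fix f g :: "real^'n \<Rightarrow> real"
    assume a: "L2_eq f g"
    then have "AE x in lebesgue. f x = g x" by (auto simp: L2_eq_def)
    then have "AE x in lebesgue. g x = f x" by eventually_elim simp
    with a show "L2_eq g f" by (auto simp: L2_eq_def)
  qed
  show "transp (L2_eq :: (real^'n \<Rightarrow> real) \<Rightarrow> _)"
  proof (rule transpI)
    fix f g h :: "real^'n \<Rightarrow> real"
    assume a: "L2_eq f g" "L2_eq g h"
    then have "AE x in lebesgue. f x = g x" "AE x in lebesgue. g x = h x"
      by (auto simp: L2_eq_def)
    then have "AE x in lebesgue. f x = h x" by eventually_elim simp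
    with a show "L2_eq f h" by (auto simp: L2_eq_def)
  qed
qed

instantiation l2 :: (finite) real_inner
begin

lift_definition zero_l2 :: "'a l2" is "\<lambda>x. 0" by (simp add: L2_eq_def L2_zero)

lift_definition plus_l2 :: "'a l2 \<Rightarrow> 'a l2 \<Rightarrow> 'a l2" is "\<lambda>f g x. f x + g x"
  by (auto simp: L2_eq_def L2_add)

lift_definition minus_l2 :: "'a l2 \<Rightarrow> 'a l2 \<Rightarrow> 'a l2" is "\<lambda>f g x. f x - g x"
  by (auto simp: L2_eq_def L2_diff)

lift_definition uminus_l2 :: "'a l2 \<Rightarrow> 'a l2" is "\<lambda>f x. - f x"
  by (auto simp: L2_eq_def L2_minus)

lift_definition scaleR_l2 :: "real \<Rightarrow> 'a l2 \<Rightarrow> 'a l2" is "\<lambda>c f x. c * f x"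
  by (auto simp: L2_eq_def L2_scale)

lift_definition inner_l2 :: "'a l2 \<Rightarrow> 'a l2 \<Rightarrow> real" is "\<lambda>f g. \<integral>x. f x * g x \<partial>lebesgue"
proof -
  fix f f' g g' :: "real^'a \<Rightarrow> real"
  assume a: "L2_eq f f'" "L2_eq g g'"
  then have "AE x in lebesgue. f x = f' x" "AE x in lebesgue. g x = g' x"
    by (auto simp: L2_eq_def)
  then have "AE x in lebesgue. f x * g x = f' x * g' x" by eventually_elim simp
  with a show "(\<integral>x. f x * g x \<partial>lebesgue) = (\<integral>x. f' x * g' x \<partial>lebesgue)"
    by (intro integral_cong_AE) (auto simp: L2_eq_def L2_def)
qed

definition norm_l2 :: "'a l2 \<Rightarrow> real" where "norm_l2 f = sqrt (inner f f)"
definition sgn_l2 :: "'a l2 \<Rightarrow> 'a l2" where "sgn_l2 f = inverse (norm f) *\<^sub>R f"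
definition dist_l2 :: "'a l2 \<Rightarrow> 'a l2 \<Rightarrow> real" where "dist_l2 f g = norm (f - g)"
definition uniformity_l2 :: "('a l2 \<times> 'a l2) filter" where
  "uniformity_l2 = (INF e\<in>{0 <..}. principal {(x, y). dist x y < e})"
definition open_l2 :: "'a l2 set \<Rightarrow> bool" where
  "open_l2 U = (\<forall>x\<in>U. eventually (\<lambda>(x', y). x' = x \<longrightarrow> y \<in> U) uniformity)"

instance
proof
  fix f g h :: "'a l2" and r s :: real and U :: "'a l2 set"
  show "f + g + h = f + (g + h)" by transfer (auto simp: L2_eq_def L2_add add.assoc)
  show "f + g = g + f" by transfer (auto simp: L2_eq_def L2_add add.commute)
  show "0 + f = f" by transfer (auto simp: L2_eq_def)
  show "- f + f = 0" by transfer (auto simp: L2_eq_def L2_zero)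
  show "f - g = f + - g" by transfer (auto simp: L2_eq_def L2_diff)
  show "r *\<^sub>R (f + g) = r *\<^sub>R f + r *\<^sub>R g"
    by transfer (auto simp: L2_eq_def L2_add L2_scale algebra_simps)
  show "(r + s) *\<^sub>R f = r *\<^sub>R f + s *\<^sub>R f"
    by transfer (auto simp: L2_eq_def L2_add L2_scale algebra_simps)
  show "r *\<^sub>R s *\<^sub>R f = (r * s) *\<^sub>R f"
    by transfer (auto simp: L2_eq_def L2_scale algebra_simps)
  show "1 *\<^sub>R f = f" by transfer (auto simp: L2_eq_def)
  show "sgn f = inverse (norm f) *\<^sub>R f" by (rule sgn_l2_def)
  show "dist f g = norm (f - g)" by (rule dist_l2_def)
  show "(uniformity :: ('a l2 \<times> 'a l2) filter) = (INF e\<in>{0 <..}. principal {(x, y). dist x y < e})"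
    by (rule uniformity_l2_def)
  show "open U = (\<forall>x\<in>U. eventually (\<lambda>(x', y). x' = x \<longrightarrow> y \<in> U) uniformity)"
    by (rule open_l2_def)
  show "inner f g = inner g f" by transfer (simp add: mult.commute)
  show "inner (f + g) h = inner f h + inner g h"
    by transfer (auto simp: L2_eq_def distrib_right Bochner_Integration.integral_add L2_integrable_mult)
  show "inner (r *\<^sub>R f) g = r * inner f g"
    by transfer (auto simp: mult.assoc)
  show "0 \<le> inner f f" by transfer simp
  show "norm f = sqrt (inner f f)" by (rule norm_l2_def)
  show "inner f f = 0 \<longleftrightarrow> f = 0"
  proof transfer
    fix f :: "real^'a \<Rightarrow> real" assume "L2_eq f f"
    then have "L2 f" by (simp add: L2_eq_def)
    then have "(\<integral>x. f x * f x \<partial>lebesgue) = 0 \<longleftrightarrow> (AE x in lebesgue. f x * f x = 0)"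
      by (intro integral_nonneg_eq_0_iff_AE L2_integrable_mult) auto
    with \<open>L2 f\<close> show "(\<integral>x. f x * f x \<partial>lebesgue) = 0 \<longleftrightarrow> L2_eq f (\<lambda>x. 0)"
      by (simp add: L2_eq_def L2_zero)
  qed
qed

end

abbreviation cls :: "(real^'n \<Rightarrow> real) \<Rightarrow> 'n l2" where "cls \<equiv> abs_l2"

lemma L2_eq_refl: "L2 f \<Longrightarrow> L2_eq f f" by (simp add: L2_eq_def)

lemma cls_surj: obtains f where "F = cls f" "L2 f"
proof -
  have "L2_eq (rep_l2 F) (rep_l2 F)"
    using Quotient_l2 Quotient_rep_reflp by fastforce
  then have "L2 (rep_l2 F)" by (simp add: L2_eq_def)
  moreover have "F = cls (rep_l2 F)" using Quotient_l2 by (metis Quotient_abs_rep)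
  ultimately show ?thesis using that by blast
qed

lemma cls_eq_iff: "L2 f \<Longrightarrow> L2 g \<Longrightarrow> cls f = cls g \<longleftrightarrow> (AE x in lebesgue. f x = g x)"
  using Quotient_rel[OF Quotient_l2, of f g] by (auto simp: L2_eq_def)

lemma cls_zero: "cls (\<lambda>x. 0) = 0" by (simp add: zero_l2_def)

lemma cls_add: "L2 f \<Longrightarrow> L2 g \<Longrightarrow> cls (\<lambda>x. f x + g x) = cls f + cls g"
  by (simp add: plus_l2.abs_eq L2_eq_refl)

lemma cls_diff: "L2 f \<Longrightarrow> L2 g \<Longrightarrow> cls (\<lambda>x. f x - g x) = cls f - cls g"
  by (simp add: minus_l2.abs_eq L2_eq_refl)

lemma cls_scale: "L2 f \<Longrightarrow> cls (\<lambda>x. c * f x) = c *\<^sub>R cls f"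
  by (simp add: scaleR_l2.abs_eq L2_eq_refl)

lemma cls_sum: "(\<And>i. i \<in> A \<Longrightarrow> L2 (f i)) \<Longrightarrow> cls (\<lambda>x. \<Sum>i\<in>A. f i x) = (\<Sum>i\<in>A. cls (f i))"
  by (induction A rule: infinite_finite_induct) (auto simp: cls_zero cls_add L2_sum)

lemma inner_cls: "L2 f \<Longrightarrow> L2 g \<Longrightarrow> inner (cls f) (cls g) = (\<integral>x. f x * g x \<partial>lebesgue)"
  by (simp add: inner_l2.abs_eq L2_eq_refl)

lemma norm_cls: "L2 f \<Longrightarrow> norm (cls f) = L2norm f"
  by (simp add: norm_eq_sqrt_inner inner_cls L2norm_def power2_eq_square)

subsection \<open>Translations\<close>

lemma distr_lebesgue_translation: "distr lebesgue lebesgue (\<lambda>x::real^'n. x + h) = lebesgue"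
  and measurable_lebesgue_translation: "(\<lambda>x::real^'n. x + h) \<in> lebesgue \<rightarrow>\<^sub>M lebesgue"
proof -
  have eq: "(\<lambda>x::real^'n. h + (\<Sum>j\<in>Basis. (1 * (x \<bullet> j)) *\<^sub>R j)) = (\<lambda>x. x + h)"
    by (simp add: euclidean_representation add.commute)
  show "(\<lambda>x::real^'n. x + h) \<in> lebesgue \<rightarrow>\<^sub>M lebesgue"
    using lebesgue_affine_measurable[of "\<lambda>_. 1" h] by (simp only: eq)
  have "lebesgue = density (distr lebesgue lebesgue (\<lambda>x::real^'n. x + h)) (\<lambda>_. ennreal (\<Prod>j\<in>(Basis::(real^'n) set). \<bar>1\<bar>))"
    using lebesgue_affine_euclidean[of "\<lambda>_. 1" h] by (simp only: eq)
  then show "distr lebesgue lebesgue (\<lambda>x::real^'n. x + h) = lebesgue"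
    by (simp add: density_1)
qed

lemma
  fixes f :: "real^'n \<Rightarrow> real"
  assumes f: "f \<in> borel_measurable lebesgue"
  shows integrable_lebesgue_translation:
      "integrable lebesgue (\<lambda>x. f (x + h)) \<longleftrightarrow> integrable lebesgue f"
    and integral_lebesgue_translation:
      "(\<integral>x. f (x + h) \<partial>lebesgue) = (\<integral>x. f x \<partial>lebesgue)"
proof -
  note m = measurable_lebesgue_translation[of h]
  show "integrable lebesgue (\<lambda>x. f (x + h)) \<longleftrightarrow> integrable lebesgue f"
    using integrable_distr_eq[OF m f] by (simp add: distr_lebesgue_translation)
  show "(\<integral>x. f (x + h) \<partial>lebesgue) = (\<integral>x. f x \<partial>lebesgue)"
    using integral_distr[OF m f] by (simp add: distr_lebesgue_translation)
qed

lemma AE_lebesgue_translation: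
  fixes h :: "real^'n"
  assumes "AE x in lebesgue. P x" shows "AE x in lebesgue. P (x + h)"
  using AE_distrD[OF measurable_lebesgue_translation, of P h] assms
  by (simp only: distr_lebesgue_translation)

lemma L2_translation:
  assumes "L2 f" shows "L2 (\<lambda>x. f (x + h))"
proof -
  have "(\<lambda>x. f (x + h)) \<in> borel_measurable lebesgue"
    using measurable_compose[OF measurable_lebesgue_translation] assms by (auto simp: L2_def)
  moreover have "(\<lambda>x. (f x)\<^sup>2) \<in> borel_measurable lebesgue" using assms by (auto simp: L2_def)
  then have "integrable lebesgue (\<lambda>x. (f (x + h))\<^sup>2)"
    using integrable_lebesgue_translation[of "\<lambda>x. (f x)\<^sup>2" h] assms by (simp add: L2_def)
  ultimately show ?thesis by (simp add: L2_def)
qed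

lift_definition shift :: "real^'n \<Rightarrow> 'n l2 \<Rightarrow> 'n l2" is "\<lambda>h f x. f (x + h)"
proof -
  fix h and f g :: "real^'n \<Rightarrow> real"
  assume "L2_eq f g"
  then show "L2_eq (\<lambda>x. f (x + h)) (\<lambda>x. g (x + h))"
    using AE_lebesgue_translation[of "\<lambda>x. f x = g x" h] by (simp add: L2_eq_def L2_translation)
qed

lemma shift_cls: "L2 f \<Longrightarrow> shift h (cls f) = cls (\<lambda>x. f (x + h))"
  by (simp add: shift.abs_eq L2_eq_refl)

lemma shift_add: "shift h (f + g) = shift h f + shift h g"
  by transfer (simp add: L2_eq_def L2_translation L2_add)

lemma shift_scaleR: "shift h (c *\<^sub>R f) = c *\<^sub>R shift h f"
  by transfer (simp add: L2_eq_def L2_translation L2_scale)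

lemma shift_shift: "shift h (shift k f) = shift (h + k) f"
  by transfer (simp add: L2_eq_def add.assoc L2_translation)

lemma shift_0: "shift 0 f = f"
  by transfer (simp add: L2_eq_def)

lemma inner_shift_shift: "inner (shift h f) (shift h g) = inner f g"
proof transfer
  fix h and f g :: "real^'n \<Rightarrow> real"
  assume "L2_eq f f" "L2_eq g g"
  then have "(\<lambda>x. f x * g x) \<in> borel_measurable lebesgue"
    by (auto simp: L2_eq_def L2_def)
  then show "(\<integral>x. f (x + h) * g (x + h) \<partial>lebesgue) = (\<integral>x. f x * g x \<partial>lebesgue)"
    by (rule integral_lebesgue_translation)
qed

lemma norm_shift: "norm (shift h f) = norm f"
  by (simp add: norm_eq_sqrt_inner inner_shift_shift)

lemma inner_shift_left: "inner (shift h f) g = inner f (shift (- h) g)"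
  using inner_shift_shift[of h f "shift (-h) g"] by (simp add: shift_shift shift_0)

lemma bounded_linear_shift: "bounded_linear (shift h)"
  by (rule bounded_linear_intro[where K = 1]) (auto simp: shift_add shift_scaleR norm_shift)

section \<open>Test functions\<close>

subsection \<open>A supply of smooth functions\<close>

lemma partial_deriv_eqI:
  assumes "(f has_derivative f') (at x)" shows "partial_deriv i f x = f' (axis i 1)"
  using frechet_derivative_at[OF assms] by (simp add: partial_deriv_def)

lemma has_derivative_frechet:
  "f differentiable (at x) \<Longrightarrow> (f has_derivative frechet_derivative f (at x)) (at x)"
  by (simp add: frechet_derivative_works)

text \<open>The functions \<open>exp (-1 / y) / y\<^sup>k\<close> on the positive half-line, extended by \<open>0\<close>: together they are
  closed under differentiation up to linear combinations, which yields smoothness of all of them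
  at once.\<close>

definition bump_profile :: "nat \<Rightarrow> real \<Rightarrow> real" where
  "bump_profile k y = (if y > 0 then exp (- 1 / y) / y ^ k else 0)"

text \<open>The only delicate point is \<open>y = 0\<close>, where the exponential beats every power of \<open>1 / y\<close>.\<close>

lemma bump_profile_DERIV:
  "(bump_profile k has_real_derivative bump_profile (k + 2) y - k * bump_profile (k + 1) y) (at y)"
proof -
  consider "y < 0" | "y > 0" | "y = 0" by linarith
  then show ?thesis
  proof cases
    case 1
    have "((\<lambda>y. 0) has_real_derivative 0) (at y)" by simp
    then have "(bump_profile k has_real_derivative 0) (at y)"
      by (rule has_field_derivative_transform_within_open[of _ _ _ "{..<0}"])
        (use 1 in \<open>auto simp: bump_profile_def\<close>)
    then show ?thesis using 1 by (simp add: bump_profile_def)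
  next
    case 2
    have "((\<lambda>y. exp (- 1 / y) / y ^ k) has_real_derivative
            exp (- 1 / y) / y ^ (k + 2) - k * (exp (- 1 / y) / y ^ (k + 1))) (at y)"
    proof -
      have e: "((\<lambda>y. exp (- 1 / y)) has_real_derivative exp (- 1 / y) / y\<^sup>2) (at y)"
        using 2 by (auto intro!: derivative_eq_intros simp: power2_eq_square)
      have p: "((\<lambda>y. y ^ k) has_real_derivative k * y ^ k / y) (at y)"
        using 2 DERIV_pow[of k y] by (cases k) auto
      have eq: "(exp (- 1 / y) / y\<^sup>2 * y ^ k - exp (- 1 / y) * (k * y ^ k / y)) / (y ^ k * y ^ k) =
          exp (- 1 / y) / y ^ (k + 2) - k * (exp (- 1 / y) / y ^ (k + 1))"
        using 2 by (simp add: diff_divide_distrib power_add power2_eq_square mult.commute mult.left_commute)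
      show ?thesis using DERIV_divide[OF e p] 2 unfolding eq by simp
    qed
    then have "(bump_profile k has_real_derivative
            exp (- 1 / y) / y ^ (k + 2) - k * (exp (- 1 / y) / y ^ (k + 1))) (at y)"
      by (rule has_field_derivative_transform_within_open[of _ _ _ "{0<..}"])
        (use 2 in \<open>auto simp: bump_profile_def\<close>)
    then show ?thesis using 2 by (simp add: bump_profile_def)
  next
    case 3
    have "((\<lambda>h. bump_profile k h / h) \<longlongrightarrow> 0) (at 0)"
    proof (rule filterlim_split_at)
      have "\<forall>\<^sub>F h in at_left 0. bump_profile k h / h = 0"
        by (simp add: eventually_at_filter bump_profile_def)
      then show "((\<lambda>h. bump_profile k h / h) \<longlongrightarrow> 0) (at_left 0)"
        by (simp add: tendsto_eventually)
      have "((\<lambda>h::real. inverse h ^ (k + 1) / exp (inverse h)) \<longlongrightarrow> 0) (at_right 0)"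
        using filterlim_compose[OF tendsto_power_div_exp_0[of "k + 1"] filterlim_inverse_at_top_right] by simp
      moreover have "\<forall>\<^sub>F h in at_right 0. inverse h ^ (k + 1) / exp (inverse h) = bump_profile k h / h"
        by (auto simp: eventually_at_filter bump_profile_def exp_minus field_simps)
      ultimately show "((\<lambda>h. bump_profile k h / h) \<longlongrightarrow> 0) (at_right 0)"
        by (rule Lim_transform_eventually)
    qed
    then show ?thesis
      using 3 by (simp add: has_field_derivative_iff bump_profile_def)
  qed
qed

text \<open>An algebra that contains the polynomials and the radial bumps and that is mapped to itself by
  all partial derivatives.  Differentiability of its members therefore implies smoothness.\<close>

inductive_set bump_algebra :: "(real^'n \<Rightarrow> real) set" where
  const: "(\<lambda>x. c) \<in> bump_algebra"
| coord: "(\<lambda>x. x $ i) \<in> bump_algebra"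
| bump: "(\<lambda>x. bump_profile k (r - x \<bullet> x)) \<in> bump_algebra"
| add: "f \<in> bump_algebra \<Longrightarrow> g \<in> bump_algebra \<Longrightarrow> (\<lambda>x. f x + g x) \<in> bump_algebra"
| mult: "f \<in> bump_algebra \<Longrightarrow> g \<in> bump_algebra \<Longrightarrow> (\<lambda>x. f x * g x) \<in> bump_algebra"

lemma bump_algebra_sum:
  "(\<And>i. i \<in> A \<Longrightarrow> f i \<in> bump_algebra) \<Longrightarrow> (\<lambda>x. \<Sum>i\<in>A. f i x) \<in> bump_algebra"
  by (induction A rule: infinite_finite_induct) (auto intro: bump_algebra.intros)

lemma bump_algebra_closed:
  fixes f :: "real^'n \<Rightarrow> real"
  assumes "f \<in> bump_algebra"
  shows "(\<forall>x. f differentiable (at x)) \<and> (\<forall>i. partial_deriv i f \<in> bump_algebra)"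
  using assms
proof induction
  case (const c)
  have "partial_deriv i (\<lambda>x::real^'n. c) = (\<lambda>x. 0)" for i
    by (rule ext, subst partial_deriv_eqI[OF has_derivative_const]) simp
  then show ?case by (auto intro: bump_algebra.const)
next
  case (coord j)
  have d: "((\<lambda>x::real^'n. x $ j) has_derivative (\<lambda>h. h $ j)) (at x)" for x
    by (rule bounded_linear_imp_has_derivative[OF bounded_linear_vec_nth])
  have "partial_deriv i (\<lambda>x::real^'n. x $ j) = (\<lambda>x. axis i 1 $ j)" for i
    by (rule ext, subst partial_deriv_eqI[OF d]) simp
  with d show ?case by (auto intro: bump_algebra.const simp: differentiable_def)
next
  case (bump k r)
  have d: "((\<lambda>x::real^'n. bump_profile k (r - x \<bullet> x)) has_derivative
      (\<lambda>h. (- 2 * (x \<bullet> h)) * (bump_profile (k + 2) (r - x \<bullet> x) - k * bump_profile (k + 1) (r - x \<bullet> x)))) (at x)" for x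
  proof -
    have "((\<lambda>x::real^'n. r - x \<bullet> x) has_derivative (\<lambda>h. - 2 * (x \<bullet> h))) (at x)"
      by (auto intro!: derivative_eq_intros simp: inner_commute)
    from has_derivative_compose[OF this bump_profile_DERIV[of k "r - x \<bullet> x", unfolded has_field_derivative_def]]
    show ?thesis by (simp add: mult.commute)
  qed
  have "partial_deriv i (\<lambda>x::real^'n. bump_profile k (r - x \<bullet> x)) =
      (\<lambda>x. (- 2 * x $ i) * (bump_profile (k + 2) (r - x \<bullet> x) + - real k * bump_profile (k + 1) (r - x \<bullet> x)))" for i
    by (rule ext, subst partial_deriv_eqI[OF d]) (simp add: inner_axis)
  moreover have "\<dots>i \<in> bump_algebra" for i
    by (intro bump_algebra.intros)
  ultimately show ?case using d by (auto simp: differentiable_def)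
next
  case (add f g)
  have "partial_deriv i (\<lambda>x. f x + g x) = (\<lambda>x. partial_deriv i f x + partial_deriv i g x)" for i
    using add.IH
    by (intro ext, subst partial_deriv_eqI[OF has_derivative_add[OF has_derivative_frechet has_derivative_frechet]])
      (auto simp: partial_deriv_def)
  then show ?case using add by (auto intro: bump_algebra.add)
next
  case (mult f g)
  have "partial_deriv i (\<lambda>x. f x * g x) = (\<lambda>x. f x * partial_deriv i g x + partial_deriv i f x * g x)" for i
    using mult.IH
    by (intro ext, subst partial_deriv_eqI[OF has_derivative_mult[OF has_derivative_frechet has_derivative_frechet]])
      (auto simp: partial_deriv_def)
  then show ?case using mult by (auto intro!: bump_algebra.intros)
qed

lemma bump_algebra_smooth:
  assumes "f \<in> bump_algebra" shows "partial_derivs \<alpha> f differentiable (at x)"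
proof -
  have "partial_derivs \<alpha> f \<in> bump_algebra"
    unfolding partial_derivs_def using assms bump_algebra_closed by (induction \<alpha>) auto
  then show ?thesis using bump_algebra_closed by blast
qed

lemma real_polynomial_function_bump_algebra:
  fixes f :: "real^'n \<Rightarrow> real"
  assumes "real_polynomial_function f" shows "f \<in> bump_algebra"
  using assms
proof induction
  case (linear f)
  have "f x = (\<Sum>i\<in>UNIV. x $ i * f (axis i 1))" for x
  proof -
    have "f x = f (\<Sum>i\<in>UNIV. x $ i *\<^sub>R axis i 1)"
      by (simp add: basis_expansion[of x] scalar_mult_eq_scaleR[symmetric])
    then show ?thesis
      by (simp add: bounded_linear.linear[OF linear] linear_sum linear_cmul)
  qed
  then have "f = (\<lambda>x. \<Sum>i\<in>UNIV. x $ i * f (axis i 1))" by blast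
  moreover have "\<dots> \<in> bump_algebra"
    by (intro bump_algebra_sum bump_algebra.intros)
  ultimately show ?case by simp
qed (auto intro: bump_algebra.intros)

subsection \<open>Closure properties of test functions\<close>

text \<open>On Euclidean space a compact support is a bounded one, which is easier to handle.\<close>

lemma test_function_iff:
  fixes \<phi> :: "real^'n \<Rightarrow> real"
  shows "test_function \<phi> \<longleftrightarrow>
     (\<forall>\<alpha> x. partial_derivs \<alpha> \<phi> differentiable (at x)) \<and> (\<exists>R. \<forall>x. norm x > R \<longrightarrow> \<phi> x = 0)"
proof -
  have "compact (closure {x. \<phi> x \<noteq> 0}) \<longleftrightarrow> (\<exists>R. \<forall>x. norm x > R \<longrightarrow> \<phi> x = 0)"
    unfolding compact_closure bounded_iff
    by (simp, metis linorder_not_le)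
  then show ?thesis by (simp add: test_function_def)
qed

lemma test_function_support:
  assumes "test_function \<phi>" obtains R where "R > 0" "\<And>x. norm x > R \<Longrightarrow> \<phi> x = 0"
proof -
  obtain R where R: "\<And>x. norm x > R \<Longrightarrow> \<phi> x = 0"
    using assms test_function_iff by blast
  show ?thesis by (rule that[of "max R 1"]) (auto intro: R)
qed

lemma test_function_differentiable:
  assumes "test_function \<phi>" shows "\<phi> differentiable (at x)"
proof -
  have "partial_derivs [] \<phi> differentiable (at x)"
    using assms test_function_def by blast
  then show ?thesis by (simp add: partial_derivs_def)
qed

lemma test_function_continuous:
  "test_function \<phi> \<Longrightarrow> continuous_on UNIV \<phi>"
  by (simp add: test_function_differentiable continuous_at_imp_continuous_on differentiable_imp_continuous_within)

lemma test_function_partial_deriv: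
  assumes "test_function \<phi>" shows "test_function (partial_deriv i \<phi>)"
proof -
  obtain R where R: "\<And>x. norm x > R \<Longrightarrow> \<phi> x = 0"
    using assms test_function_iff by blast
  have "partial_deriv i \<phi> x = 0" if "norm x > R" for x
  proof -
    have "open {x::real^'n. norm x > R}"
      by (intro open_Collect_less continuous_intros)
    then have "(\<phi> has_derivative (\<lambda>h. 0)) (at x)"
      using that R
      by (intro has_derivative_transform_within_open[where s = "{x. norm x > R}", OF has_derivative_const[of 0]]) auto
    then show ?thesis by (rule partial_deriv_eqI)
  qed
  moreover have "partial_derivs \<alpha> (partial_deriv i \<phi>) = partial_derivs (\<alpha> @ [i]) \<phi>" for \<alpha>
    by (simp add: partial_derivs_def)
  ultimately show ?thesis
    using assms unfolding test_function_iff by metis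
qed

lemma test_function_partial_derivs:
  "test_function \<phi> \<Longrightarrow> test_function (partial_derivs \<alpha> \<phi>)"
  unfolding partial_derivs_def by (induction \<alpha>) (auto intro: test_function_partial_deriv)

lemma partial_deriv_translation:
  "partial_deriv i (\<lambda>x. f (x + h)) x = partial_deriv i f (x + h)"
proof -
  have 1: "((\<lambda>x. f (x + h)) has_derivative D) (at x)" if "(f has_derivative D) (at (x + h))"
    for f :: "real^'n \<Rightarrow> real" and D x h
  proof -
    have "((\<lambda>x. x + h) has_derivative (\<lambda>y. y)) (at x)"
      by (auto intro!: derivative_eq_intros)
    from has_derivative_compose[OF this that] show ?thesis .
  qed
  have "((\<lambda>x. f (x + h)) has_derivative D) (at x) \<longleftrightarrow> (f has_derivative D) (at (x + h))" for D
    using 1[of f D x h] 1[of "\<lambda>x. f (x + h)" D "x + h" "- h"] by auto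
  then show ?thesis by (simp add: partial_deriv_def frechet_derivative_def)
qed

lemma partial_derivs_translation:
  "partial_derivs \<alpha> (\<lambda>x. f (x + h)) = (\<lambda>x. partial_derivs \<alpha> f (x + h))"
  by (induction \<alpha>) (auto simp: partial_derivs_def partial_deriv_translation)

lemma test_function_translation:
  assumes "test_function \<phi>" shows "test_function (\<lambda>x. \<phi> (x + h))"
proof -
  obtain R where R: "\<And>x. norm x > R \<Longrightarrow> \<phi> x = 0"
    using assms test_function_iff by blast
  have "\<phi> (x + h) = 0" if "norm x > R + norm h" for x
    using that norm_triangle_ineq4[of "x + h" h] by (intro R) simp
  moreover have "(\<lambda>x. partial_derivs \<alpha> \<phi> (x + h)) differentiable (at x)" for \<alpha> x
  proof -
    have "partial_derivs \<alpha> \<phi> differentiable (at (x + h))"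
      using assms test_function_def by blast
    then show ?thesis
      using differentiable_chain_at[of "\<lambda>x. x + h" x "partial_derivs \<alpha> \<phi>"] by (simp add: o_def)
  qed
  ultimately show ?thesis
    unfolding test_function_iff partial_derivs_translation by blast
qed

subsection \<open>Continuous functions of bounded support\<close>

lemma bounded_support_L2:
  fixes g :: "real^'n \<Rightarrow> real"
  assumes m: "g \<in> borel_measurable lebesgue" and 0: "\<And>x. norm x > R \<Longrightarrow> g x = 0"
    and e: "\<And>x. \<bar>g x\<bar> \<le> e"
  shows "L2 g" and "norm (cls g) \<le> e * sqrt (measure lebesgue (cball (0::real^'n) R))"
proof -
  have "0 \<le> e" using e[of 0] by linarith
  have i: "integrable lebesgue (\<lambda>x. e\<^sup>2 * indicat_real (cball (0::real^'n) R) x)"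
    using lmeasurable_cball by (intro integrable_mult_right integrable_real_indicator) (auto simp: fmeasurable_def)
  have le: "(g x)\<^sup>2 \<le> e\<^sup>2 * indicat_real (cball 0 R) x" for x
  proof (cases "norm x \<le> R")
    case True
    then show ?thesis using power_mono[OF e abs_ge_zero, of x 2] by (simp add: indicator_def)
  qed (simp add: 0 indicator_def)
  have "integrable lebesgue (\<lambda>x. (g x)\<^sup>2)"
  proof (rule Bochner_Integration.integrable_bound[OF i])
    show "AE x in lebesgue. norm ((g x)\<^sup>2) \<le> norm (e\<^sup>2 * indicat_real (cball 0 R) x)"
      using le order_trans[OF le abs_ge_self] by simp
  qed (use m in auto)
  with m show L: "L2 g" by (simp add: L2_def)
  have "(\<integral>x. (g x)\<^sup>2 \<partial>lebesgue) \<le> (\<integral>x. e\<^sup>2 * indicat_real (cball (0::real^'n) R) x \<partial>lebesgue)"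
    using L le i by (intro integral_mono) (auto simp: L2_def)
  also have "\<dots> = e\<^sup>2 * measure lebesgue (cball (0::real^'n) R)"
    by simp
  finally have "sqrt (\<integral>x. (g x)\<^sup>2 \<partial>lebesgue) \<le> sqrt (e\<^sup>2 * measure lebesgue (cball (0::real^'n) R))"
    by (rule real_sqrt_le_mono)
  then show "norm (cls g) \<le> e * sqrt (measure lebesgue (cball (0::real^'n) R))"
    using \<open>0 \<le> e\<close> by (simp add: norm_cls[OF L] L2norm_def real_sqrt_mult)
qed

lemma continuous_lebesgue_measurable:
  "continuous_on UNIV (g :: real^'n \<Rightarrow> real) \<Longrightarrow> g \<in> borel_measurable lebesgue"
  by (simp add: borel_measurable_continuous_onI measurable_completion)

lemma continuous_bounded_support_bounded:
  fixes g :: "real^'n \<Rightarrow> real"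
  assumes "continuous_on UNIV g" and 0: "\<And>x. norm x > R \<Longrightarrow> g x = 0"
  obtains B where "\<And>x. \<bar>g x\<bar> \<le> B"
proof -
  have "compact (g ` cball 0 R)"
    using assms(1) by (intro compact_continuous_image) (auto intro: continuous_on_subset)
  then obtain B where B: "\<And>y. y \<in> g ` cball 0 R \<Longrightarrow> norm y \<le> B"
    using compact_imp_bounded bounded_iff by metis
  have "\<bar>g x\<bar> \<le> max B 0" for x
  proof (cases "norm x \<le> R")
    case True
    then show ?thesis using B[of "g x"] by auto
  qed (simp add: 0)
  then show ?thesis by (rule that)
qed

lemma continuous_bounded_support_L2:
  fixes g :: "real^'n \<Rightarrow> real"
  assumes "continuous_on UNIV g" and "\<And>x. norm x > R \<Longrightarrow> g x = 0"
  shows "L2 g"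
  using continuous_bounded_support_bounded[OF assms] bounded_support_L2(1) assms
    continuous_lebesgue_measurable by metis

lemma test_function_L2: "test_function \<phi> \<Longrightarrow> L2 \<phi>"
  using test_function_support[of \<phi>] continuous_bounded_support_L2 test_function_continuous by metis

lemma bounded_support_uniformly_continuous:
  fixes g :: "real^'n \<Rightarrow> real"
  assumes c: "continuous_on UNIV g" and 0: "\<And>x. norm x > R \<Longrightarrow> g x = 0" and "e > 0"
  obtains d where "d > 0" "\<And>x y. dist x y < d \<Longrightarrow> \<bar>g x - g y\<bar> < e"
proof -
  have "uniformly_continuous_on (cball 0 (R + 1)) g"
    by (rule compact_uniformly_continuous) (auto intro: continuous_on_subset[OF c])
  then obtain d where d: "d > 0"
      "\<And>x y. norm x \<le> R + 1 \<Longrightarrow> norm y \<le> R + 1 \<Longrightarrow> dist x y < d \<Longrightarrow> dist (g x) (g y) < e"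
    using \<open>e > 0\<close> unfolding uniformly_continuous_on_def by (auto simp: dist_commute)
  show ?thesis
  proof (rule that[of "min d 1"])
    fix x y :: "real^'n" assume xy: "dist x y < min d 1"
    have *: "norm x \<le> norm y + dist x y" "norm y \<le> norm x + dist x y"
      using norm_triangle_sub[of x y] norm_triangle_sub[of y x] by (auto simp: dist_norm norm_minus_commute)
    show "\<bar>g x - g y\<bar> < e"
    proof (cases "norm x \<le> R + 1 \<and> norm y \<le> R + 1")
      case True
      then show ?thesis using d(2)[of x y] xy by (simp add: dist_real_def)
    next
      case False
      then have "norm x > R" "norm y > R" using xy * by auto
      then show ?thesis using 0 \<open>e > 0\<close> by simp
    qed
  qed (use d in auto)
qed

subsection \<open>Density\<close>

text \<open>Dominated convergence, as convergence in the norm of \<open>L\<^sup>2\<close>.\<close>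

lemma cls_tendsto_dominated:
  fixes F :: "nat \<Rightarrow> real^'n \<Rightarrow> real"
  assumes F: "\<And>k. L2 (F k)" and f: "L2 f" and w: "integrable lebesgue w"
    and lim: "AE x in lebesgue. (\<lambda>k. F k x) \<longlonglongrightarrow> f x"
    and dom: "\<And>k. AE x in lebesgue. (F k x - f x)\<^sup>2 \<le> w x"
  shows "(\<lambda>k. cls (F k)) \<longlonglongrightarrow> cls f"
proof -
  have "(\<lambda>k. \<integral>x. (F k x - f x)\<^sup>2 \<partial>lebesgue) \<longlonglongrightarrow> (\<integral>x. (0::real) \<partial>(lebesgue :: (real^'n) measure))"
  proof (rule integral_dominated_convergence[OF _ _ w])
    show "(\<lambda>x. (F k x - f x)\<^sup>2) \<in> borel_measurable lebesgue" for k
      using L2_diff[OF F f] by (auto simp: L2_def)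
    show "AE x in lebesgue. (\<lambda>k. (F k x - f x)\<^sup>2) \<longlonglongrightarrow> 0"
      using lim
    proof eventually_elim
      case (elim x)
      then have "(\<lambda>k. (F k x - f x)\<^sup>2) \<longlonglongrightarrow> (f x - f x)\<^sup>2" by (intro tendsto_intros)
      then show ?case by simp
    qed
    show "AE x in lebesgue. norm ((F k x - f x)\<^sup>2) \<le> w x" for k
      using dom[of k] by simp
  qed auto
  then have "(\<lambda>k. sqrt (\<integral>x. (F k x - f x)\<^sup>2 \<partial>lebesgue)) \<longlonglongrightarrow> sqrt 0"
    by (intro tendsto_real_sqrt) simp
  moreover have "norm (cls (F k) - cls f) = sqrt (\<integral>x. (F k x - f x)\<^sup>2 \<partial>lebesgue)" for k
    using norm_cls[OF L2_diff[OF F f], of k] by (simp add: cls_diff F f L2norm_def)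
  ultimately have "(\<lambda>k. norm (cls (F k) - cls f)) \<longlonglongrightarrow> 0" by simp
  then have "(\<lambda>k. cls (F k) - cls f) \<longlonglongrightarrow> 0" by (rule tendsto_norm_zero_cancel)
  then show ?thesis by (rule LIM_zero_cancel)
qed

text \<open>Divide by a bump \<open>\<beta>\<close> that is positive on the support of \<open>g\<close>, approximate the quotient
  uniformly by a polynomial \<open>p\<close> (Stone--Weierstrass) and multiply again: \<open>\<beta> p\<close> is a test function,
  and the error stays uniformly small with a fixed bounded support.\<close>

lemma continuous_bounded_support_in_closure_test:
  fixes g :: "real^'n \<Rightarrow> real"
  assumes c: "continuous_on UNIV g" and 0: "\<And>x. norm x > R \<Longrightarrow> g x = 0"
  shows "cls g \<in> closure (cls ` Collect test_function)"
proof -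
  define r where "r = max R 1"
  have r: "r \<ge> 1" "\<And>x. norm x > r \<Longrightarrow> g x = 0" unfolding r_def by (auto intro: 0)
  \<comment> \<open>the radius \<open>2 r\<close> keeps \<open>\<beta>\<close> away from \<open>0\<close> on the support of \<open>g\<close>\<close>
  define \<beta> where "\<beta> x = bump_profile 0 ((2 * r)\<^sup>2 - x \<bullet> x)" for x :: "real^'n"
  have \<beta>_alg: "\<beta> \<in> bump_algebra" unfolding \<beta>_def by (rule bump_algebra.bump)
  have \<beta>_pos: "\<beta> x > 0 \<longleftrightarrow> norm x < 2 * r" for x
  proof -
    have "x \<bullet> x < (2 * r)\<^sup>2 \<longleftrightarrow> norm x < 2 * r"
      using r(1) power2_less_imp_less[of "norm x" "2 * r"] power_strict_mono[of "norm x" "2 * r" 2]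
      unfolding power2_norm_eq_inner[symmetric] by auto
    then show ?thesis by (simp add: \<beta>_def bump_profile_def)
  qed
  have \<beta>_bd: "0 \<le> \<beta> x" "\<beta> x \<le> 1" for x by (auto simp: \<beta>_def bump_profile_def)
  have \<beta>_c: "continuous_on UNIV \<beta>"
    using bump_algebra_closed[OF \<beta>_alg]
    by (simp add: continuous_at_imp_continuous_on differentiable_imp_continuous_within)
  define k where "k x = (if norm x \<le> r then g x / \<beta> x else 0)" for x
  have k_c: "continuous_on (cball 0 (2 * r)) k"
  proof -
    have "continuous_on (cball 0 r \<union> (UNIV - ball 0 r)) k"
      unfolding k_def
    proof (rule continuous_on_cases)
      show "continuous_on (cball 0 r) (\<lambda>x. g x / \<beta> x)"
      proof (intro continuous_on_divide)
        show "\<forall>x\<in>cball 0 r. \<beta> x \<noteq> 0"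
        proof
          fix x :: "real^'n" assume "x \<in> cball 0 r"
          then have "\<beta> x > 0" unfolding \<beta>_pos using r(1) by simp
          then show "\<beta> x \<noteq> 0" by simp
        qed
      qed (auto intro: continuous_on_subset[OF c] continuous_on_subset[OF \<beta>_c])
      \<comment> \<open>on the sphere \<open>g\<close> vanishes by continuity, so the two branches of \<open>k\<close> agree there\<close>
      have "g x = 0" if "norm x = r" for x
      proof -
        have "x \<in> closure {x. norm x > r}"
        proof (rule closure_sequential[THEN iffD2], intro exI conjI allI)
          have "norm ((1 + 1 / real (Suc n)) *\<^sub>R x) > r" for n
            using that r(1) by (simp add: field_simps)
          then show "(1 + 1 / real (Suc n)) *\<^sub>R x \<in> {x. norm x > r}" for n by simp
          have "(\<lambda>n. (1 + 1 / real (Suc n)) *\<^sub>R x) \<longlonglongrightarrow> (1 + 0) *\<^sub>R x"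
            by (intro tendsto_intros LIMSEQ_Suc lim_1_over_n)
          then show "(\<lambda>n. (1 + 1 / real (Suc n)) *\<^sub>R x) \<longlonglongrightarrow> x" by simp
        qed
        then show ?thesis
          using continuous_constant_on_closure[of "{x. norm x > r}" g 0 x] continuous_on_subset[OF c] r(2) by auto
      qed
      then show "\<forall>x. x \<in> cball 0 r \<and> \<not> norm x \<le> r \<or> x \<in> UNIV - ball 0 r \<and> norm x \<le> r \<longrightarrow> g x / \<beta> x = 0"
        by auto
    qed auto
    then show ?thesis by (rule continuous_on_subset) auto
  qed
  show ?thesis
  proof (subst closure_approachable, intro allI impI)
    fix e :: real assume "e > 0"
    define M where "M = sqrt (measure lebesgue (cball (0::real^'n) (2 * r)))"
    have "M \<ge> 0" by (simp add: M_def)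
    define \<epsilon> where "\<epsilon> = e / (M + 1)"
    have \<epsilon>: "\<epsilon> > 0" "\<epsilon> * M < e"
      using \<open>e > 0\<close> \<open>M \<ge> 0\<close> by (auto simp: \<epsilon>_def field_simps)
    obtain p where p: "real_polynomial_function p" "\<And>x. x \<in> cball 0 (2 * r) \<Longrightarrow> \<bar>k x - p x\<bar> < \<epsilon>"
      using Stone_Weierstrass_real_polynomial_function[OF compact_cball k_c \<epsilon>(1)] by blast
    define \<phi> where "\<phi> x = \<beta> x * p x" for x
    have \<phi>0: "\<phi> x = 0" if "norm x > 2 * r" for x
      using \<beta>_pos[of x] \<beta>_bd[of x] that by (simp add: \<phi>_def)
    have "\<phi> \<in> bump_algebra" unfolding \<phi>_def
      by (intro bump_algebra.mult \<beta>_alg real_polynomial_function_bump_algebra p(1))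
    then have \<phi>: "test_function \<phi>"
      unfolding test_function_iff using bump_algebra_smooth \<phi>0 by blast
    have diff0: "\<phi> x - g x = 0" if "norm x > 2 * r" for x
      using \<phi>0[OF that] r that by simp
    have le: "\<bar>\<phi> x - g x\<bar> \<le> \<epsilon>" for x
    proof (cases "norm x < 2 * r")
      case True
      then have "\<beta> x \<noteq> 0" using \<beta>_pos[of x] by simp
      have "g x = \<beta> x * k x" using \<open>\<beta> x \<noteq> 0\<close> r(2)[of x] by (simp add: k_def)
      then have "\<phi> x - g x = \<beta> x * (p x - k x)" by (simp add: \<phi>_def algebra_simps)
      then have "\<bar>\<phi> x - g x\<bar> = \<beta> x * \<bar>k x - p x\<bar>"
        using \<beta>_bd[of x] by (simp add: abs_mult abs_minus_commute)
      also have "\<dots> \<le> 1 * \<epsilon>"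
        using \<beta>_bd[of x] p(2)[of x] True by (intro mult_mono) auto
      finally show ?thesis by simp
    next
      case False
      then have "\<beta> x = 0" "g x = 0" using \<beta>_pos[of x] \<beta>_bd[of x] r by auto
      then show ?thesis using \<epsilon>(1) by (simp add: \<phi>_def)
    qed
    have gL: "L2 g" by (rule continuous_bounded_support_L2[OF c 0])
    have "norm (cls (\<lambda>x. \<phi> x - g x)) \<le> \<epsilon> * M"
      unfolding M_def
      by (rule bounded_support_L2(2)[OF _ diff0 le])
        (use test_function_L2[OF \<phi>] gL in \<open>auto simp: L2_def\<close>)
    then have "dist (cls \<phi>) (cls g) < e"
      using \<epsilon>(2) by (simp add: dist_norm cls_diff test_function_L2[OF \<phi>] gL)
    then show "\<exists>y\<in>cls ` Collect test_function. dist y (cls g) < e"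
      using \<phi> by blast
  qed
qed

text \<open>A square integrable function is almost everywhere a limit of continuous functions.  Truncating
  values and support makes this limit dominated; then the truncation is removed.\<close>

theorem test_functions_dense: "closure (cls ` Collect test_function) = (UNIV :: ('n::finite) l2 set)"
proof -
  let ?C = "closure (cls ` Collect test_function) :: 'n l2 set"
  have "F \<in> ?C" for F :: "'n l2"
  proof -
    obtain f where F: "F = cls f" and f: "L2 f" by (rule cls_surj)
    have "f measurable_on UNIV"
      using f lebesgue_measurable_imp_measurable_on[of f UNIV] by (simp add: L2_def)
    then obtain N g where N: "negligible N" and g: "\<And>n. continuous_on UNIV (g n)"
      and gf: "\<And>x. x \<notin> N \<Longrightarrow> (\<lambda>n. g n x) \<longlonglongrightarrow> f x"
      unfolding measurable_on_def by auto
    have AEN: "AE x in lebesgue. x \<notin> N"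
      using N by (simp add: negligible_iff_null_sets AE_not_in)
    define clamp where "clamp R y = max (- R) (min R y)" for R y :: real
    define \<eta> where "\<eta> R x = max 0 (min 1 (R + 1 - norm x))" for R and x :: "real^'n"
    define h where "h m n x = clamp (real m) (g n x) * \<eta> (real m) x" for m n x
    define H where "H m x = clamp (real m) (f x) * \<eta> (real m) x" for m x
    have clamp_le: "\<bar>clamp (real m) y\<bar> \<le> real m" for m y by (auto simp: clamp_def)
    have \<eta>_bd: "0 \<le> \<eta> R x" "\<eta> R x \<le> 1" for R x by (auto simp: \<eta>_def)
    have \<eta>_0: "\<eta> R x = 0" if "norm x > R + 1" for R x using that by (simp add: \<eta>_def)
    have bd: "\<bar>clamp (real m) y * \<eta> (real m) x\<bar> \<le> real m" for m y x
    proof -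
      have "\<bar>clamp (real m) y\<bar> * \<bar>\<eta> (real m) x\<bar> \<le> real m * 1"
        using \<eta>_bd[of "real m" x] by (intro mult_mono clamp_le) auto
      then show ?thesis by (simp add: abs_mult)
    qed
    have h_c: "continuous_on UNIV (h m n)" for m n
      unfolding h_def clamp_def \<eta>_def by (intro continuous_intros g)
    have h_0: "h m n x = 0" if "norm x > real m + 1" for m n x using \<eta>_0[OF that] by (simp add: h_def)
    have H_0: "H m x = 0" if "norm x > real m + 1" for m x using \<eta>_0[OF that] by (simp add: H_def)
    have fm: "f \<in> borel_measurable lebesgue" using f by (simp add: L2_def)
    have H_m: "H m \<in> borel_measurable lebesgue" for m
    proof -
      have "\<eta> (real m) \<in> borel_measurable lebesgue"
        by (rule continuous_lebesgue_measurable) (auto simp: \<eta>_def intro!: continuous_intros)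
      then show ?thesis unfolding H_def clamp_def
        by (intro borel_measurable_times borel_measurable_max borel_measurable_min borel_measurable_const fm)
    qed
    have H_bd: "\<bar>H m x\<bar> \<le> real m" for m x unfolding H_def by (rule bd)
    have H_L2: "L2 (H m)" for m by (rule bounded_support_L2(1)[OF H_m H_0 H_bd])
    have h_L2: "L2 (h m n)" for m n by (rule continuous_bounded_support_L2[OF h_c h_0])
    have mem: "cls (H m) \<in> ?C" for m
    proof -
      have lim: "(\<lambda>n. cls (h m n)) \<longlonglongrightarrow> cls (H m)"
      proof (rule cls_tendsto_dominated[OF h_L2 H_L2])
        show "integrable lebesgue (\<lambda>x. (2 * real m)\<^sup>2 * indicat_real (cball (0::real^'n) (real m + 1)) x)"
          using lmeasurable_cball
          by (intro integrable_mult_right integrable_real_indicator) (auto simp: fmeasurable_def)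
        show "AE x in lebesgue. (\<lambda>n. h m n x) \<longlonglongrightarrow> H m x"
          using AEN
        proof eventually_elim
          case (elim x)
          show ?case unfolding h_def H_def clamp_def by (intro tendsto_intros gf elim)
        qed
        have "(h m n x - H m x)\<^sup>2 \<le> (2 * real m)\<^sup>2 * indicat_real (cball (0::real^'n) (real m + 1)) x" for n x
        proof (cases "norm x \<le> real m + 1")
          case True
          have "\<bar>h m n x\<bar> \<le> real m" unfolding h_def by (rule bd)
          then have "\<bar>h m n x - H m x\<bar> \<le> 2 * real m" using H_bd[of m x] by linarith
          then have "\<bar>h m n x - H m x\<bar>\<^sup>2 \<le> (2 * real m)\<^sup>2" by (intro power_mono) auto
          then show ?thesis using True by (simp add: indicator_def)
        qed (simp add: h_0 H_0 indicator_def)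
        then show "AE x in lebesgue. (h m n x - H m x)\<^sup>2
            \<le> (2 * real m)\<^sup>2 * indicat_real (cball (0::real^'n) (real m + 1)) x" for n by simp
      qed
      have mem: "cls (h m n) \<in> ?C" for n
        by (rule continuous_bounded_support_in_closure_test[OF h_c h_0])
      show ?thesis by (rule closed_sequentially[OF closed_closure mem lim])
    qed
    have lim: "(\<lambda>m. cls (H m)) \<longlonglongrightarrow> cls f"
    proof (rule cls_tendsto_dominated[OF H_L2 f])
      show "integrable lebesgue (\<lambda>x. (f x)\<^sup>2)" using f by (simp add: L2_def)
      have "\<bar>clamp (real m) y * c - y\<bar> \<le> \<bar>y\<bar>" if c: "0 \<le> c" "c \<le> 1" for m y c
      proof (cases "0 \<le> y")
        case True
        then have z: "0 \<le> clamp (real m) y" "clamp (real m) y \<le> y" by (auto simp: clamp_def)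
        have "0 \<le> clamp (real m) y * c" "clamp (real m) y * c \<le> clamp (real m) y"
          using z c by (auto intro: mult_left_le)
        then show ?thesis using z True by linarith
      next
        case False
        then have z: "clamp (real m) y \<le> 0" "y \<le> clamp (real m) y" by (auto simp: clamp_def)
        have "clamp (real m) y * c \<le> 0" using z c by (simp add: mult_nonpos_nonneg)
        moreover have "- clamp (real m) y * c \<le> - clamp (real m) y"
          using z c by (intro mult_left_le) auto
        ultimately show ?thesis using z False by simp
      qed
      then have "\<bar>H m x - f x\<bar> \<le> \<bar>f x\<bar>" for m x unfolding H_def using \<eta>_bd by blast
      then have "(H m x - f x)\<^sup>2 \<le> (f x)\<^sup>2" for m x by (simp add: abs_le_square_iff)
      then show "AE x in lebesgue. (H m x - f x)\<^sup>2 \<le> (f x)\<^sup>2" for m by simp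
      have "(\<lambda>m. H m x) \<longlonglongrightarrow> f x" for x
      proof (rule tendsto_eventually)
        obtain m0 :: nat where m0: "real m0 \<ge> max \<bar>f x\<bar> (norm x)" using real_arch_simple by blast
        show "\<forall>\<^sub>F m in sequentially. H m x = f x"
          using eventually_ge_at_top[of m0]
        proof eventually_elim
          case (elim m)
          then have "real m0 \<le> real m" by simp
          then have "\<bar>f x\<bar> \<le> real m" "norm x \<le> real m" using m0 by linarith+
          then show ?case by (auto simp: H_def clamp_def \<eta>_def max_def min_def)
        qed
      qed
      then show "AE x in lebesgue. (\<lambda>m. H m x) \<longlonglongrightarrow> f x" by simp
    qed
    show ?thesis unfolding F by (rule closed_sequentially[OF closed_closure mem lim])
  qed
  then show ?thesis by blast
qed

lemma test_functions_approximate: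
  obtains \<phi> where "\<And>n. test_function (\<phi> n)" "(\<lambda>n. cls (\<phi> n)) \<longlonglongrightarrow> F"
proof -
  have "F \<in> closure (cls ` Collect test_function)" by (simp add: test_functions_dense)
  then have "\<exists>y. (\<forall>n. y n \<in> cls ` Collect test_function) \<and> y \<longlonglongrightarrow> F"
    by (simp only: closure_sequential)
  then obtain y where y: "\<forall>n. y n \<in> cls ` Collect test_function" and lim: "y \<longlonglongrightarrow> F"
    by (elim exE conjE)
  have "\<forall>n. \<exists>\<phi>. test_function \<phi> \<and> y n = cls \<phi>" using y by (simp add: image_iff)
  then obtain \<phi> where \<phi>: "\<forall>n. test_function (\<phi> n) \<and> y n = cls (\<phi> n)"
    using choice[of "\<lambda>n \<phi>. test_function \<phi> \<and> y n = cls \<phi>"] by auto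
  have "y = (\<lambda>n. cls (\<phi> n))" using \<phi> by (simp add: fun_eq_iff)
  with lim have "(\<lambda>n. cls (\<phi> n)) \<longlonglongrightarrow> F" by simp
  with \<phi> show ?thesis by (intro that[of \<phi>]) simp_all
qed

text \<open>Density in the form in which it is used: the norm is computed by pairing with test functions.\<close>

lemma norm_le_by_test_functions:
  assumes "0 \<le> M" and le: "\<And>\<phi>. test_function \<phi> \<Longrightarrow> \<bar>inner F (cls \<phi>)\<bar> \<le> M * norm (cls \<phi>)"
  shows "norm F \<le> M"
proof -
  obtain \<phi> where \<phi>: "\<And>n. test_function (\<phi> n)" "(\<lambda>n. cls (\<phi> n)) \<longlonglongrightarrow> F"
    using test_functions_approximate[where F = F] by metis
  have "\<bar>inner F F\<bar> \<le> M * norm F"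
  proof (rule LIMSEQ_le)
    show "(\<lambda>n. \<bar>inner F (cls (\<phi> n))\<bar>) \<longlonglongrightarrow> \<bar>inner F F\<bar>"
      by (intro tendsto_intros \<phi>(2))
    show "(\<lambda>n. M * norm (cls (\<phi> n))) \<longlonglongrightarrow> M * norm F"
      by (intro tendsto_intros \<phi>(2))
    show "\<exists>N. \<forall>n\<ge>N. \<bar>inner F (cls (\<phi> n))\<bar> \<le> M * norm (cls (\<phi> n))"
      by (intro exI[of _ 0] allI impI le \<phi>(1))
  qed
  then have *: "norm F * norm F \<le> M * norm F"
    by (simp add: dot_square_norm power2_eq_square)
  show ?thesis
  proof (cases "F = 0")
    case True
    then show ?thesis using \<open>0 \<le> M\<close> by simp
  next
    case False
    with * show ?thesis by simp
  qed
qed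

section \<open>Weak derivatives and translations\<close>

lemma l2_eqI_test_functions:
  assumes "\<And>\<phi>. test_function \<phi> \<Longrightarrow> inner F (cls \<phi>) = inner G (cls \<phi>)"
  shows "F = G"
proof -
  have "norm (F - G) \<le> 0"
    by (rule norm_le_by_test_functions) (simp_all add: inner_diff_left assms)
  then show ?thesis by simp
qed

text \<open>The weak derivative as a relation on classes; the relation form suits the unbounded operator,
  which need not be defined everywhere.\<close>

definition wderiv :: "('n::finite) list \<Rightarrow> 'n l2 \<Rightarrow> 'n l2 \<Rightarrow> bool" where
  "wderiv \<alpha> F G \<longleftrightarrow> (\<forall>\<phi>. test_function \<phi> \<longrightarrow>
     inner F (cls (partial_derivs \<alpha> \<phi>)) = (-1) ^ length \<alpha> * inner G (cls \<phi>))"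

lemma wderivD:
  "wderiv \<alpha> F G \<Longrightarrow> test_function \<phi> \<Longrightarrow>
     inner F (cls (partial_derivs \<alpha> \<phi>)) = (-1) ^ length \<alpha> * inner G (cls \<phi>)"
  by (simp add: wderiv_def)

lemma wderiv_unique:
  assumes "wderiv \<alpha> F G" "wderiv \<alpha> F H" shows "G = H"
proof (rule l2_eqI_test_functions)
  fix \<phi> :: "real^'a \<Rightarrow> real" assume "test_function \<phi>"
  then have "(-1) ^ length \<alpha> * inner G (cls \<phi>) = (-1) ^ length \<alpha> * inner H (cls \<phi>)"
    by (simp only: wderivD[OF assms(1), symmetric] wderivD[OF assms(2), symmetric])
  then show "inner G (cls \<phi>) = inner H (cls \<phi>)" by simp
qed

lemma wderiv_Nil: "wderiv [] F G \<longleftrightarrow> F = G"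
proof
  assume "wderiv [] F G"
  then show "F = G"
    by (intro l2_eqI_test_functions) (simp add: wderiv_def partial_derivs_def)
qed (simp add: wderiv_def partial_derivs_def)

lemma wderiv_add: "wderiv \<alpha> F G \<Longrightarrow> wderiv \<alpha> F' G' \<Longrightarrow> wderiv \<alpha> (F + F') (G + G')"
  by (simp add: wderiv_def inner_add_left distrib_left)

lemma wderiv_diff: "wderiv \<alpha> F G \<Longrightarrow> wderiv \<alpha> F' G' \<Longrightarrow> wderiv \<alpha> (F - F') (G - G')"
  by (simp add: wderiv_def inner_diff_left right_diff_distrib)

lemma wderiv_scaleR: "wderiv \<alpha> F G \<Longrightarrow> wderiv \<alpha> (c *\<^sub>R F) (c *\<^sub>R G)"
  by (simp add: wderiv_def)

lemma wderiv_sum: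
  "(\<And>i. i \<in> A \<Longrightarrow> wderiv \<alpha> (F i) (G i)) \<Longrightarrow> wderiv \<alpha> (\<Sum>i\<in>A. F i) (\<Sum>i\<in>A. G i)"
  by (induction A rule: infinite_finite_induct) (simp_all add: wderiv_add, simp_all add: wderiv_def)

text \<open>A derivative along a longer multi-index is the derivative of a derivative; note that the later
  entries of the list act last on the weak side, though first on the test function.\<close>

lemma wderiv_append:
  assumes "wderiv \<alpha> F G" shows "wderiv (\<alpha> @ \<beta>) F H \<longleftrightarrow> wderiv \<beta> G H"
proof -
  have "inner F (cls (partial_derivs (\<alpha> @ \<beta>) \<phi>)) =
      (-1) ^ length \<alpha> * inner G (cls (partial_derivs \<beta> \<phi>))" if "test_function \<phi>" for \<phi>
    using wderivD[OF assms test_function_partial_derivs[OF that, of \<beta>]]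
    by (simp add: partial_derivs_def)
  then show ?thesis by (auto simp: wderiv_def power_add)
qed

lemma shift_cls_test:
  "test_function \<phi> \<Longrightarrow> shift h (cls (partial_derivs \<alpha> \<phi>)) = cls (partial_derivs \<alpha> (\<lambda>x. \<phi> (x + h)))"
  by (simp add: shift_cls test_function_L2 test_function_partial_derivs partial_derivs_translation)

lemma wderiv_shift:
  assumes "wderiv \<alpha> F G" shows "wderiv \<alpha> (shift h F) (shift h G)"
  unfolding wderiv_def
proof (intro allI impI)
  fix \<phi> :: "real^'a \<Rightarrow> real" assume \<phi>: "test_function \<phi>"
  have "inner (shift h F) (cls (partial_derivs \<alpha> \<phi>)) = inner F (cls (partial_derivs \<alpha> (\<lambda>x. \<phi> (x + - h))))"
    by (simp only: inner_shift_left shift_cls_test[OF \<phi>])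
  also have "\<dots> = (-1) ^ length \<alpha> * inner G (cls (\<lambda>x. \<phi> (x + - h)))"
    by (rule wderivD[OF assms test_function_translation[OF \<phi>]])
  also have "inner G (cls (\<lambda>x. \<phi> (x + - h))) = inner (shift h G) (cls \<phi>)"
    by (simp only: inner_shift_left shift_cls[OF test_function_L2[OF \<phi>]])
  finally show "inner (shift h F) (cls (partial_derivs \<alpha> \<phi>)) = (-1) ^ length \<alpha> * inner (shift h G) (cls \<phi>)" .
qed

text \<open>Weak differentiation is a closed operator.\<close>

lemma wderiv_limit:
  fixes F G :: "('n::finite) l2"
  assumes "(f \<longlongrightarrow> F) net" "(g \<longlongrightarrow> G) net" "net \<noteq> bot" "\<forall>\<^sub>F x in net. wderiv \<alpha> (f x) (g x)"
  shows "wderiv \<alpha> F G"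
  unfolding wderiv_def
proof (intro allI impI)
  fix \<phi> :: "real^'n \<Rightarrow> real" assume \<phi>: "test_function \<phi>"
  have 1: "((\<lambda>x. inner (f x) (cls (partial_derivs \<alpha> \<phi>))) \<longlongrightarrow> inner F (cls (partial_derivs \<alpha> \<phi>))) net"
    by (intro tendsto_intros assms)
  have 2: "((\<lambda>x. (-1) ^ length \<alpha> * inner (g x) (cls \<phi>)) \<longlongrightarrow> (-1) ^ length \<alpha> * inner G (cls \<phi>)) net"
    by (intro tendsto_intros assms)
  have "\<forall>\<^sub>F x in net. inner (f x) (cls (partial_derivs \<alpha> \<phi>)) = (-1) ^ length \<alpha> * inner (g x) (cls \<phi>)"
    using assms(4) by eventually_elim (rule wderivD[OF _ \<phi>])
  from Lim_transform_eventually[OF 1 this] 2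
  show "inner F (cls (partial_derivs \<alpha> \<phi>)) = (-1) ^ length \<alpha> * inner G (cls \<phi>)"
    by (rule tendsto_unique[OF assms(3)])
qed

subsection \<open>From weak to strong differentiability\<close>

text \<open>The form of differentiability in terms of difference quotients, to be matched with the
  definition of time derivatives of Sobolev functions.\<close>

lemma has_vector_derivative_quotient:
  fixes f :: "real \<Rightarrow> 'a::real_normed_vector"
  shows "(f has_vector_derivative D) (at t within S) \<longleftrightarrow>
     ((\<lambda>s. (1 / (s - t)) *\<^sub>R (f s - f t)) \<longlongrightarrow> D) (at t within S)"
proof -
  have "(f has_vector_derivative D) (at t within S) \<longleftrightarrow>
      ((\<lambda>s. norm (f s - f t - (s - t) *\<^sub>R D) / norm (s - t)) \<longlongrightarrow> 0) (at t within S)"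
    by (simp add: has_vector_derivative_def has_derivative_iff_norm bounded_linear_scaleR_left)
  also have "\<dots> \<longleftrightarrow> ((\<lambda>s. norm ((1 / (s - t)) *\<^sub>R (f s - f t) - D)) \<longlongrightarrow> 0) (at t within S)"
  proof (rule filterlim_cong[OF refl refl])
    show "\<forall>\<^sub>F s in at t within S. norm (f s - f t - (s - t) *\<^sub>R D) / norm (s - t) =
        norm ((1 / (s - t)) *\<^sub>R (f s - f t) - D)"
    proof (rule eventually_at_filter[THEN iffD2], intro always_eventually allI impI)
      fix s assume "s \<noteq> t"
      then have "(1 / (s - t)) *\<^sub>R (f s - f t) - D = (1 / (s - t)) *\<^sub>R (f s - f t - (s - t) *\<^sub>R D)"
        by (simp add: scaleR_diff_right)
      then show "norm (f s - f t - (s - t) *\<^sub>R D) / norm (s - t) = norm ((1 / (s - t)) *\<^sub>R (f s - f t) - D)"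
        by simp
    qed
  qed
  also have "\<dots> \<longleftrightarrow> ((\<lambda>s. (1 / (s - t)) *\<^sub>R (f s - f t)) \<longlongrightarrow> D) (at t within S)"
    unfolding tendsto_norm_zero_iff by (rule Lim_null[symmetric])
  finally show ?thesis .
qed

text \<open>For each test function the mean value inequality estimates the increment of
  \<open>r \<mapsto> \<langle>P r - r Q t, \<phi>\<rangle>\<close> by the oscillation of \<open>Q\<close> near \<open>t\<close>, uniformly for \<open>\<parallel>\<phi>\<parallel> \<le> 1\<close>; by density this is an
  estimate in norm.\<close>

lemma strong_derivative_of_weak:
  fixes P Q :: "real \<Rightarrow> ('n::finite) l2"
  assumes S: "convex S" and t: "t \<in> S" and Q: "continuous (at t within S) Q"
    and weak: "\<And>\<phi> s. test_function \<phi> \<Longrightarrow> s \<in> S \<Longrightarrow>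
      ((\<lambda>s. inner (P s) (cls \<phi>)) has_real_derivative inner (Q s) (cls \<phi>)) (at s within S)"
  shows "(P has_vector_derivative Q t) (at t within S)"
  unfolding has_vector_derivative_def has_derivative_within_alt
proof (intro conjI allI impI)
  show "bounded_linear (\<lambda>x. x *\<^sub>R Q t)" by (rule bounded_linear_scaleR_left)
  fix e :: real assume e: "e > 0"
  obtain d where d: "d > 0" "\<And>s. s \<in> S \<Longrightarrow> dist s t < d \<Longrightarrow> dist (Q s) (Q t) < e"
    using Q e unfolding continuous_within_eps_delta by blast
  show "\<exists>d>0. \<forall>s\<in>S. norm (s - t) < d \<longrightarrow> norm (P s - P t - (s - t) *\<^sub>R Q t) \<le> e * norm (s - t)"
  proof (intro exI[of _ d] conjI ballI impI d(1))
    fix s assume s: "s \<in> S" "norm (s - t) < d"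
    show "norm (P s - P t - (s - t) *\<^sub>R Q t) \<le> e * norm (s - t)"
    proof (rule norm_le_by_test_functions)
      show "0 \<le> e * norm (s - t)" using e by simp
      fix \<phi> :: "real^'n \<Rightarrow> real" assume \<phi>: "test_function \<phi>"
      define X where "X = S \<inter> ball t d"
      define g where "g r = inner (P r) (cls \<phi>) - r * inner (Q t) (cls \<phi>)" for r
      have "norm (g s - g t) \<le> (e * norm (cls \<phi>)) * norm (s - t)"
      proof (rule field_differentiable_bound)
        show "convex X" unfolding X_def by (intro convex_Int S convex_ball)
        fix r assume r: "r \<in> X"
        then have "r \<in> S" by (simp add: X_def)
        from weak[OF \<phi> this] have "((\<lambda>s. inner (P s) (cls \<phi>)) has_real_derivative inner (Q r) (cls \<phi>)) (at r within X)"
          by (rule DERIV_subset) (simp add: X_def)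
        moreover have "((\<lambda>r. r * inner (Q t) (cls \<phi>)) has_real_derivative inner (Q t) (cls \<phi>)) (at r within X)"
          by (auto intro!: derivative_eq_intros)
        ultimately show "(g has_real_derivative inner (Q r - Q t) (cls \<phi>)) (at r within X)"
          unfolding g_def inner_diff_left by (rule DERIV_diff)
        have "norm (Q r - Q t) \<le> e"
          using d(2)[of r] r by (simp add: X_def dist_norm abs_minus_commute)
        then show "norm (inner (Q r - Q t) (cls \<phi>)) \<le> e * norm (cls \<phi>)"
          using Cauchy_Schwarz_ineq2[of "Q r - Q t" "cls \<phi>"] mult_right_mono[of "norm (Q r - Q t)" e "norm (cls \<phi>)"]
          by simp
      qed (use s t d(1) in \<open>auto simp: X_def dist_norm norm_minus_commute\<close>)
      moreover have "g s - g t = inner (P s - P t - (s - t) *\<^sub>R Q t) (cls \<phi>)"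
        by (simp add: g_def inner_diff_left algebra_simps)
      ultimately show "\<bar>inner (P s - P t - (s - t) *\<^sub>R Q t) (cls \<phi>)\<bar> \<le> e * norm (s - t) * norm (cls \<phi>)"
        by (simp add: mult.commute mult.left_commute)
    qed
  qed
qed

text \<open>A space derivative may be taken through the time derivative as soon as the candidate for the
  mixed derivative is continuous in time.\<close>

lemma wderiv_time_derivative:
  fixes F G F' G' :: "real \<Rightarrow> ('n::finite) l2"
  assumes S: "convex S"
    and F: "\<And>s. s \<in> S \<Longrightarrow> (F has_vector_derivative F' s) (at s within S)"
    and G: "\<And>s. s \<in> S \<Longrightarrow> wderiv \<alpha> (F s) (G s)"
    and G': "\<And>s. s \<in> S \<Longrightarrow> wderiv \<alpha> (F' s) (G' s)"
    and cont: "continuous_on S G'" and t: "t \<in> S"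
  shows "(G has_vector_derivative G' t) (at t within S)"
proof (rule strong_derivative_of_weak[OF S t])
  show "continuous (at t within S) G'" using cont t by (simp add: continuous_on_eq_continuous_within)
  fix \<phi> :: "real^'n \<Rightarrow> real" and s assume \<phi>: "test_function \<phi>" and s: "s \<in> S"
  have sq: "(-1) ^ length \<alpha> * ((-1) ^ length \<alpha> * x) = x" for x :: real
    by (simp add: mult.assoc[symmetric] power_add[symmetric])
  have "((\<lambda>s. inner (F s) (cls (partial_derivs \<alpha> \<phi>))) has_real_derivative inner (F' s) (cls (partial_derivs \<alpha> \<phi>))) (at s within S)"
    using bounded_linear.has_vector_derivative[OF bounded_linear_inner_left F[OF s]]
    by (simp add: has_real_derivative_iff_has_vector_derivative)
  then have "((\<lambda>s. (-1) ^ length \<alpha> * inner (F s) (cls (partial_derivs \<alpha> \<phi>))) has_real_derivative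
      (-1) ^ length \<alpha> * inner (F' s) (cls (partial_derivs \<alpha> \<phi>))) (at s within S)"
    by (rule DERIV_cmult)
  then have "((\<lambda>s. (-1) ^ length \<alpha> * inner (F s) (cls (partial_derivs \<alpha> \<phi>))) has_real_derivative
      inner (G' s) (cls \<phi>)) (at s within S)"
    by (simp only: wderivD[OF G'[OF s] \<phi>] sq)
  then show "((\<lambda>s. inner (G s) (cls \<phi>)) has_real_derivative inner (G' s) (cls \<phi>)) (at s within S)"
    by (rule has_field_derivative_transform_within[OF _ zero_less_one s])
      (simp only: wderivD[OF G \<phi>] sq)
qed

subsection \<open>Translation as a differentiable motion\<close>

text \<open>For a test function the difference quotients converge uniformly, with supports in a fixed ball,
  because the partial derivative is uniformly continuous.\<close>

lemma shift_test_has_vector_derivative: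
  fixes \<phi> :: "real^'n \<Rightarrow> real"
  assumes \<phi>: "test_function \<phi>"
  shows "((\<lambda>s. shift (s *\<^sub>R axis i 1) (cls \<phi>)) has_vector_derivative
           shift (s *\<^sub>R axis i 1) (cls (partial_deriv i \<phi>))) (at s)"
  unfolding has_vector_derivative_quotient
proof (rule tendstoI)
  let ?e = "axis i 1 :: real^'n"
  fix \<epsilon> :: real assume \<epsilon>: "\<epsilon> > 0"
  obtain R where R: "R > 0" "\<And>x. norm x > R \<Longrightarrow> \<phi> x = 0" by (rule test_function_support[OF \<phi>]) blast
  note d\<phi> = test_function_partial_deriv[OF \<phi>, of i]
  obtain R' where R': "R' > 0" "\<And>x. norm x > R' \<Longrightarrow> partial_deriv i \<phi> x = 0"
    by (rule test_function_support[OF d\<phi>]) blast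
  \<comment> \<open>contains the supports of all translates by parameters at distance at most \<open>1\<close> from \<open>s\<close>\<close>
  define \<rho> where "\<rho> = R + R' + \<bar>s\<bar> + 1"
  define M where "M = sqrt (measure lebesgue (cball (0::real^'n) \<rho>))"
  have "M \<ge> 0" by (simp add: M_def)
  define \<delta> where "\<delta> = \<epsilon> / (M + 1)"
  have \<delta>: "\<delta> > 0" "\<delta> * M < \<epsilon>" using \<epsilon> \<open>M \<ge> 0\<close> by (auto simp: \<delta>_def field_simps)
  obtain d where d: "d > 0" "\<And>x y. dist x y < d \<Longrightarrow> \<bar>partial_deriv i \<phi> x - partial_deriv i \<phi> y\<bar> < \<delta>"
    using bounded_support_uniformly_continuous[OF test_function_continuous[OF d\<phi>] R'(2) \<delta>(1)] by metis
  have L: "L2 (\<lambda>x. \<phi> (x + h))" "L2 (\<lambda>x. partial_deriv i \<phi> (x + h))" for h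
    by (intro L2_translation test_function_L2 \<phi> d\<phi>)+
  have bound: "dist ((1 / (r - s)) *\<^sub>R (shift (r *\<^sub>R ?e) (cls \<phi>) - shift (s *\<^sub>R ?e) (cls \<phi>)))
      (shift (s *\<^sub>R ?e) (cls (partial_deriv i \<phi>))) < \<epsilon>" if r: "r \<noteq> s" "dist r s < min d 1" for r
  proof -
    define g where "g x = (1 / (r - s)) * (\<phi> (x + r *\<^sub>R ?e) - \<phi> (x + s *\<^sub>R ?e)) - partial_deriv i \<phi> (x + s *\<^sub>R ?e)" for x
    have gL: "L2 g" unfolding g_def by (intro L2_diff L2_scale L)
    have g0: "g x = 0" if x: "norm x > \<rho>" for x
    proof -
      have *: "norm (x + c *\<^sub>R ?e) > R + R'" if "\<bar>c\<bar> \<le> \<bar>s\<bar> + 1" for c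
        using norm_triangle_ineq4[of "x + c *\<^sub>R ?e" "c *\<^sub>R ?e"] x that by (simp add: \<rho>_def)
      have "\<bar>r - s\<bar> < 1" using r by (simp add: dist_real_def)
      then have "\<bar>r\<bar> \<le> \<bar>s\<bar> + 1" by linarith
      with *[of r] *[of s] R(1) R'(1) show ?thesis by (simp add: g_def R(2) R'(2))
    qed
    have g\<delta>: "\<bar>g x\<bar> \<le> \<delta>" for x
    proof -
      have D: "((\<lambda>c. \<phi> (x + c *\<^sub>R ?e)) has_real_derivative partial_deriv i \<phi> (x + c *\<^sub>R ?e)) (at c)" for c
      proof -
        have 1: "((\<lambda>c. x + c *\<^sub>R ?e) has_derivative (\<lambda>c. c *\<^sub>R ?e)) (at c)"
          by (auto intro!: derivative_eq_intros)
        have 2: "(\<phi> has_derivative frechet_derivative \<phi> (at (x + c *\<^sub>R ?e))) (at (x + c *\<^sub>R ?e))"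
          by (rule has_derivative_frechet[OF test_function_differentiable[OF \<phi>]])
        have "frechet_derivative \<phi> (at (x + c *\<^sub>R ?e)) (b *\<^sub>R ?e) = partial_deriv i \<phi> (x + c *\<^sub>R ?e) * b" for b
          using linear_cmul[OF has_derivative_linear[OF 2]] by (simp add: partial_deriv_def)
        with has_derivative_compose[OF 1 2] show ?thesis
          by (simp add: has_field_derivative_def)
      qed
      obtain \<xi> where \<xi>: "\<bar>\<xi> - s\<bar> \<le> \<bar>r - s\<bar>"
        "\<phi> (x + r *\<^sub>R ?e) - \<phi> (x + s *\<^sub>R ?e) = (r - s) * partial_deriv i \<phi> (x + \<xi> *\<^sub>R ?e)"
      proof (cases "r < s")
        case True
        obtain z where "z > r" "z < s"
          "\<phi> (x + s *\<^sub>R ?e) - \<phi> (x + r *\<^sub>R ?e) = (s - r) * partial_deriv i \<phi> (x + z *\<^sub>R ?e)"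
          using MVT2[OF True, of "\<lambda>c. \<phi> (x + c *\<^sub>R ?e)" "\<lambda>c. partial_deriv i \<phi> (x + c *\<^sub>R ?e)"] D by blast
        then show ?thesis by (intro that[of z]) (auto simp: algebra_simps)
      next
        case False
        then have "s < r" using r by simp
        obtain z where "z > s" "z < r"
          "\<phi> (x + r *\<^sub>R ?e) - \<phi> (x + s *\<^sub>R ?e) = (r - s) * partial_deriv i \<phi> (x + z *\<^sub>R ?e)"
          using MVT2[OF \<open>s < r\<close>, of "\<lambda>c. \<phi> (x + c *\<^sub>R ?e)" "\<lambda>c. partial_deriv i \<phi> (x + c *\<^sub>R ?e)"] D by blast
        then show ?thesis by (intro that[of z]) auto
      qed
      have "dist (x + \<xi> *\<^sub>R ?e) (x + s *\<^sub>R ?e) = \<bar>\<xi> - s\<bar>"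
        by (simp add: dist_norm scaleR_diff_left[symmetric] del: scaleR_diff_left)
      then have "\<bar>partial_deriv i \<phi> (x + \<xi> *\<^sub>R ?e) - partial_deriv i \<phi> (x + s *\<^sub>R ?e)\<bar> < \<delta>"
        using \<xi>(1) r by (intro d(2)) (simp add: dist_real_def)
      then show ?thesis using r by (simp add: g_def \<xi>(2))
    qed
    have "norm (cls g) \<le> \<delta> * M"
      unfolding M_def using gL by (intro bounded_support_L2(2)[OF _ g0 g\<delta>]) (auto simp: L2_def)
    moreover have "cls g = (1 / (r - s)) *\<^sub>R (shift (r *\<^sub>R ?e) (cls \<phi>) - shift (s *\<^sub>R ?e) (cls \<phi>)) -
        shift (s *\<^sub>R ?e) (cls (partial_deriv i \<phi>))"
      unfolding g_def
      by (simp only: cls_diff cls_scale L L2_diff L2_scale shift_cls test_function_L2[OF \<phi>] test_function_L2[OF d\<phi>])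
    ultimately show ?thesis using \<delta>(2) by (simp add: dist_norm)
  qed
  show "\<forall>\<^sub>F r in at s. dist ((1 / (r - s)) *\<^sub>R (shift (r *\<^sub>R ?e) (cls \<phi>) - shift (s *\<^sub>R ?e) (cls \<phi>)))
      (shift (s *\<^sub>R ?e) (cls (partial_deriv i \<phi>))) < \<epsilon>"
    unfolding eventually_at using bound d(1) by (intro exI[of _ "min d 1"]) auto
qed

text \<open>Translations are isometries, so approximation of \<open>F\<close> by test functions is uniform along the whole
  curve of translates.\<close>

lemma continuous_on_shift: "continuous_on UNIV (\<lambda>s. shift (s *\<^sub>R axis i 1) F)"
proof -
  obtain \<phi> where \<phi>: "\<And>n. test_function (\<phi> n)" and lim: "(\<lambda>n. cls (\<phi> n)) \<longlonglongrightarrow> F"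
    using test_functions_approximate[where F = F] by metis
  show ?thesis
  proof (rule uniform_limit_theorem)
    show "\<forall>\<^sub>F n in sequentially. continuous_on UNIV (\<lambda>s. shift (s *\<^sub>R axis i 1) (cls (\<phi> n)))"
      using \<phi> by (intro always_eventually allI continuous_at_imp_continuous_on ballI
        has_vector_derivative_continuous[OF shift_test_has_vector_derivative])
    show "uniform_limit UNIV (\<lambda>n s. shift (s *\<^sub>R axis i 1) (cls (\<phi> n))) (\<lambda>s. shift (s *\<^sub>R axis i 1) F) sequentially"
    proof (rule uniform_limitI)
      fix e :: real assume "e > 0"
      then have "\<forall>\<^sub>F n in sequentially. dist (cls (\<phi> n)) F < e" by (rule tendstoD[OF lim])
      moreover have "dist (shift h A) (shift h B) = dist A B" for h and A B :: "'a l2"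
        using norm_shift[of h "A - B"] by (simp add: dist_norm linear_diff[OF bounded_linear.linear[OF bounded_linear_shift]])
      ultimately show "\<forall>\<^sub>F n in sequentially. \<forall>s\<in>UNIV. dist (shift (s *\<^sub>R axis i 1) (cls (\<phi> n))) (shift (s *\<^sub>R axis i 1) F) < e"
        by simp
    qed
  qed simp
qed

text \<open>Moving the translation onto the test function shows that the curve is weakly differentiable;
  its weak velocity is continuous in norm.\<close>

lemma shift_has_vector_derivative:
  fixes F G :: "('n::finite) l2"
  assumes FG: "wderiv [i] F G"
  shows "((\<lambda>s. shift (s *\<^sub>R axis i 1) F) has_vector_derivative shift (s *\<^sub>R axis i 1) G) (at s)"
proof (rule strong_derivative_of_weak[where S = UNIV and Q = "\<lambda>s. shift (s *\<^sub>R axis i 1) G"])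
  show "continuous (at s) (\<lambda>s. shift (s *\<^sub>R axis i 1) G)"
    using continuous_on_shift[of i G] by (simp add: continuous_on_eq_continuous_at)
  fix \<phi> :: "real^'n \<Rightarrow> real" and s :: real assume \<phi>: "test_function \<phi>"
  let ?e = "axis i 1 :: real^'n"
  have "((\<lambda>s. shift (s *\<^sub>R ?e) (cls \<phi>)) has_vector_derivative
      shift ((- s) *\<^sub>R ?e) (cls (partial_deriv i \<phi>))) (at (- s))"
    by (rule shift_test_has_vector_derivative[OF \<phi>])
  then have "((\<lambda>s. shift (s *\<^sub>R ?e) (cls \<phi>)) \<circ> (\<lambda>s. - s) has_vector_derivative
      (- 1) *\<^sub>R shift ((- s) *\<^sub>R ?e) (cls (partial_deriv i \<phi>))) (at s)"
    by (intro vector_diff_chain_at) (auto intro!: derivative_eq_intros)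
  then have "((\<lambda>s. inner F (shift (- (s *\<^sub>R ?e)) (cls \<phi>))) has_vector_derivative
      inner F ((- 1) *\<^sub>R shift (- (s *\<^sub>R ?e)) (cls (partial_deriv i \<phi>)))) (at s)"
    using bounded_linear.has_vector_derivative[OF bounded_linear_inner_right] by (fastforce simp: o_def)
  moreover have "inner F ((- 1) *\<^sub>R shift (- (s *\<^sub>R ?e)) (cls (partial_deriv i \<phi>))) =
      inner (shift (s *\<^sub>R ?e) G) (cls \<phi>)"
  proof -
    have "inner (shift (s *\<^sub>R ?e) F) (cls (partial_deriv i \<phi>)) = - inner (shift (s *\<^sub>R ?e) G) (cls \<phi>)"
      using wderivD[OF wderiv_shift[OF FG] \<phi>] by (simp add: partial_derivs_def)
    then show ?thesis by (simp add: inner_shift_left)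
  qed
  ultimately show "((\<lambda>s. inner (shift (s *\<^sub>R ?e) F) (cls \<phi>)) has_real_derivative
      inner (shift (s *\<^sub>R ?e) G) (cls \<phi>)) (at s)"
    by (simp add: has_real_derivative_iff_has_vector_derivative inner_shift_left)
qed auto

lemma shift_has_vector_derivative_0:
  assumes "wderiv [i] F G"
  shows "((\<lambda>s. shift (s *\<^sub>R axis i 1) F) has_vector_derivative G) (at 0)"
  using shift_has_vector_derivative[OF assms, of 0] by (simp add: shift_0)

text \<open>Both sides of \<open>\<langle>\<tau>\<^sub>s F, \<tau>\<^sub>s G\<rangle> = \<langle>F, G\<rangle>\<close> are differentiated at \<open>s = 0\<close>.\<close>

theorem wderiv_integration_by_parts:
  assumes F: "wderiv [i] F F'" and G: "wderiv [i] G G'"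
  shows "inner F' G = - inner F G'"
proof -
  let ?S = "\<lambda>s. shift (s *\<^sub>R axis i 1)"
  have "((\<lambda>s. inner (?S s F) (?S s G)) has_vector_derivative
      inner (?S 0 F) G' + inner F' (?S 0 G)) (at 0)"
    by (rule bounded_bilinear.has_vector_derivative[OF bounded_bilinear_inner])
      (rule shift_has_vector_derivative_0 F G)+
  then have "((\<lambda>s::real. inner F G) has_vector_derivative inner F G' + inner F' G) (at 0)"
    by (simp add: inner_shift_shift shift_0)
  moreover have "((\<lambda>s::real. inner F G) has_vector_derivative 0) (at 0)" by simp
  ultimately have "inner F G' + inner F' G = 0" by (rule vector_derivative_unique_at)
  then show ?thesis by simp
qed

subsection \<open>Difference quotients\<close>

definition diff_quot :: "real \<Rightarrow> ('n::finite) \<Rightarrow> 'n l2 \<Rightarrow> 'n l2" where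
  "diff_quot h i F = (1 / h) *\<^sub>R (shift (h *\<^sub>R axis i 1) F - F)"

lemma diff_quot_tendsto:
  assumes "wderiv [i] F G" shows "((\<lambda>h. diff_quot h i F) \<longlongrightarrow> G) (at 0)"
  using shift_has_vector_derivative_0[OF assms]
  by (simp add: has_vector_derivative_quotient diff_quot_def shift_0)

lemma norm_diff_quot_le:
  assumes "wderiv [i] F G" "h \<noteq> 0" shows "norm (diff_quot h i F) \<le> norm G"
proof -
  have "norm (shift (h *\<^sub>R axis i 1) F - shift (0 *\<^sub>R axis i 1) F) \<le> norm G * norm (h - 0)"
  proof (rule differentiable_bound[of UNIV])
    fix s :: real
    show "((\<lambda>s. shift (s *\<^sub>R axis i 1) F) has_derivative (\<lambda>c. c *\<^sub>R shift (s *\<^sub>R axis i 1) G)) (at s)"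
      using shift_has_vector_derivative[OF assms(1)] by (simp add: has_vector_derivative_def)
    show "onorm (\<lambda>c. c *\<^sub>R shift (s *\<^sub>R axis i 1) G) \<le> norm G"
      by (rule onorm_le) (simp add: norm_shift mult.commute)
  qed auto
  then have "norm (shift (h *\<^sub>R axis i 1) F - F) / \<bar>h\<bar> \<le> norm G"
    using assms(2) by (simp add: shift_0 field_simps)
  moreover have "norm (diff_quot h i F) = norm (shift (h *\<^sub>R axis i 1) F - F) / \<bar>h\<bar>"
    unfolding diff_quot_def norm_scaleR by simp
  ultimately show ?thesis by simp
qed

lemma bounded_linear_diff_quot: "bounded_linear (diff_quot h i)"
  unfolding diff_quot_def
  by (intro bounded_linear_const_scaleR bounded_linear_sub bounded_linear_shift bounded_linear_ident)

lemma wderiv_diff_quot: "wderiv \<alpha> F G \<Longrightarrow> wderiv \<alpha> (diff_quot h i F) (diff_quot h i G)"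
  unfolding diff_quot_def by (intro wderiv_scaleR wderiv_diff wderiv_shift)

text \<open>Difference quotients in direction \<open>j\<close> commute with \<open>\<partial>\<^sub>i\<close>, and \<open>\<partial>\<^sub>i\<close> is closed.  In particular \<open>\<partial>\<^sub>i\<partial>\<^sub>j F\<close>
  exists whenever \<open>\<partial>\<^sub>j\<partial>\<^sub>i F\<close> and \<open>\<partial>\<^sub>j F\<close> do.\<close>

lemma wderiv_commute:
  assumes "wderiv [i] F Fi" "wderiv [j] Fi Fij" "wderiv [j] F Fj"
  shows "wderiv [i] Fj Fij"
  by (rule wderiv_limit[OF diff_quot_tendsto[OF assms(3)] diff_quot_tendsto[OF assms(2)]])
    (intro at_neq_bot always_eventually allI wderiv_diff_quot assms(1))+

text \<open>Two integrations by parts would need third derivatives of \<open>F\<close>.  Instead, one of the two derivatives in direction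
  \<open>i\<close> is realized as the velocity of a translation, which is moved to the other factor after a
  single integration by parts in direction \<open>j\<close>.\<close>

lemma inner_mixed_derivatives:
  fixes F :: "('n::finite) l2" and F1 :: "'n \<Rightarrow> 'n l2"
  assumes 1: "\<And>i. wderiv [i] F (F1 i)" and 2: "\<And>i j. wderiv [j] (F1 i) (F2 i j)"
  shows "inner (F2 i j) (F2 i j) = inner (F2 i i) (F2 j j)"
proof -
  have sym: "F2 i j = F2 j i" by (rule wderiv_unique[OF 2 wderiv_commute[OF 1 2 1]])
  let ?S = "\<lambda>s. shift (s *\<^sub>R axis i 1)"
  have a: "((\<lambda>s. inner (?S s (F1 j)) (F2 i j)) has_vector_derivative inner (F2 i j) (F2 i j)) (at 0)"
    using bounded_linear.has_vector_derivative[OF bounded_linear_inner_left shift_has_vector_derivative_0[OF 2]]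
    by (simp add: sym)
  have "inner (?S s (F1 j)) (F2 i j) = - inner (?S s (F2 j j)) (F1 i)" for s
    using wderiv_integration_by_parts[OF wderiv_shift[OF 2[of j j]] 2[of j i]] by simp
  then have eq: "inner (?S s (F1 j)) (F2 i j) = - inner (F2 j j) (?S (- s) (F1 i))" for s
    by (simp add: inner_shift_left)
  have "((\<lambda>s. ?S s (F1 i)) \<circ> (\<lambda>s. - s) has_vector_derivative (- 1) *\<^sub>R F2 i i) (at 0)"
    by (intro vector_diff_chain_at) (auto intro!: derivative_eq_intros shift_has_vector_derivative_0 2)
  then have "((\<lambda>s. - inner (F2 j j) (?S (- s) (F1 i))) has_vector_derivative
      - inner (F2 j j) ((- 1) *\<^sub>R F2 i i)) (at 0)"
    using bounded_linear.has_vector_derivative[OF bounded_linear_inner_right]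
    by (intro has_vector_derivative_minus) (fastforce simp: o_def)
  then have "((\<lambda>s. inner (?S s (F1 j)) (F2 i j)) has_vector_derivative inner (F2 i i) (F2 j j)) (at 0)"
    by (simp add: eq inner_commute[of "F2 i i" "F2 j j"])
  with a show ?thesis by (rule vector_derivative_unique_at)
qed

text \<open>Summing the preceding identity over all \<open>i, j\<close> shows that the Laplacian has the same norm as the
  full Hessian.\<close>

lemma norm_second_derivative_le_laplacian:
  fixes F :: "('n::finite) l2" and F1 :: "'n \<Rightarrow> 'n l2"
  assumes 1: "\<And>i. wderiv [i] F (F1 i)" and 2: "\<And>i j. wderiv [j] (F1 i) (F2 i j)"
  shows "norm (F2 i j) \<le> norm (\<Sum>k\<in>UNIV. F2 k k)"
proof -
  have "(norm (F2 i j))\<^sup>2 \<le> (\<Sum>j\<in>UNIV. (norm (F2 i j))\<^sup>2)"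
    by (rule member_le_sum) auto
  also have "\<dots> \<le> (\<Sum>i\<in>UNIV. \<Sum>j\<in>UNIV. (norm (F2 i j))\<^sup>2)"
    by (rule member_le_sum) (auto intro: sum_nonneg)
  also have "\<dots> = (\<Sum>i\<in>UNIV. \<Sum>j\<in>UNIV. inner (F2 i i) (F2 j j))"
    by (simp add: power2_norm_eq_inner inner_mixed_derivatives[OF 1 2])
  also have "\<dots> = (norm (\<Sum>k\<in>UNIV. F2 k k))\<^sup>2"
    unfolding power2_norm_eq_inner inner_sum_left inner_sum_right
    by (intro sum.cong refl inner_commute)
  finally show ?thesis by (rule power2_le_imp_le) simp
qed

section \<open>The conserved functionals\<close>

lemma inner_has_real_derivative:
  fixes f g :: "real \<Rightarrow> 'a::real_inner"
  assumes "(f has_vector_derivative f') (at t within S)" "(g has_vector_derivative g') (at t within S)"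
  shows "((\<lambda>t. inner (f t) (g t)) has_real_derivative inner (f t) g' + inner f' (g t)) (at t within S)"
  using bounded_bilinear.has_vector_derivative[OF bounded_bilinear_inner assms]
  by (simp add: has_real_derivative_iff_has_vector_derivative)

lemma norm_sq_has_real_derivative:
  fixes f :: "real \<Rightarrow> 'a::real_inner"
  assumes "(f has_vector_derivative f') (at t within S)"
  shows "((\<lambda>t. (norm (f t))\<^sup>2) has_real_derivative 2 * inner (f t) f') (at t within S)"
  using inner_has_real_derivative[OF assms assms] by (simp add: power2_norm_eq_inner inner_commute)

text \<open>The equation as a statement about curves in \<open>L\<^sup>2\<close>.  The curves \<open>u1 i\<close>, \<open>u2 i j\<close>, \<open>u3 i j k\<close> are the
  space derivatives of \<open>u\<close>, where the last index is the derivative taken last, and \<open>p\<close> is \<open>u\<^sub>t\<close> with derivatives \<open>p1\<close>,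
  \<open>p2\<close>; \<open>lu\<close> is \<open>\<Delta>u\<close>.\<close>

locale kirchhoff_l2 =
  fixes a b T :: real
    and u p :: "real \<Rightarrow> ('n::finite) l2" and u1 p1 :: "'n \<Rightarrow> real \<Rightarrow> 'n l2"
    and u2 p2 :: "'n \<Rightarrow> 'n \<Rightarrow> real \<Rightarrow> 'n l2" and u3 :: "'n \<Rightarrow> 'n \<Rightarrow> 'n \<Rightarrow> real \<Rightarrow> 'n l2"
    and S :: "real set" and s q :: "real \<Rightarrow> real" and lu :: "real \<Rightarrow> 'n l2"
  defines "S \<equiv> {0..<T}"
    and "s \<equiv> \<lambda>t. \<Sum>i\<in>UNIV. (norm (u1 i t))\<^sup>2"
    and "q \<equiv> \<lambda>t. a * s t + b"
    and "lu \<equiv> \<lambda>t. \<Sum>i\<in>UNIV. u2 i i t"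
  assumes b_pos: "b > 0"
    and u1: "\<And>t i. t \<in> S \<Longrightarrow> wderiv [i] (u t) (u1 i t)"
    and u2: "\<And>t i j. t \<in> S \<Longrightarrow> wderiv [j] (u1 i t) (u2 i j t)"
    and u3: "\<And>t i j k. t \<in> S \<Longrightarrow> wderiv [k] (u2 i j t) (u3 i j k t)"
    and p1: "\<And>t i. t \<in> S \<Longrightarrow> wderiv [i] (p t) (p1 i t)"
    and p2: "\<And>t i j. t \<in> S \<Longrightarrow> wderiv [j] (p1 i t) (p2 i j t)"
    and u1_time: "\<And>t i. t \<in> S \<Longrightarrow> (u1 i has_vector_derivative p1 i t) (at t within S)"
    and u2_time: "\<And>t i j. t \<in> S \<Longrightarrow> (u2 i j has_vector_derivative p2 i j t) (at t within S)"
    and u3_cont: "\<And>i j k. continuous_on S (u3 i j k)"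
    and p2_cont: "\<And>i j. continuous_on S (p2 i j)"
    and pde: "\<And>t \<phi>. t \<in> S \<Longrightarrow> test_function \<phi> \<Longrightarrow>
      ((\<lambda>t. inner (p t) (cls \<phi>)) has_real_derivative inner ((1 / (q t)\<^sup>2) *\<^sub>R lu t) (cls \<phi>)) (at t within S)"
    and s_small: "\<And>t. a < 0 \<Longrightarrow> t \<in> S \<Longrightarrow> s t < b / \<bar>a\<bar>"
begin

text \<open>In classical notation \<open>m = \<langle>\<nabla>u, \<nabla>u\<^sub>t\<rangle> = s' / 2\<close>, \<open>lp = \<Delta>u\<^sub>t\<close>, \<open>gl i = \<partial>\<^sub>i \<Delta>u\<close>, \<open>N = \<parallel>\<nabla>u\<^sub>t\<parallel>\<^sup>2\<close>,
  \<open>L = \<parallel>\<Delta>u\<parallel>\<^sup>2\<close>, \<open>X = \<langle>\<Delta>u, \<Delta>u\<^sub>t\<rangle>\<close>, \<open>k = s'' / 2\<close>, \<open>\<Gamma> = \<parallel>\<nabla>\<Delta>u\<parallel>\<^sup>2\<close>; \<open>e2\<close> and \<open>e3\<close> are the leading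
  energies in \<open>I\<^sub>2\<close> and \<open>I\<^sub>3\<close>.\<close>

definition m :: "real \<Rightarrow> real" where "m t = (\<Sum>i\<in>UNIV. inner (u1 i t) (p1 i t))"
definition lp :: "real \<Rightarrow> 'n l2" where "lp t = (\<Sum>i\<in>UNIV. p2 i i t)"
definition gl :: "'n \<Rightarrow> real \<Rightarrow> 'n l2" where "gl i t = (\<Sum>j\<in>UNIV. u3 j j i t)"
definition N :: "real \<Rightarrow> real" where "N t = (\<Sum>i\<in>UNIV. (norm (p1 i t))\<^sup>2)"
definition L :: "real \<Rightarrow> real" where "L t = (norm (lu t))\<^sup>2"
definition X :: "real \<Rightarrow> real" where "X t = inner (lu t) (lp t)"
definition k :: "real \<Rightarrow> real" where "k t = N t - L t / (q t)\<^sup>2"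
definition \<Gamma> :: "real \<Rightarrow> real" where "\<Gamma> t = (\<Sum>i\<in>UNIV. (norm (gl i t))\<^sup>2)"
definition e2 :: "real \<Rightarrow> real" where "e2 t = q t * N t + L t / q t"
definition e3 :: "real \<Rightarrow> real" where "e3 t = q t * (norm (lp t))\<^sup>2 + \<Gamma> t / q t"

lemma convex_S: "convex S" by (simp add: S_def)

lemma s_nonneg: "s t \<ge> 0" by (simp add: s_def sum_nonneg)

lemma q_pos: assumes "t \<in> S" shows "q t > 0"
proof (cases "a < 0")
  case True
  then have "\<bar>a\<bar> * s t < b" using s_small[OF True assms] by (simp add: field_simps)
  then show ?thesis using True by (simp add: q_def)
next
  case False
  then have "a * s t \<ge> 0" using s_nonneg by simp
  then show ?thesis using b_pos by (simp add: q_def)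
qed

lemma s_deriv: assumes "t \<in> S" shows "(s has_real_derivative 2 * m t) (at t within S)"
proof -
  have "((\<lambda>t. \<Sum>i\<in>UNIV. (norm (u1 i t))\<^sup>2) has_real_derivative (\<Sum>i\<in>UNIV. 2 * inner (u1 i t) (p1 i t))) (at t within S)"
    by (intro DERIV_sum norm_sq_has_real_derivative u1_time assms)
  then show ?thesis by (simp add: s_def m_def sum_distrib_left)
qed

lemma q_deriv: assumes "t \<in> S" shows "(q has_real_derivative 2 * a * m t) (at t within S)"
  unfolding q_def using DERIV_add[OF DERIV_cmult[OF s_deriv[OF assms], of a] DERIV_const[of b]]
  by (simp add: mult.commute mult.left_commute)

lemma lu_deriv: assumes "t \<in> S" shows "(lu has_vector_derivative lp t) (at t within S)"
  unfolding lu_def lp_def by (intro has_vector_derivative_sum u2_time assms)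

lemma wderiv_gl: assumes "t \<in> S" shows "wderiv [i] (lu t) (gl i t)"
  unfolding lu_def gl_def by (intro wderiv_sum u3 assms)

text \<open>\<open>\<partial>\<^sub>i \<Delta>u = \<Delta> \<partial>\<^sub>i u\<close>.\<close>

lemma gl_commuted: assumes "t \<in> S" shows "gl i t = (\<Sum>j\<in>UNIV. u3 i j j t)"
proof -
  have sym2: "u2 i j t = u2 j i t" for i j
    by (rule wderiv_unique[OF u2[OF assms] wderiv_commute[OF u1 u2 u1]]) (rule assms)+
  have "u3 i j j t = u3 j j i t" for j
  proof -
    have "wderiv [j] (u2 j i t) (u3 j j i t)"
      by (rule wderiv_commute[OF u2 u3 u2]) (rule assms)+
    then show ?thesis using wderiv_unique[OF u3[OF assms, of j i j]] by (simp add: sym2)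
  qed
  then show ?thesis by (simp add: gl_def)
qed

lemma cont_q: "continuous_on S q"
  using DERIV_continuous_on[OF q_deriv] .

lemma cont_lu: "continuous_on S lu"
  using continuous_on_vector_derivative[OF lu_deriv] .

lemma q_nonzero: "t \<in> S \<Longrightarrow> q t \<noteq> 0" using q_pos[of t] by simp

text \<open>The distributional equation holds in the norm of \<open>L\<^sup>2\<close>, because \<open>\<Delta>u / q\<^sup>2\<close> is continuous in time.\<close>

lemma p_deriv: assumes "t \<in> S" shows "(p has_vector_derivative (1 / (q t)\<^sup>2) *\<^sub>R lu t) (at t within S)"
proof (rule strong_derivative_of_weak[OF convex_S assms])
  have "continuous_on S (\<lambda>t. (1 / (q t)\<^sup>2) *\<^sub>R lu t)"
    using q_nonzero by (intro continuous_intros cont_q cont_lu) auto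
  then show "continuous (at t within S) (\<lambda>t. (1 / (q t)\<^sup>2) *\<^sub>R lu t)"
    using assms by (simp add: continuous_on_eq_continuous_within)
qed (rule pde)

lemma p1_deriv: assumes "t \<in> S" shows "(p1 i has_vector_derivative (1 / (q t)\<^sup>2) *\<^sub>R gl i t) (at t within S)"
proof (rule wderiv_time_derivative[OF convex_S p_deriv p1 _ _ assms])
  show "continuous_on S (\<lambda>t. (1 / (q t)\<^sup>2) *\<^sub>R gl i t)"
    unfolding gl_def using q_nonzero by (intro continuous_intros cont_q u3_cont) auto
qed (auto intro: wderiv_scaleR wderiv_gl)

lemma m_parts: assumes "t \<in> S" shows "m t = - inner (lu t) (p t)"
proof -
  have "inner (u1 i t) (p1 i t) = - inner (u2 i i t) (p t)" for i
    using wderiv_integration_by_parts[OF u2[of t i i] p1[of t i]] assms by simp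
  then show ?thesis by (simp add: m_def lu_def inner_sum_left sum_negf)
qed

lemma N_parts: assumes "t \<in> S" shows "N t = - inner (lp t) (p t)"
proof -
  have "inner (p1 i t) (p1 i t) = - inner (p2 i i t) (p t)" for i
    using wderiv_integration_by_parts[OF p2[of t i i] p1[of t i]] assms by simp
  then show ?thesis by (simp add: N_def lp_def inner_sum_left sum_negf power2_norm_eq_inner)
qed

lemma L_parts: assumes "t \<in> S" shows "L t = - (\<Sum>i\<in>UNIV. inner (u1 i t) (gl i t))"
proof -
  have "inner (u1 i t) (gl i t) = - inner (u2 i i t) (lu t)" for i
    using wderiv_integration_by_parts[OF u2[of t i i] wderiv_gl[of t i]] assms by simp
  moreover have "L t = (\<Sum>i\<in>UNIV. inner (u2 i i t) (lu t))"
    unfolding L_def power2_norm_eq_inner by (subst (1) lu_def) (rule inner_sum_left)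
  ultimately show ?thesis by (simp add: sum_negf)
qed

lemma X_parts: assumes "t \<in> S" shows "X t = - (\<Sum>i\<in>UNIV. inner (p1 i t) (gl i t))"
proof -
  have "inner (p1 i t) (gl i t) = - inner (p2 i i t) (lu t)" for i
    using wderiv_integration_by_parts[OF p2[of t i i] wderiv_gl[of t i]] assms by simp
  moreover have "X t = (\<Sum>i\<in>UNIV. inner (p2 i i t) (lu t))"
    unfolding X_def lp_def inner_sum_right by (simp add: inner_commute)
  ultimately show ?thesis by (simp add: sum_negf)
qed

lemma m_deriv: assumes "t \<in> S" shows "(m has_real_derivative k t) (at t within S)"
proof -
  have "((\<lambda>t. \<Sum>i\<in>UNIV. inner (u1 i t) (p1 i t)) has_real_derivative
      (\<Sum>i\<in>UNIV. inner (u1 i t) ((1 / (q t)\<^sup>2) *\<^sub>R gl i t) + inner (p1 i t) (p1 i t))) (at t within S)"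
    by (intro DERIV_sum inner_has_real_derivative u1_time p1_deriv assms)
  moreover have "(\<Sum>i\<in>UNIV. inner (u1 i t) ((1 / (q t)\<^sup>2) *\<^sub>R gl i t) + inner (p1 i t) (p1 i t)) = k t"
    by (simp add: sum.distrib k_def N_def L_parts[OF assms] power2_norm_eq_inner sum_divide_distrib)
  ultimately show ?thesis by (simp add: m_def[abs_def])
qed

lemma N_deriv: assumes "t \<in> S" shows "(N has_real_derivative - 2 * X t / (q t)\<^sup>2) (at t within S)"
proof -
  have "((\<lambda>t. \<Sum>i\<in>UNIV. (norm (p1 i t))\<^sup>2) has_real_derivative
      (\<Sum>i\<in>UNIV. 2 * inner (p1 i t) ((1 / (q t)\<^sup>2) *\<^sub>R gl i t))) (at t within S)"
    by (intro DERIV_sum norm_sq_has_real_derivative p1_deriv assms)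
  moreover have "(\<Sum>i\<in>UNIV. 2 * inner (p1 i t) ((1 / (q t)\<^sup>2) *\<^sub>R gl i t)) = - 2 * X t / (q t)\<^sup>2"
    by (simp add: X_parts[OF assms] sum_distrib_left sum_divide_distrib sum_negf)
  ultimately show ?thesis by (simp add: N_def[abs_def])
qed

lemma L_deriv: assumes "t \<in> S" shows "(L has_real_derivative 2 * X t) (at t within S)"
  using norm_sq_has_real_derivative[OF lu_deriv[OF assms]] by (simp add: L_def[abs_def] X_def)

lemma k_deriv: assumes "t \<in> S"
  shows "(k has_real_derivative - 4 * X t / (q t)\<^sup>2 + 4 * a * m t * L t / (q t) ^ 3) (at t within S)"
proof -
  have "((\<lambda>t. N t - L t / (q t)\<^sup>2) has_real_derivative
      - 2 * X t / (q t)\<^sup>2 - (2 * X t * (q t)\<^sup>2 - L t * (2 * a * m t * q t * 2)) / ((q t)\<^sup>2 * (q t)\<^sup>2)) (at t within S)"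
    using q_nonzero[OF assms]
    by (auto intro!: derivative_eq_intros N_deriv L_deriv q_deriv assms)
  moreover have "- 2 * X t / (q t)\<^sup>2 - (2 * X t * (q t)\<^sup>2 - L t * (2 * a * m t * q t * 2)) / ((q t)\<^sup>2 * (q t)\<^sup>2) =
      - 4 * X t / (q t)\<^sup>2 + 4 * a * m t * L t / (q t) ^ 3"
    using q_nonzero[OF assms] by (simp add: field_simps power2_eq_square power3_eq_cube)
  ultimately show ?thesis by (simp add: k_def[abs_def])
qed

lemma e2_deriv: assumes "t \<in> S" shows "(e2 has_real_derivative 2 * a * m t * k t) (at t within S)"
proof -
  have "((\<lambda>t. q t * N t + L t / q t) has_real_derivative
      (2 * a * m t * N t + (- 2 * X t / (q t)\<^sup>2) * q t) + (2 * X t * q t - L t * (2 * a * m t)) / (q t * q t)) (at t within S)"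
    by (intro DERIV_add DERIV_mult DERIV_divide N_deriv L_deriv q_deriv assms q_nonzero)
  moreover have "(2 * a * m t * N t + (- 2 * X t / (q t)\<^sup>2) * q t) + (2 * X t * q t - L t * (2 * a * m t)) / (q t * q t) =
      2 * a * m t * k t"
    using q_nonzero[OF assms] by (simp add: k_def field_simps power2_eq_square)
  ultimately show ?thesis by (simp add: e2_def[abs_def])
qed

lemma constant_on_S:
  assumes "\<And>t. t \<in> S \<Longrightarrow> (f has_real_derivative 0) (at t within S)" and "t \<in> S"
  shows "f t = f 0"
proof -
  obtain c where "\<And>t. t \<in> S \<Longrightarrow> f t = c"
    using has_field_derivative_zero_constant[OF convex_S assms(1)] by blast
  moreover have "0 \<in> S" using assms(2) by (simp add: S_def)
  ultimately show ?thesis using assms(2) by simp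
qed

lemma I1_conserved:
  assumes "t \<in> S"
  shows "(norm (p t))\<^sup>2 + s t / (b * q t) = (norm (p 0))\<^sup>2 + s 0 / (b * q 0)"
proof (rule constant_on_S[where f = "\<lambda>t. (norm (p t))\<^sup>2 + s t / (b * q t)", OF _ assms])
  fix t assume t: "t \<in> S"
  have "((\<lambda>t. (norm (p t))\<^sup>2 + s t / (b * q t)) has_real_derivative
      2 * inner (p t) ((1 / (q t)\<^sup>2) *\<^sub>R lu t) +
      (2 * m t * (b * q t) - s t * (b * (2 * a * m t))) / ((b * q t) * (b * q t))) (at t within S)"
    using b_pos q_nonzero[OF t]
    by (intro DERIV_add DERIV_divide norm_sq_has_real_derivative p_deriv s_deriv DERIV_cmult q_deriv t) auto
  moreover have "2 * inner (p t) ((1 / (q t)\<^sup>2) *\<^sub>R lu t) +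
      (2 * m t * (b * q t) - s t * (b * (2 * a * m t))) / ((b * q t) * (b * q t)) = 0"
  proof -
    have "inner (p t) (lu t) = - m t" by (simp add: m_parts[OF t] inner_commute)
    moreover have "2 * m t * (b * q t) - s t * (b * (2 * a * m t)) = 2 * m t * b * b"
      by (simp add: q_def algebra_simps)
    ultimately show ?thesis using b_pos by (simp add: power2_eq_square)
  qed
  ultimately show "((\<lambda>t. (norm (p t))\<^sup>2 + s t / (b * q t)) has_real_derivative 0) (at t within S)" by simp
qed

lemma I2_conserved: assumes "t \<in> S" shows "e2 t - a * (m t)\<^sup>2 = e2 0 - a * (m 0)\<^sup>2"
proof (rule constant_on_S[where f = "\<lambda>t. e2 t - a * (m t)\<^sup>2", OF _ assms])
  fix t assume t: "t \<in> S"
  show "((\<lambda>t. e2 t - a * (m t)\<^sup>2) has_real_derivative 0) (at t within S)"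
    by (auto intro!: derivative_eq_intros e2_deriv m_deriv t)
qed

text \<open>The terms of \<open>I\<^sub>3\<close> that involve at most second derivatives of \<open>u\<close> and first derivatives of \<open>u\<^sub>t\<close>,
  rewritten with \<open>q' = 2 a m\<close>, \<open>s' = 2 m\<close> and \<open>s'' = 2 k\<close>.  These can be differentiated in time.\<close>

definition low :: "real \<Rightarrow> real" where
  "low t = a\<^sup>2 * (m t)\<^sup>2 * e2 t / 2 - a ^ 3 * (m t) ^ 4 / 4 - a * (q t)\<^sup>2 * (k t)\<^sup>2 / 4"

definition i3 :: "real \<Rightarrow> real" where
  "i3 t = e3 t - 2 * a * m t * X t + low t"

text \<open>All terms with \<open>m\<close> as a factor cancel because \<open>e2 = q k + 2 L / q\<close>.\<close>

lemma low_deriv: assumes "t \<in> S" shows "(low has_real_derivative 2 * a * k t * X t) (at t within S)"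
proof -
  define k' where "k' = - 4 * X t / (q t)\<^sup>2 + 4 * a * m t * L t / (q t) ^ 3"
  have "((\<lambda>t. a\<^sup>2 * (m t)\<^sup>2 * e2 t / 2 - a ^ 3 * (m t) ^ 4 / 4 - a * (q t)\<^sup>2 * (k t)\<^sup>2 / 4) has_real_derivative
      a\<^sup>2 * m t * k t * e2 t - a * (a * m t * q t * (k t)\<^sup>2 + (q t)\<^sup>2 * k t * k' / 2)) (at t within S)"
    by (rule DERIV_cong, (rule derivative_eq_intros e2_deriv m_deriv q_deriv k_deriv[OF assms, folded k'_def] assms refl | (simp; fail))+)
      (simp add: field_simps power2_eq_square power3_eq_cube)
  moreover have "a\<^sup>2 * m t * k t * e2 t - a * (a * m t * q t * (k t)\<^sup>2 + (q t)\<^sup>2 * k t * k' / 2) = 2 * a * k t * X t"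
  proof -
    have 1: "(q t)\<^sup>2 * k' = - 4 * X t + 4 * a * m t * L t / q t"
      using q_nonzero[OF assms] by (simp add: k'_def field_simps power2_eq_square power3_eq_cube)
    have 2: "e2 t = q t * k t + 2 * L t / q t"
      using q_nonzero[OF assms] by (simp add: e2_def k_def field_simps power2_eq_square)
    have "(q t)\<^sup>2 * k t * k' = k t * ((q t)\<^sup>2 * k')" by simp
    then have 3: "(q t)\<^sup>2 * k t * k' = k t * (- 4 * X t + 4 * a * m t * L t / q t)"
      by (simp only: 1)
    show ?thesis unfolding 2 3 by (simp add: field_simps power2_eq_square)
  qed
  ultimately show ?thesis by (simp add: low_def[abs_def])
qed

text \<open>The regularization \<open>v\<close> of \<open>\<Delta>u\<close> replaces one of the two derivatives by a difference quotient;
  \<open>w\<close>, \<open>V h j\<close>, \<open>W h j\<close> and \<open>Z\<close> are \<open>v\<^sub>t\<close>, \<open>\<partial>\<^sub>j v\<close>, \<open>\<partial>\<^sub>j v\<^sub>t\<close> and \<open>\<Delta>v\<close>.\<close>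

definition v :: "real \<Rightarrow> real \<Rightarrow> 'n l2" where "v h t = (\<Sum>i\<in>UNIV. diff_quot h i (u1 i t))"
definition w :: "real \<Rightarrow> real \<Rightarrow> 'n l2" where "w h t = (\<Sum>i\<in>UNIV. diff_quot h i (p1 i t))"
definition V :: "real \<Rightarrow> 'n \<Rightarrow> real \<Rightarrow> 'n l2" where "V h j t = (\<Sum>i\<in>UNIV. diff_quot h i (u2 i j t))"
definition W :: "real \<Rightarrow> 'n \<Rightarrow> real \<Rightarrow> 'n l2" where "W h j t = (\<Sum>i\<in>UNIV. diff_quot h i (p2 i j t))"
definition Z :: "real \<Rightarrow> real \<Rightarrow> 'n l2" where "Z h t = (\<Sum>i\<in>UNIV. diff_quot h i (gl i t))"

lemma diff_quot_time:
  "(f has_vector_derivative f') F \<Longrightarrow> ((\<lambda>t. diff_quot h i (f t)) has_vector_derivative diff_quot h i f') F"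
  by (rule bounded_linear.has_vector_derivative[OF bounded_linear_diff_quot])

lemma v_deriv: assumes "t \<in> S" shows "(v h has_vector_derivative w h t) (at t within S)"
  unfolding v_def w_def by (intro has_vector_derivative_sum diff_quot_time u1_time assms)

lemma V_deriv: assumes "t \<in> S" shows "(V h j has_vector_derivative W h j t) (at t within S)"
  unfolding V_def W_def by (intro has_vector_derivative_sum diff_quot_time u2_time assms)

lemma w_deriv: assumes "t \<in> S" shows "(w h has_vector_derivative (1 / (q t)\<^sup>2) *\<^sub>R Z h t) (at t within S)"
proof -
  have "(w h has_vector_derivative (\<Sum>i\<in>UNIV. diff_quot h i ((1 / (q t)\<^sup>2) *\<^sub>R gl i t))) (at t within S)"
    unfolding w_def by (intro has_vector_derivative_sum diff_quot_time p1_deriv assms)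
  then show ?thesis
    by (simp add: Z_def scaleR_sum_right linear_cmul[OF bounded_linear.linear[OF bounded_linear_diff_quot]])
qed

lemma Z_eq: assumes "t \<in> S" shows "Z h t = (\<Sum>j\<in>UNIV. \<Sum>i\<in>UNIV. diff_quot h i (u3 i j j t))"
proof -
  have "Z h t = (\<Sum>i\<in>UNIV. \<Sum>j\<in>UNIV. diff_quot h i (u3 i j j t))"
    by (simp add: Z_def gl_commuted[OF assms] linear_sum[OF bounded_linear.linear[OF bounded_linear_diff_quot]])
  then show ?thesis by (subst sum.swap)
qed

lemma wderiv_V:
  assumes "t \<in> S"
  shows "wderiv [j] (v h t) (V h j t)" "wderiv [j] (w h t) (W h j t)"
    "wderiv [j] (V h j t) (\<Sum>i\<in>UNIV. diff_quot h i (u3 i j j t))"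
  unfolding v_def V_def w_def W_def by (intro wderiv_sum wderiv_diff_quot u2 p2 u3 assms)+

lemma inner_v_Z: assumes "t \<in> S" shows "inner (v h t) (Z h t) = - (\<Sum>j\<in>UNIV. (norm (V h j t))\<^sup>2)"
proof -
  have *: "inner (v h t) (\<Sum>i\<in>UNIV. diff_quot h i (u3 i j j t)) = - (norm (V h j t))\<^sup>2" for j
    using wderiv_integration_by_parts[OF wderiv_V(1)[OF assms, of j h] wderiv_V(3)[OF assms, of j h]]
    by (simp add: power2_norm_eq_inner)
  show ?thesis by (simp add: Z_eq[OF assms]) (subst inner_sum_right, simp add: * sum_negf)
qed

lemma inner_w_Z: assumes "t \<in> S" shows "inner (w h t) (Z h t) = - (\<Sum>j\<in>UNIV. inner (V h j t) (W h j t))"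
proof -
  have *: "inner (w h t) (\<Sum>i\<in>UNIV. diff_quot h i (u3 i j j t)) = - inner (V h j t) (W h j t)" for j
    using wderiv_integration_by_parts[OF wderiv_V(2)[OF assms, of j h] wderiv_V(3)[OF assms, of j h]]
    by (simp add: inner_commute)
  show ?thesis by (simp add: Z_eq[OF assms]) (subst inner_sum_right, simp add: * sum_negf)
qed

definition i3h :: "real \<Rightarrow> real \<Rightarrow> real" where
  "i3h h t = q t * (norm (w h t))\<^sup>2 + (\<Sum>j\<in>UNIV. (norm (V h j t))\<^sup>2) / q t
     - 2 * a * m t * inner (v h t) (w h t) + low t"

text \<open>The squares \<open>\<parallel>w\<parallel>\<^sup>2\<close> and \<open>\<parallel>V\<parallel>\<^sup>2\<close> produced by \<open>q'\<close> in the energy cancel against those produced by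
  differentiating \<open>\<langle>v, w\<rangle>\<close> in the correction \<open>- q' \<langle>v, w\<rangle>\<close>.  What remains is the defect between \<open>\<langle>\<Delta>u, \<Delta>u\<^sub>t\<rangle>\<close>
  and its regularization.\<close>

lemma i3h_deriv: assumes "t \<in> S"
  shows "(i3h h has_real_derivative 2 * a * k t * (X t - inner (v h t) (w h t))) (at t within S)"
proof -
  let ?r = "(1 / (q t)\<^sup>2) *\<^sub>R Z h t"
  let ?VV = "\<Sum>j\<in>UNIV. (norm (V h j t))\<^sup>2"
  let ?VW = "\<Sum>j\<in>UNIV. inner (V h j t) (W h j t)"
  have "((\<lambda>t. q t * (norm (w h t))\<^sup>2 + (\<Sum>j\<in>UNIV. (norm (V h j t))\<^sup>2) / q t
     - 2 * a * m t * inner (v h t) (w h t) + low t) has_real_derivative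
     (2 * a * m t * (norm (w h t))\<^sup>2 + (2 * inner (w h t) ?r) * q t)
     + ((\<Sum>j\<in>UNIV. 2 * inner (V h j t) (W h j t)) * q t - ?VV * (2 * a * m t)) / (q t * q t)
     - ((2 * a * k t) * inner (v h t) (w h t) + (inner (v h t) ?r + inner (w h t) (w h t)) * (2 * a * m t))
     + 2 * a * k t * X t) (at t within S)"
    by (intro DERIV_add DERIV_diff DERIV_mult DERIV_divide DERIV_sum norm_sq_has_real_derivative
        inner_has_real_derivative DERIV_cmult q_deriv w_deriv V_deriv v_deriv m_deriv low_deriv assms q_nonzero)
  moreover have "(2 * a * m t * (norm (w h t))\<^sup>2 + (2 * inner (w h t) ?r) * q t)
     + ((\<Sum>j\<in>UNIV. 2 * inner (V h j t) (W h j t)) * q t - ?VV * (2 * a * m t)) / (q t * q t)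
     - ((2 * a * k t) * inner (v h t) (w h t) + (inner (v h t) ?r + inner (w h t) (w h t)) * (2 * a * m t))
     + 2 * a * k t * X t = 2 * a * k t * (X t - inner (v h t) (w h t))"
  proof -
    have 1: "inner (w h t) ?r = - ?VW / (q t)\<^sup>2" "inner (v h t) ?r = - ?VV / (q t)\<^sup>2"
      by (simp_all add: inner_w_Z[OF assms] inner_v_Z[OF assms])
    have 2: "(\<Sum>j\<in>UNIV. 2 * inner (V h j t) (W h j t)) = 2 * ?VW" by (simp add: sum_distrib_left)
    have 3: "inner (w h t) (w h t) = (norm (w h t))\<^sup>2" by (simp add: power2_norm_eq_inner)
    show ?thesis unfolding 1 2 3 using q_nonzero[OF assms]
      by (simp add: field_simps power2_eq_square)
  qed
  ultimately show ?thesis by (simp add: i3h_def[abs_def])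
qed

lemma i3h_tendsto: assumes "t \<in> S" shows "((\<lambda>h. i3h h t) \<longlongrightarrow> i3 t) (at 0)"
    and inner_vw_tendsto: "((\<lambda>h. inner (v h t) (w h t)) \<longlongrightarrow> X t) (at 0)"
proof -
  have v: "((\<lambda>h. v h t) \<longlongrightarrow> lu t) (at 0)"
    unfolding v_def lu_def by (intro tendsto_sum diff_quot_tendsto u2 assms)
  have w: "((\<lambda>h. w h t) \<longlongrightarrow> lp t) (at 0)"
    unfolding w_def lp_def by (intro tendsto_sum diff_quot_tendsto p2 assms)
  have V: "((\<lambda>h. V h j t) \<longlongrightarrow> gl j t) (at 0)" for j
    unfolding V_def gl_def
    by (intro tendsto_sum diff_quot_tendsto wderiv_commute[OF u2 u3 u2] assms)
  show "((\<lambda>h. inner (v h t) (w h t)) \<longlongrightarrow> X t) (at 0)"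
    unfolding X_def by (intro tendsto_inner v w)
  show "((\<lambda>h. i3h h t) \<longlongrightarrow> i3 t) (at 0)"
    unfolding i3h_def i3_def e3_def \<Gamma>_def X_def
    by (intro tendsto_intros v w V q_nonzero assms)
qed

lemma norm_v_le: assumes "t \<in> S" "h \<noteq> 0" shows "norm (v h t) \<le> (\<Sum>i\<in>UNIV. norm (u2 i i t))"
  unfolding v_def by (rule sum_norm_le) (rule norm_diff_quot_le[OF u2[OF assms(1)] assms(2)])

lemma norm_w_le: assumes "t \<in> S" "h \<noteq> 0" shows "norm (w h t) \<le> (\<Sum>i\<in>UNIV. norm (p2 i i t))"
  unfolding w_def by (rule sum_norm_le) (rule norm_diff_quot_le[OF p2[OF assms(1)] assms(2)])

text \<open>The defect in the preceding lemma tends to \<open>0\<close> at each time and is dominated on compact time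
  intervals, since difference quotients are bounded by the derivatives.\<close>

lemma I3_conserved: assumes "t \<in> S" shows "i3 t = i3 0"
proof -
  have sub: "{0..t} \<subseteq> S" and 0: "0 \<in> S" "0 \<le> t" using assms by (auto simp: S_def)
  define h where "h n = inverse (real (Suc n))" for n
  have h: "h n \<noteq> 0" for n by (simp add: h_def)
  have h0: "filterlim h (at 0) sequentially"
    unfolding filterlim_at using h LIMSEQ_inverse_real_of_nat by (simp add: h_def[abs_def])
  define f where "f n r = 2 * a * k r * (X r - inner (v (h n) r) (w (h n) r))" for n r
  define B where "B r = \<bar>2 * a * k r\<bar> * (\<bar>X r\<bar> + (\<Sum>i\<in>UNIV. norm (u2 i i r)) * (\<Sum>i\<in>UNIV. norm (p2 i i r)))" for r
  have int: "(f n has_integral i3h (h n) t - i3h (h n) 0) {0..t}" for n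
  proof (rule fundamental_theorem_of_calculus[OF 0(2)])
    fix r assume "r \<in> {0..t}"
    then have "r \<in> S" using sub by blast
    from i3h_deriv[OF this] show "(i3h (h n) has_vector_derivative f n r) (at r within {0..t})"
      unfolding f_def has_real_derivative_iff_has_vector_derivative
      by (rule has_vector_derivative_within_subset[OF _ sub])
  qed
  have "B integrable_on {0..t}"
  proof (rule integrable_continuous_real, rule continuous_on_subset[OF _ sub])
    show "continuous_on S B"
      unfolding B_def X_def lp_def
      using DERIV_continuous_on[OF k_deriv] continuous_on_vector_derivative[OF u2_time]
      by (intro continuous_intros cont_lu p2_cont) auto
  qed
  moreover have "norm (f n r) \<le> B r" if "r \<in> {0..t}" for n r
  proof -
    have r: "r \<in> S" using that sub by blast
    have "\<bar>inner (v (h n) r) (w (h n) r)\<bar> \<le> norm (v (h n) r) * norm (w (h n) r)"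
      by (rule Cauchy_Schwarz_ineq2)
    also have "\<dots> \<le> (\<Sum>i\<in>UNIV. norm (u2 i i r)) * (\<Sum>i\<in>UNIV. norm (p2 i i r))"
      by (intro mult_mono norm_v_le norm_w_le r h) (auto intro: sum_nonneg)
    finally have "\<bar>X r - inner (v (h n) r) (w (h n) r)\<bar> \<le> \<bar>X r\<bar> + (\<Sum>i\<in>UNIV. norm (u2 i i r)) * (\<Sum>i\<in>UNIV. norm (p2 i i r))"
      by linarith
    then show ?thesis unfolding f_def B_def real_norm_def abs_mult[of _ "X r - _"]
      by (rule mult_left_mono) simp
  qed
  moreover have "(\<lambda>n. f n r) \<longlonglongrightarrow> 0" if "r \<in> {0..t}" for r
  proof -
    have "r \<in> S" using that sub by blast
    then have "(\<lambda>n. inner (v (h n) r) (w (h n) r)) \<longlonglongrightarrow> X r"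
      by (intro filterlim_compose[OF inner_vw_tendsto h0])
    then have "(\<lambda>n. f n r) \<longlonglongrightarrow> 2 * a * k r * (X r - X r)"
      unfolding f_def by (intro tendsto_intros)
    then show ?thesis by simp
  qed
  ultimately have "(\<lambda>n. integral {0..t} (f n)) \<longlonglongrightarrow> integral {0..t} (\<lambda>r. 0)"
    using has_integral_integrable[OF int] by (intro dominated_convergence(2)[where h = B]) auto
  moreover have "integral {0..t} (f n) = i3h (h n) t - i3h (h n) 0" for n
    using int by (rule integral_unique)
  ultimately have "(\<lambda>n. i3h (h n) t - i3h (h n) 0) \<longlonglongrightarrow> 0" by simp
  moreover have "(\<lambda>n. i3h (h n) t - i3h (h n) 0) \<longlonglongrightarrow> i3 t - i3 0"
    by (intro tendsto_diff filterlim_compose[OF i3h_tendsto(1) h0] assms 0)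
  ultimately have "0 = i3 t - i3 0" by (rule LIMSEQ_unique)
  then show ?thesis by simp
qed

end

section \<open>A priori bounds\<close>

text \<open>The algebraic core of the estimates, with \<open>q\<close> scaled away: \<open>c = \<bar>a\<bar>\<close>, \<open>\<alpha> = q \<parallel>u\<^sub>t\<parallel>\<^sup>2\<close>,
  \<open>\<sigma> = \<parallel>\<nabla>u\<parallel>\<^sup>2 / q\<close>, \<open>n = q \<parallel>\<nabla>u\<^sub>t\<parallel>\<^sup>2\<close>, \<open>l = \<parallel>\<Delta>u\<parallel>\<^sup>2 / q\<close>, \<open>f = q \<parallel>\<Delta>u\<^sub>t\<parallel>\<^sup>2\<close>, \<open>g = \<parallel>\<nabla>\<Delta>u\<parallel>\<^sup>2 / q\<close>.  Interpolation
  gives \<open>(n l)\<^sup>2 \<le> \<alpha> \<sigma> f g\<close>; taking the geometric mean of the two bounds for \<open>m\<close> and of the two bounds for \<open>X\<close>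
  gives \<open>(m X)\<^sup>2 \<le> \<alpha> \<sigma> f g\<close>.  Since \<open>c\<^sup>2 \<alpha> \<sigma>\<close> is small, both products are small compared with \<open>f + g\<close>.\<close>

lemma normalized_bounds:
  fixes c \<alpha> \<sigma> n l f g m X :: real
  assumes nn: "c \<ge> 0" "\<alpha> \<ge> 0" "\<sigma> \<ge> 0" "n \<ge> 0" "l \<ge> 0" "f \<ge> 0" "g \<ge> 0"
    and c: "c * \<alpha> \<le> 1 / 5" "c * \<sigma> \<le> 1 / 6"
    and n: "n\<^sup>2 \<le> \<alpha> * f" and l: "l\<^sup>2 \<le> \<sigma> * g"
    and m: "m\<^sup>2 \<le> \<sigma> * n" "m\<^sup>2 \<le> \<alpha> * l"
    and X: "X\<^sup>2 \<le> l * f" "X\<^sup>2 \<le> n * g"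
  shows "c * m\<^sup>2 \<le> (n + l) / 5"
    and "\<bar>2 * c * m * X\<bar> \<le> (f + g) / 5"
    and "c\<^sup>2 * m\<^sup>2 * (n + l) / 2 \<le> (f + g) / 50"
    and "c ^ 3 * m ^ 4 / 4 \<le> (f + g) / 1200"
    and "c * (n - l)\<^sup>2 / 4 \<le> (f + g) / 20"
proof -
  have "c * m\<^sup>2 \<le> c * (\<alpha> * l)" using m nn by (intro mult_left_mono) auto
  also have "\<dots> = (c * \<alpha>) * l" by simp
  also have "\<dots> \<le> 1 / 5 * l" using c nn by (intro mult_right_mono) auto
  also have "\<dots> \<le> (n + l) / 5" using nn by simp
  finally show "c * m\<^sup>2 \<le> (n + l) / 5" .
  have cc: "(c * \<sigma>) * (c * \<alpha>) \<le> 1 / 30"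
    using mult_mono[OF c(2) c(1)] nn by simp
  have fg: "f * g \<le> (f + g)\<^sup>2 / 4"
    using sum_squares_ge_zero[of "f - g" 0] by (simp add: power2_eq_square algebra_simps)
  have fg0: "0 \<le> f * g" using nn by simp
  have ccfg: "(c * \<sigma>) * (c * \<alpha>) * (f * g) \<le> (f + g)\<^sup>2 / 120"
    using mult_right_mono[OF cc fg0] fg by linarith
  have nl: "(n * l)\<^sup>2 \<le> (\<alpha> * f) * (\<sigma> * g)"
    unfolding power_mult_distrib using n l nn by (intro mult_mono) auto
  have "(c * (n * l))\<^sup>2 \<le> c\<^sup>2 * ((\<alpha> * f) * (\<sigma> * g))"
    unfolding power_mult_distrib[of c] using nl by (intro mult_left_mono) auto
  also have "\<dots> = (c * \<sigma>) * (c * \<alpha>) * (f * g)" by (simp add: power2_eq_square)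
  also have "\<dots> \<le> (f + g)\<^sup>2 / 120" by (rule ccfg)
  also have "\<dots> \<le> ((f + g) / 10)\<^sup>2" by (simp add: power_divide)
  finally have cnl: "c * (n * l) \<le> (f + g) / 10"
    by (rule power2_le_imp_le) (use nn in auto)
  have m4: "m ^ 4 \<le> (\<sigma> * n) * (\<alpha> * l)"
    using mult_mono[OF m] nn by (simp add: power4_eq_xxxx power2_eq_square mult.assoc)
  have X4: "X ^ 4 \<le> (l * f) * (n * g)"
    using mult_mono[OF X] nn by (simp add: power4_eq_xxxx power2_eq_square mult.assoc)
  have "((m * X)\<^sup>2)\<^sup>2 = m ^ 4 * X ^ 4" by (simp add: power_mult_distrib power4_eq_xxxx power2_eq_square)
  also have "\<dots> \<le> ((\<sigma> * n) * (\<alpha> * l)) * ((l * f) * (n * g))"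
    using m4 X4 nn by (intro mult_mono) auto
  also have "\<dots> = (\<sigma> * \<alpha> * (f * g)) * (n * l)\<^sup>2" by (simp add: power2_eq_square)
  also have "\<dots> \<le> (\<sigma> * \<alpha> * (f * g)) * ((\<alpha> * f) * (\<sigma> * g))"
    using nl nn by (intro mult_left_mono) auto
  also have "\<dots> = (\<sigma> * \<alpha> * (f * g))\<^sup>2" by (simp add: power2_eq_square)
  finally have mX: "(m * X)\<^sup>2 \<le> \<sigma> * \<alpha> * (f * g)"
    by (rule power2_le_imp_le) (use nn in auto)
  have "(2 * c * m * X)\<^sup>2 = 4 * c\<^sup>2 * (m * X)\<^sup>2" by (simp add: power_mult_distrib)
  also have "\<dots> \<le> 4 * c\<^sup>2 * (\<sigma> * \<alpha> * (f * g))" using mX by (intro mult_left_mono) auto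
  also have "\<dots> = 4 * ((c * \<sigma>) * (c * \<alpha>) * (f * g))" by (simp add: power2_eq_square)
  also have "\<dots> \<le> 4 * ((f + g)\<^sup>2 / 120)" using ccfg by linarith
  also have "\<dots> \<le> ((f + g) / 5)\<^sup>2" by (simp add: power_divide)
  finally have "\<bar>2 * c * m * X\<bar> \<le> \<bar>(f + g) / 5\<bar>" by (simp only: abs_le_square_iff)
  then show "\<bar>2 * c * m * X\<bar> \<le> (f + g) / 5" using nn by simp
  have "m\<^sup>2 * n \<le> (\<alpha> * l) * n" "m\<^sup>2 * l \<le> (\<sigma> * n) * l"
    using m nn by (auto intro: mult_right_mono)
  then have "m\<^sup>2 * (n + l) \<le> (\<alpha> + \<sigma>) * (n * l)" by (simp add: algebra_simps)
  then have "c\<^sup>2 * (m\<^sup>2 * (n + l)) \<le> c\<^sup>2 * ((\<alpha> + \<sigma>) * (n * l))" by (intro mult_left_mono) auto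
  also have "\<dots> = (c * \<alpha> + c * \<sigma>) * (c * (n * l))" by (simp add: power2_eq_square algebra_simps)
  also have "\<dots> \<le> (1 / 5 + 1 / 6) * ((f + g) / 10)" using c cnl nn by (intro mult_mono add_mono) auto
  also have "\<dots> \<le> (f + g) / 25" using nn by simp
  finally have "c\<^sup>2 * m\<^sup>2 * (n + l) \<le> (f + g) / 25" by (simp only: mult.assoc)
  from divide_right_mono[OF this, of 2]
  show "c\<^sup>2 * m\<^sup>2 * (n + l) / 2 \<le> (f + g) / 50" by simp
  have "c ^ 3 * m ^ 4 \<le> c ^ 3 * ((\<sigma> * n) * (\<alpha> * l))" using m4 nn by (intro mult_left_mono) auto
  also have "\<dots> = ((c * \<sigma>) * (c * \<alpha>)) * (c * (n * l))" by (simp add: power3_eq_cube)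
  also have "\<dots> \<le> (1 / 30) * ((f + g) / 10)" using cc cnl nn by (intro mult_mono) auto
  finally show "c ^ 3 * m ^ 4 / 4 \<le> (f + g) / 1200" by simp
  have "(n - l)\<^sup>2 \<le> n\<^sup>2 + l\<^sup>2" using nn by (simp add: power2_diff)
  then have "c * (n - l)\<^sup>2 \<le> c * (\<alpha> * f + \<sigma> * g)" using n l nn by (intro mult_left_mono) auto
  also have "\<dots> = (c * \<alpha>) * f + (c * \<sigma>) * g" by (simp add: algebra_simps)
  also have "\<dots> \<le> 1 / 5 * f + 1 / 6 * g" using c nn by (intro add_mono mult_right_mono) auto
  also have "\<dots> \<le> (f + g) / 5" using nn by simp
  finally show "c * (n - l)\<^sup>2 / 4 \<le> (f + g) / 20" by simp
qed

lemma sum_inner_Cauchy_Schwarz: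
  fixes x y :: "'i \<Rightarrow> 'a::real_inner"
  shows "(\<Sum>i\<in>A. inner (x i) (y i))\<^sup>2 \<le> (\<Sum>i\<in>A. (norm (x i))\<^sup>2) * (\<Sum>i\<in>A. (norm (y i))\<^sup>2)"
proof -
  have "\<bar>\<Sum>i\<in>A. inner (x i) (y i)\<bar> \<le> (\<Sum>i\<in>A. norm (x i) * norm (y i))"
    by (rule order_trans[OF sum_abs]) (intro sum_mono Cauchy_Schwarz_ineq2)
  from power_mono[OF this abs_ge_zero, of 2]
  have "(\<Sum>i\<in>A. inner (x i) (y i))\<^sup>2 \<le> (\<Sum>i\<in>A. norm (x i) * norm (y i))\<^sup>2"
    by simp
  also have "\<dots> \<le> (\<Sum>i\<in>A. (norm (x i))\<^sup>2) * (\<Sum>i\<in>A. (norm (y i))\<^sup>2)"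
    by (rule Cauchy_Schwarz_ineq_sum)
  finally show ?thesis .
qed

lemma inner_sq_le: "(inner x y)\<^sup>2 \<le> (norm x)\<^sup>2 * (norm y)\<^sup>2"
  using Cauchy_Schwarz_ineq[of x y] by (simp add: power2_norm_eq_inner)

context kirchhoff_l2 begin

context
  assumes a_nonzero: "a \<noteq> 0"
    and I1_small: "(norm (p 0))\<^sup>2 + s 0 / (b * q 0) \<le> 1 / (6 * \<bar>a * b\<bar>)"
begin

text \<open>Both summands of the conserved \<open>I\<^sub>1\<close> are nonnegative, so each of them obeys the bound on \<open>I\<^sub>1\<close> at all times;
  the second one controls \<open>q - b = a s\<close>.\<close>

lemma smallness_persists: assumes "t \<in> S"
  shows "\<bar>a\<bar> * s t \<le> q t / 6" and "\<bar>a\<bar> * (norm (p t))\<^sup>2 \<le> 1 / (6 * b)"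
    and "6 / 7 * b \<le> q t" and "q t \<le> 6 / 5 * b"
proof -
  have I1: "(norm (p t))\<^sup>2 + s t / (b * q t) \<le> 1 / (6 * \<bar>a\<bar> * b)"
    using I1_small I1_conserved[OF assms] b_pos by (simp add: abs_mult)
  have q: "q t > 0" by (rule q_pos[OF assms])
  have a: "\<bar>a\<bar> > 0" using a_nonzero by simp
  have "s t / (b * q t) \<le> 1 / (6 * \<bar>a\<bar> * b)" using I1 zero_le_power2[of "norm (p t)"] by linarith
  then show 1: "\<bar>a\<bar> * s t \<le> q t / 6" using q a b_pos by (simp add: field_simps)
  have "0 \<le> s t / (b * q t)" using q b_pos s_nonneg[of t] by simp
  then have "(norm (p t))\<^sup>2 \<le> 1 / (6 * \<bar>a\<bar> * b)" using I1 by linarith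
  then show "\<bar>a\<bar> * (norm (p t))\<^sup>2 \<le> 1 / (6 * b)" using a b_pos by (simp add: field_simps)
  have "\<bar>q t - b\<bar> = \<bar>a\<bar> * s t" using s_nonneg[of t] by (simp add: q_def abs_mult)
  with 1 show "6 / 7 * b \<le> q t" "q t \<le> 6 / 5 * b" by linarith+
qed

lemma \<Gamma>_nonneg: "\<Gamma> t \<ge> 0" by (simp add: \<Gamma>_def sum_nonneg)
lemma N_nonneg: "N t \<ge> 0" by (simp add: N_def sum_nonneg)
lemma L_nonneg: "L t \<ge> 0" by (simp add: L_def)

lemma energy_bounds: assumes t: "t \<in> S"
  shows "\<bar>a * (m t)\<^sup>2\<bar> \<le> e2 t / 5" and "\<bar>i3 t - e3 t\<bar> \<le> e3 t / 2"
proof -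
  have q: "q t > 0" by (rule q_pos[OF t])
  define c \<alpha> \<sigma> n l f g where "c = \<bar>a\<bar>" and "\<alpha> = q t * (norm (p t))\<^sup>2" and "\<sigma> = s t / q t"
    and "n = q t * N t" and "l = L t / q t" and "f = q t * (norm (lp t))\<^sup>2" and "g = \<Gamma> t / q t"
  note defs = c_def \<alpha>_def \<sigma>_def n_def l_def f_def g_def
  have nn: "c \<ge> 0" "\<alpha> \<ge> 0" "\<sigma> \<ge> 0" "n \<ge> 0" "l \<ge> 0" "f \<ge> 0" "g \<ge> 0"
    using q s_nonneg \<Gamma>_nonneg N_nonneg L_nonneg by (auto simp: defs)
  have "c * \<alpha> = q t * (\<bar>a\<bar> * (norm (p t))\<^sup>2)" by (simp add: defs)
  also have "\<dots> \<le> (6 / 5 * b) * (1 / (6 * b))"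
    using smallness_persists[OF t] q b_pos by (intro mult_mono) auto
  finally have c1: "c * \<alpha> \<le> 1 / 5" using b_pos by simp
  have c2: "c * \<sigma> \<le> 1 / 6" using smallness_persists(1)[OF t] q by (simp add: defs field_simps)
  have "(N t)\<^sup>2 \<le> (norm (lp t))\<^sup>2 * (norm (p t))\<^sup>2"
    using inner_sq_le[of "lp t" "p t"] by (simp add: N_parts[OF t])
  then have "(q t)\<^sup>2 * (N t)\<^sup>2 \<le> (q t)\<^sup>2 * ((norm (lp t))\<^sup>2 * (norm (p t))\<^sup>2)" by (intro mult_left_mono) auto
  then have n: "n\<^sup>2 \<le> \<alpha> * f" by (simp add: defs power_mult_distrib power2_eq_square mult.commute mult.left_commute)
  have "(L t)\<^sup>2 \<le> s t * \<Gamma> t"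
    using sum_inner_Cauchy_Schwarz[of "\<lambda>i. u1 i t" "\<lambda>i. gl i t" UNIV]
    by (simp add: L_parts[OF t] s_def \<Gamma>_def)
  then have l: "l\<^sup>2 \<le> \<sigma> * g"
    using q by (simp add: defs power_divide power2_eq_square divide_right_mono)
  have "(m t)\<^sup>2 \<le> s t * N t"
    using sum_inner_Cauchy_Schwarz[of "\<lambda>i. u1 i t" "\<lambda>i. p1 i t" UNIV] by (simp add: m_def s_def N_def)
  then have m1: "(m t)\<^sup>2 \<le> \<sigma> * n" using q by (simp add: defs)
  have "(m t)\<^sup>2 \<le> L t * (norm (p t))\<^sup>2"
    using inner_sq_le[of "lu t" "p t"] by (simp add: m_parts[OF t] L_def)
  then have m2: "(m t)\<^sup>2 \<le> \<alpha> * l" using q by (simp add: defs mult.commute)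
  have "(X t)\<^sup>2 \<le> L t * (norm (lp t))\<^sup>2" using inner_sq_le[of "lu t" "lp t"] by (simp add: X_def L_def)
  then have X1: "(X t)\<^sup>2 \<le> l * f" using q by (simp add: defs)
  have "(X t)\<^sup>2 \<le> N t * \<Gamma> t"
    using sum_inner_Cauchy_Schwarz[of "\<lambda>i. p1 i t" "\<lambda>i. gl i t" UNIV] by (simp add: X_parts[OF t] N_def \<Gamma>_def)
  then have X2: "(X t)\<^sup>2 \<le> n * g" using q by (simp add: defs)
  note bounds = normalized_bounds[OF nn c1 c2 n l m1 m2 X1 X2]
  have e2: "e2 t = n + l" and e3: "e3 t = f + g" by (simp_all add: e2_def e3_def defs)
  show "\<bar>a * (m t)\<^sup>2\<bar> \<le> e2 t / 5" using bounds(1) by (simp add: abs_mult e2 c_def)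
  have "q t * k t = n - l"
    using q by (simp add: k_def defs right_diff_distrib power2_eq_square)
  then have qk: "(q t)\<^sup>2 * (k t)\<^sup>2 = (n - l)\<^sup>2"
    by (simp only: power_mult_distrib[symmetric])
  have i3: "i3 t - e3 t = - (2 * a * m t * X t) + a\<^sup>2 * (m t)\<^sup>2 * (n + l) / 2 - a ^ 3 * (m t) ^ 4 / 4 - a * (n - l)\<^sup>2 / 4"
    by (simp add: i3_def low_def e2 qk[symmetric])
  \<comment> \<open>\<open>1 / 5 + 1 / 50 + 1 / 1200 + 1 / 20 < 1 / 2\<close>\<close>
  have combine: "\<bar>- A + B - C - D\<bar> \<le> y / 2"
    if "\<bar>A\<bar> \<le> y / 5" "0 \<le> B" "B \<le> y / 50" "\<bar>C\<bar> \<le> y / 1200" "\<bar>D\<bar> \<le> y / 20" "0 \<le> y" for A B C D y :: real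
    using that by linarith
  show "\<bar>i3 t - e3 t\<bar> \<le> e3 t / 2" unfolding i3 unfolding e3
  proof (rule combine)
    show "\<bar>2 * a * m t * X t\<bar> \<le> (f + g) / 5" using bounds(2) by (simp add: abs_mult c_def)
    show "0 \<le> a\<^sup>2 * (m t)\<^sup>2 * (n + l) / 2" "a\<^sup>2 * (m t)\<^sup>2 * (n + l) / 2 \<le> (f + g) / 50"
      using bounds(3) nn by (simp_all add: c_def)
    show "\<bar>a ^ 3 * (m t) ^ 4 / 4\<bar> \<le> (f + g) / 1200"
      using bounds(4) by (simp add: c_def abs_mult power_abs)
    show "\<bar>a * (n - l)\<^sup>2 / 4\<bar> \<le> (f + g) / 20" using bounds(5) by (simp add: c_def abs_mult)
  qed (use nn in simp)
qed

lemma e2_nonneg: "t \<in> S \<Longrightarrow> e2 t \<ge> 0"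
  using q_pos[of t] N_nonneg[of t] L_nonneg[of t] by (simp add: e2_def)

lemma e3_nonneg: "t \<in> S \<Longrightarrow> e3 t \<ge> 0"
  using q_pos[of t] \<Gamma>_nonneg[of t] by (simp add: e3_def)

lemma e2_le_initial: assumes "t \<in> S" shows "e2 t \<le> 3 * e2 0"
proof -
  have 0: "0 \<in> S" using assms by (simp add: S_def)
  show ?thesis
    using energy_bounds(1)[OF assms] energy_bounds(1)[OF 0] I2_conserved[OF assms]
      e2_nonneg[OF assms] e2_nonneg[OF 0] by linarith
qed

lemma e3_le_initial: assumes "t \<in> S" shows "e3 t \<le> 3 * e3 0"
proof -
  have 0: "0 \<in> S" using assms by (simp add: S_def)
  show ?thesis
    using energy_bounds(2)[OF assms] energy_bounds(2)[OF 0] I3_conserved[OF assms]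
      e3_nonneg[OF assms] e3_nonneg[OF 0] by linarith
qed

end

text \<open>The third time derivative \<open>u\<^sub>t\<^sub>t\<^sub>t = (\<Delta>u / q\<^sup>2)\<^sub>t\<close>.\<close>

definition jerk :: "real \<Rightarrow> 'n l2" where
  "jerk t = (1 / (q t)\<^sup>2) *\<^sub>R lp t - (4 * a * m t / (q t) ^ 3) *\<^sub>R lu t"

lemma acceleration_deriv: assumes "t \<in> S"
  shows "((\<lambda>t. (1 / (q t)\<^sup>2) *\<^sub>R lu t) has_vector_derivative jerk t) (at t within S)"
proof -
  have "((\<lambda>t. 1 / (q t)\<^sup>2) has_real_derivative - (4 * a * m t / (q t) ^ 3)) (at t within S)"
  proof -
    have "((\<lambda>t. 1 / (q t)\<^sup>2) has_real_derivative
        (0 * (q t)\<^sup>2 - 1 * (2 * a * m t * q t * 2)) / ((q t)\<^sup>2 * (q t)\<^sup>2)) (at t within S)"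
      using q_nonzero[OF assms] by (auto intro!: derivative_eq_intros q_deriv assms)
    moreover have "(0 * (q t)\<^sup>2 - 1 * (2 * a * m t * q t * 2)) / ((q t)\<^sup>2 * (q t)\<^sup>2) = - (4 * a * m t / (q t) ^ 3)"
      using q_nonzero[OF assms] by (simp add: field_simps power2_eq_square power3_eq_cube)
    ultimately show ?thesis by simp
  qed
  from has_vector_derivative_scaleR[OF this lu_deriv[OF assms]]
  show ?thesis by (simp add: jerk_def)
qed

definition time_deriv :: "nat \<Rightarrow> real \<Rightarrow> 'n l2" where
  "time_deriv j = (if j = 0 then u else if j = 1 then p else if j = 2 then (\<lambda>t. (1 / (q t)\<^sup>2) *\<^sub>R lu t) else jerk)"

end

text \<open>A bound for all derivatives of orders one to three in terms of the initial leading energies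
  \<open>\<epsilon>\<^sub>2\<close>, \<open>\<epsilon>\<^sub>3\<close> of \<open>I\<^sub>2\<close>, \<open>I\<^sub>3\<close>: the sum of separate bounds for \<open>\<parallel>\<nabla>u\<parallel>\<close>, \<open>\<parallel>u\<^sub>t\<parallel>\<close>, \<open>\<parallel>\<nabla>u\<^sub>t\<parallel>\<close>, \<open>\<parallel>\<Delta>u\<parallel>\<close>, \<open>\<parallel>\<Delta>u\<^sub>t\<parallel>\<close>,
  \<open>\<parallel>\<nabla>\<Delta>u\<parallel>\<close>, \<open>\<parallel>u\<^sub>t\<^sub>t\<parallel>\<close>, \<open>\<parallel>\<nabla>u\<^sub>t\<^sub>t\<parallel>\<close> and \<open>\<parallel>u\<^sub>t\<^sub>t\<^sub>t\<parallel>\<close>.  The numbers \<open>7 / (6 b)\<close> and \<open>6 b / 5\<close> bound \<open>1 / q\<close> and \<open>q\<close>, and the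
  factor \<open>3\<close> is the ratio by which the energies may grow.\<close>

definition data_bound :: "real \<Rightarrow> real \<Rightarrow> real \<Rightarrow> real \<Rightarrow> real" where
  "data_bound a b \<epsilon>\<^sub>2 \<epsilon>\<^sub>3 =
     (let P = sqrt (1 / (6 * \<bar>a\<bar> * b)); D = sqrt (6 / 5 * b * (3 * \<epsilon>\<^sub>2)); F = sqrt (7 / (6 * b) * (3 * \<epsilon>\<^sub>3));
          G = sqrt (6 / 5 * b * (3 * \<epsilon>\<^sub>3)); r = (7 / (6 * b))\<^sup>2
      in sqrt (b / (5 * \<bar>a\<bar>)) + P + sqrt (7 / (6 * b) * (3 * \<epsilon>\<^sub>2)) + D + F + G
         + r * D + r * G + (r * F + 4 * \<bar>a\<bar> * (D * P) * (7 / (6 * b)) ^ 3 * D))"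

context kirchhoff_l2 begin

lemma derivatives_bounded:
  assumes a: "a \<noteq> 0" and I1: "(norm (p 0))\<^sup>2 + s 0 / (b * q 0) \<le> 1 / (6 * \<bar>a * b\<bar>)"
    and t: "t \<in> S" and len: "1 \<le> length \<alpha> + j" "length \<alpha> + j \<le> 3"
  shows "\<exists>G. wderiv \<alpha> (time_deriv j t) G \<and> norm G \<le> data_bound a b (e2 0) (e3 0)"
proof -
  note sm = smallness_persists[OF a I1 t]
  have q: "q t > 0" by (rule q_pos[OF t])
  have 0: "0 \<in> S" using t by (simp add: S_def)
  note N0 = N_nonneg[OF a I1, of t] and L0 = L_nonneg[OF a I1, of t] and G0 = \<Gamma>_nonneg[OF a I1, of t]
  define \<epsilon>2 \<epsilon>3 where "\<epsilon>2 = e2 0" and "\<epsilon>3 = e3 0"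
  define Q where "Q = 7 / (6 * b)"
  have Q: "Q > 0" "1 / q t \<le> Q" using b_pos q sm(3) by (auto simp: Q_def field_simps)
  define P where "P = sqrt (1 / (6 * \<bar>a\<bar> * b))"
  define D where "D = sqrt (6 / 5 * b * (3 * \<epsilon>2))"
  define F where "F = sqrt (Q * (3 * \<epsilon>3))"
  define G where "G = sqrt (6 / 5 * b * (3 * \<epsilon>3))"
  define U where "U = sqrt (b / (5 * \<bar>a\<bar>))"
  define B where "B = sqrt (Q * (3 * \<epsilon>2))"
  have \<epsilon>: "e2 t \<le> 3 * \<epsilon>2" "e3 t \<le> 3 * \<epsilon>3" "\<epsilon>2 \<ge> 0" "\<epsilon>3 \<ge> 0"
    using e2_le_initial[OF a I1 t] e3_le_initial[OF a I1 t] e2_nonneg[OF a I1 0] e3_nonneg[OF a I1 0]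
    by (auto simp: \<epsilon>2_def \<epsilon>3_def)
  have nn: "P \<ge> 0" "D \<ge> 0" "F \<ge> 0" "G \<ge> 0" "U \<ge> 0" "B \<ge> 0"
    using b_pos Q \<epsilon> by (auto simp: P_def D_def F_def G_def U_def B_def)
  define J where "J = Q\<^sup>2 * F + 4 * \<bar>a\<bar> * (D * P) * Q ^ 3 * D"
  define M where "M = data_bound a b (e2 0) (e3 0)"
  have "M = U + P + B + D + F + G + Q\<^sup>2 * D + Q\<^sup>2 * G + J"
    by (simp add: M_def J_def data_bound_def Let_def U_def P_def B_def D_def F_def G_def Q_def \<epsilon>2_def \<epsilon>3_def)
  moreover have "0 \<le> Q\<^sup>2 * D" "0 \<le> Q\<^sup>2 * G" "0 \<le> J"
    using nn Q by (auto simp: J_def)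
  ultimately have M: "U \<le> M" "P \<le> M" "B \<le> M" "D \<le> M" "F \<le> M" "G \<le> M" "Q\<^sup>2 * D \<le> M" "Q\<^sup>2 * G \<le> M" "J \<le> M"
    using nn by linarith+
  have pP: "norm (p t) \<le> P"
    unfolding P_def by (rule real_le_rsqrt) (use sm(2) a b_pos in \<open>simp add: field_simps\<close>)
  have sU: "sqrt (s t) \<le> U"
    unfolding U_def by (rule real_sqrt_le_mono) (use sm(1,4) a b_pos in \<open>simp add: field_simps\<close>)
  have "q t * N t \<le> e2 t" "L t / q t \<le> e2 t" "q t * (norm (lp t))\<^sup>2 \<le> e3 t" "\<Gamma> t / q t \<le> e3 t"
    using q N0 L0 G0 by (auto simp: e2_def e3_def)
  with \<epsilon> have le: "q t * N t \<le> 3 * \<epsilon>2" "L t / q t \<le> 3 * \<epsilon>2" "q t * (norm (lp t))\<^sup>2 \<le> 3 * \<epsilon>3" "\<Gamma> t / q t \<le> 3 * \<epsilon>3"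
    by linarith+
  have up: "y \<le> Q * e" if "q t * y \<le> e" "e \<ge> 0" for y e
  proof -
    have "y \<le> (1 / q t) * e" using that q by (simp add: field_simps)
    also have "\<dots> \<le> Q * e" using that Q by (intro mult_right_mono) auto
    finally show ?thesis .
  qed
  have dn: "y \<le> 6 / 5 * b * e" if "y / q t \<le> e" "e \<ge> 0" for y e
  proof -
    have "y \<le> q t * e" using that q by (simp add: field_simps)
    also have "\<dots> \<le> 6 / 5 * b * e" using that sm(4) by (intro mult_right_mono) auto
    finally show ?thesis .
  qed
  have NB: "sqrt (N t) \<le> B"
    unfolding B_def using le(1) \<epsilon> by (intro real_sqrt_le_mono up) auto
  have luD: "norm (lu t) \<le> D"
    unfolding D_def using dn[OF le(2)] \<epsilon> by (intro real_le_rsqrt) (simp add: L_def)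
  have lpF: "norm (lp t) \<le> F"
    unfolding F_def using le(3) \<epsilon> by (intro real_le_rsqrt up) auto
  have \<Gamma>G: "sqrt (\<Gamma> t) \<le> G"
    unfolding G_def using le(4) \<epsilon> by (intro real_sqrt_le_mono dn) auto
  have comp: "norm (x i) \<le> sqrt (\<Sum>i\<in>UNIV. (norm (x i))\<^sup>2)" for x :: "'n \<Rightarrow> 'n l2" and i
    by (rule real_le_rsqrt) (rule member_le_sum, auto)
  have u1U: "norm (u1 i t) \<le> U" for i
    using comp[of "\<lambda>i. u1 i t" i] sU by (simp add: s_def)
  have p1B: "norm (p1 i t) \<le> B" for i
    using comp[of "\<lambda>i. p1 i t" i] NB by (simp add: N_def)
  have glG: "norm (gl i t) \<le> G" for i
    using comp[of "\<lambda>i. gl i t" i] \<Gamma>G by (simp add: \<Gamma>_def)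
  have u2D: "norm (u2 i i' t) \<le> D" for i i'
    using norm_second_derivative_le_laplacian[OF u1[OF t] u2[OF t], of i i'] luD by (simp add: lu_def)
  have p2F: "norm (p2 i i' t) \<le> F" for i i'
    using norm_second_derivative_le_laplacian[OF p1[OF t] p2[OF t], of i i'] lpF by (simp add: lp_def)
  have u3G: "norm (u3 i i' i'' t) \<le> G" for i i' i''
    using norm_second_derivative_le_laplacian[OF u2[OF t, where i = i] u3[OF t, where i = i], of i' i''] glG[of i]
    by (simp add: gl_commuted[OF t])
  have qQ: "1 / (q t)\<^sup>2 \<le> Q\<^sup>2" "1 / (q t) ^ 3 \<le> Q ^ 3"
    using power_mono[OF Q(2), of 2] power_mono[OF Q(2), of 3] q by (simp_all add: power_divide)
  have acc: "norm ((1 / (q t)\<^sup>2) *\<^sub>R y) \<le> Q\<^sup>2 * e" if "norm y \<le> e" for y :: "'n l2" and e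
  proof -
    have "(1 / (q t)\<^sup>2) * norm y \<le> Q\<^sup>2 * e" by (rule mult_mono[OF qQ(1) that]) auto
    then show ?thesis by simp
  qed
  have mm: "\<bar>m t\<bar> \<le> D * P"
    using Cauchy_Schwarz_ineq2[of "lu t" "p t"] mult_mono[OF luD pP] nn by (simp add: m_parts[OF t])
  have "norm ((4 * a * m t / (q t) ^ 3) *\<^sub>R lu t) = 4 * \<bar>a\<bar> * \<bar>m t\<bar> * (1 / (q t) ^ 3) * norm (lu t)"
    using q by (simp add: abs_mult)
  also have "\<dots> \<le> 4 * \<bar>a\<bar> * (D * P) * Q ^ 3 * D"
    using mm qQ(2) luD nn Q q by (intro mult_mono) auto
  finally have jerk: "norm (jerk t) \<le> J"
    unfolding jerk_def J_def using acc[OF lpF] norm_triangle_ineq4[of "(1 / (q t)\<^sup>2) *\<^sub>R lp t" "(4 * a * m t / (q t) ^ 3) *\<^sub>R lu t"]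
    by linarith
  have two: "wderiv [i, i'] (u t) (u2 i i' t)" "wderiv [i, i'] (p t) (p2 i i' t)" for i i'
    using wderiv_append[OF u1[OF t, of i], of "[i']"] wderiv_append[OF p1[OF t, of i], of "[i']"] u2[OF t] p2[OF t] by auto
  have three: "wderiv [i, i', i''] (u t) (u3 i i' i'' t)" for i i' i''
    using wderiv_append[OF two(1), of i i' "[i'']"] u3[OF t] by auto
  have one: "wderiv [i] ((1 / (q t)\<^sup>2) *\<^sub>R lu t) ((1 / (q t)\<^sup>2) *\<^sub>R gl i t)" for i
    by (intro wderiv_scaleR wderiv_gl t)
  have "j = 0 \<or> j = 1 \<or> j = 2 \<or> j = 3" using len by linarith
  moreover have "\<alpha> = [] \<or> (\<exists>i. \<alpha> = [i]) \<or> (\<exists>i i'. \<alpha> = [i, i']) \<or> (\<exists>i i' i''. \<alpha> = [i, i', i''])"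
    using len by (cases \<alpha>; cases "tl \<alpha>"; cases "tl (tl \<alpha>)"; cases "tl (tl (tl \<alpha>))") auto
  ultimately consider (c1) i where "j = 0" "\<alpha> = [i]" | (c2) i i' where "j = 0" "\<alpha> = [i, i']"
    | (c3) i i' i'' where "j = 0" "\<alpha> = [i, i', i'']" | (c4) "j = 1" "\<alpha> = []" | (c5) i where "j = 1" "\<alpha> = [i]"
    | (c6) i i' where "j = 1" "\<alpha> = [i, i']" | (c7) "j = 2" "\<alpha> = []" | (c8) i where "j = 2" "\<alpha> = [i]"
    | (c9) "j = 3" "\<alpha> = []"
    using len by auto
  then show ?thesis
  proof cases
    case c1
    then show ?thesis using u1[OF t, of i] order_trans[OF u1U[of i] M(1)]
      by (intro exI[of _ "u1 i t"]) (simp add: time_deriv_def M_def wderiv_Nil)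
  next
    case c2
    then show ?thesis using two(1)[of i i'] order_trans[OF u2D[of i i'] M(4)]
      by (intro exI[of _ "u2 i i' t"]) (simp add: time_deriv_def M_def wderiv_Nil)
  next
    case c3
    then show ?thesis using three[of i i' i''] order_trans[OF u3G[of i i' i''] M(6)]
      by (intro exI[of _ "u3 i i' i'' t"]) (simp add: time_deriv_def M_def wderiv_Nil)
  next
    case c4
    then show ?thesis using t order_trans[OF pP M(2)]
      by (intro exI[of _ "p t"]) (simp add: time_deriv_def M_def wderiv_Nil)
  next
    case c5
    then show ?thesis using p1[OF t, of i] order_trans[OF p1B[of i] M(3)]
      by (intro exI[of _ "p1 i t"]) (simp add: time_deriv_def M_def wderiv_Nil)
  next
    case c6
    then show ?thesis using two(2)[of i i'] order_trans[OF p2F[of i i'] M(5)]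
      by (intro exI[of _ "p2 i i' t"]) (simp add: time_deriv_def M_def wderiv_Nil)
  next
    case c7
    then show ?thesis using t order_trans[OF acc[OF luD] M(7)]
      by (intro exI[of _ "(1 / (q t)\<^sup>2) *\<^sub>R lu t"]) (simp add: time_deriv_def M_def wderiv_Nil)
  next
    case c8
    then show ?thesis using one[of i] order_trans[OF acc[OF glG[of i]] M(8)]
      by (intro exI[of _ "(1 / (q t)\<^sup>2) *\<^sub>R gl i t"]) (simp add: time_deriv_def M_def wderiv_Nil)
  next
    case c9
    then show ?thesis using t order_trans[OF jerk M(9)]
      by (intro exI[of _ "jerk t"]) (simp add: time_deriv_def M_def wderiv_Nil)
  qed
qed

end

section \<open>Sobolev functions as classes\<close>

lemma is_weak_deriv_iff:
  assumes "L2 f" "L2 g" shows "is_weak_deriv \<alpha> f g \<longleftrightarrow> wderiv \<alpha> (cls f) (cls g)"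
  unfolding is_weak_deriv_def wderiv_def
  by (simp add: inner_cls assms test_function_L2 test_function_partial_derivs cong: imp_cong)

text \<open>Links the function chosen by the Hilbert operator with the weak derivative of the class.\<close>

lemma weak_deriv_eqI:
  assumes f: "L2 f" and G: "wderiv \<alpha> (cls f) G"
  shows "has_weak_deriv_L2 \<alpha> f" "L2 (weak_deriv \<alpha> f)" "cls (weak_deriv \<alpha> f) = G"
proof -
  obtain g where g: "G = cls g" "L2 g" by (rule cls_surj)
  then have *: "L2 g \<and> is_weak_deriv \<alpha> f g" using G by (simp add: is_weak_deriv_iff f)
  then show "has_weak_deriv_L2 \<alpha> f" by (auto simp: has_weak_deriv_L2_def)
  have w: "L2 (weak_deriv \<alpha> f) \<and> is_weak_deriv \<alpha> f (weak_deriv \<alpha> f)"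
    unfolding weak_deriv_def by (rule someI[where P = "\<lambda>g. L2 g \<and> is_weak_deriv \<alpha> f g", OF *])
  then show L: "L2 (weak_deriv \<alpha> f)" by simp
  have "wderiv \<alpha> (cls f) (cls (weak_deriv \<alpha> f))" using w is_weak_deriv_iff[OF f L] by simp
  then show "cls (weak_deriv \<alpha> f) = G" by (rule wderiv_unique[OF _ G])
qed

lemma weak_deriv_wderiv:
  assumes f: "L2 f" and "has_weak_deriv_L2 \<alpha> f"
  shows "L2 (weak_deriv \<alpha> f)" "wderiv \<alpha> (cls f) (cls (weak_deriv \<alpha> f))"
proof -
  obtain g where "L2 g" "is_weak_deriv \<alpha> f g" using assms by (auto simp: has_weak_deriv_L2_def)
  then have g: "wderiv \<alpha> (cls f) (cls g)" by (simp add: is_weak_deriv_iff f)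
  show "L2 (weak_deriv \<alpha> f)" "wderiv \<alpha> (cls f) (cls (weak_deriv \<alpha> f))"
    using weak_deriv_eqI(2,3)[OF f g] g by auto
qed

lemma weak_deriv_cong_cls:
  assumes "L2 f" "L2 g" "cls f = cls g" shows "weak_deriv \<alpha> f = weak_deriv \<alpha> g"
proof -
  have "(L2 h \<and> is_weak_deriv \<alpha> f h) = (L2 h \<and> is_weak_deriv \<alpha> g h)" for h
    using assms by (auto simp: is_weak_deriv_iff)
  then show ?thesis by (simp add: weak_deriv_def)
qed

lemma in_H_L2: "in_H n f \<Longrightarrow> L2 f" by (simp add: in_H_def)

lemma in_H_weak_deriv:
  assumes "in_H n f" "length \<alpha> \<le> n"
  shows "L2 (weak_deriv \<alpha> f)" "wderiv \<alpha> (cls f) (cls (weak_deriv \<alpha> f))"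
proof -
  have f: "L2 f" "has_weak_deriv_L2 \<alpha> f" using assms by (auto simp: in_H_def)
  show "L2 (weak_deriv \<alpha> f)" "wderiv \<alpha> (cls f) (cls (weak_deriv \<alpha> f))"
    by (rule weak_deriv_wderiv[OF f])+
qed

lemma in_H_0: "in_H 0 f \<longleftrightarrow> L2 f"
  using weak_deriv_eqI(1)[of f "[]" "cls f"] by (auto simp: in_H_def wderiv_Nil)

lemma Hnorm_0: assumes "L2 f" shows "Hnorm 0 f = norm (cls f)"
proof -
  have "{\<alpha>::'a list. length \<alpha> \<le> 0} = {[]}" by auto
  moreover have "L2 (weak_deriv [] f)" "cls (weak_deriv [] f) = cls f"
    using weak_deriv_eqI(2,3)[OF assms, of "[]" "cls f"] by (auto simp: wderiv_Nil)
  ultimately show ?thesis by (simp add: Hnorm_def norm_cls[symmetric])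
qed

lemma norm_weak_deriv_le_Hnorm:
  fixes f :: "real^'n \<Rightarrow> real"
  assumes "in_H n f" "length \<alpha> \<le> n" shows "norm (cls (weak_deriv \<alpha> f)) \<le> Hnorm n f"
proof -
  have fin: "finite {\<alpha>::'n list. length \<alpha> \<le> n}"
    using finite_lists_length_le[of "UNIV::'n set" n] by simp
  have "(L2norm (weak_deriv \<alpha> f))\<^sup>2 \<le> (\<Sum>\<alpha> | length \<alpha> \<le> n. (L2norm (weak_deriv \<alpha> f))\<^sup>2)"
    using assms(2) fin by (intro member_le_sum) auto
  then have "L2norm (weak_deriv \<alpha> f) \<le> Hnorm n f"
    unfolding Hnorm_def by (rule real_le_rsqrt)
  then show ?thesis using norm_cls[OF in_H_weak_deriv(1)[OF assms]] by simp
qed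

text \<open>The combination that occurs in difference quotients in time.\<close>

lemma in_H_combine:
  assumes "in_H n f" "in_H n g" "in_H n h"
  shows "in_H n (\<lambda>x. (f x - g x) / c - h x)"
    and "length \<alpha> \<le> n \<Longrightarrow> cls (weak_deriv \<alpha> (\<lambda>x. (f x - g x) / c - h x)) =
      (1 / c) *\<^sub>R (cls (weak_deriv \<alpha> f) - cls (weak_deriv \<alpha> g)) - cls (weak_deriv \<alpha> h)"
proof -
  note L = in_H_L2[OF assms(1)] in_H_L2[OF assms(2)] in_H_L2[OF assms(3)]
  have eq: "(\<lambda>x. (f x - g x) / c - h x) = (\<lambda>x. (1 / c) * (f x - g x) - h x)" by simp
  have L2: "L2 (\<lambda>x. (f x - g x) / c - h x)" unfolding eq by (intro L2_diff L2_scale L)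
  have cls: "cls (\<lambda>x. (f x - g x) / c - h x) = (1 / c) *\<^sub>R (cls f - cls g) - cls h"
    unfolding eq by (simp only: cls_diff cls_scale L2_diff L2_scale L)
  have w: "wderiv \<alpha> (cls (\<lambda>x. (f x - g x) / c - h x))
      ((1 / c) *\<^sub>R (cls (weak_deriv \<alpha> f) - cls (weak_deriv \<alpha> g)) - cls (weak_deriv \<alpha> h))"
    if "length \<alpha> \<le> n" for \<alpha>
    unfolding cls by (intro wderiv_diff wderiv_scaleR in_H_weak_deriv(2)[OF _ that] assms)
  show "in_H n (\<lambda>x. (f x - g x) / c - h x)"
    unfolding in_H_def using L2 weak_deriv_eqI(1)[OF L2 w] by blast
  show "cls (weak_deriv \<alpha> (\<lambda>x. (f x - g x) / c - h x)) =
      (1 / c) *\<^sub>R (cls (weak_deriv \<alpha> f) - cls (weak_deriv \<alpha> g)) - cls (weak_deriv \<alpha> h)" if "length \<alpha> \<le> n"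
    by (rule weak_deriv_eqI(3)[OF L2 w[OF that]])
qed

lemma wderiv_zero: "wderiv \<alpha> (cls (\<lambda>x. 0)) 0"
  by (simp add: cls_zero wderiv_def)

lemma in_H_zero: "in_H n (\<lambda>x. 0)"
  unfolding in_H_def by (intro conjI L2_zero allI impI weak_deriv_eqI(1)[OF L2_zero wderiv_zero])

lemma weak_deriv_zero: "cls (weak_deriv \<alpha> (\<lambda>x. 0)) = 0"
  by (rule weak_deriv_eqI(3)[OF L2_zero wderiv_zero])

section \<open>Derivatives in time\<close>

lemma at_within_time:
  assumes "t \<in> {0..<T::real}" shows "at t within {0..} = at t within {0..<T}"
  by (rule at_within_nhd[of _ "{..<T}"]) (use assms in auto)

lemma at_time_nontrivial: "0 \<le> (t::real) \<Longrightarrow> at t within {0..} \<noteq> bot"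
  using at_within_Icc_at_right[of t "t + 1"] 
  by (metis at_le at_within_eq_bot_iff atLeastAtMost_iff  bot.extremum_uniqueI subsetI atLeast_iff order_trans trivial_limit_at_right_real less_add_one)

lemma eventually_time_interval:
  assumes "t \<in> {0..<T::real}" shows "\<forall>\<^sub>F \<tau> in at t within {0..}. \<tau> \<in> {0..<T}"
  unfolding at_within_time[OF assms] by (simp add: eventually_at_filter)

lemma has_time_deriv_weak_deriv:
  assumes h: "has_time_deriv n U t v" and len: "length \<alpha> \<le> n"
  shows "((\<lambda>\<tau>. cls (weak_deriv \<alpha> (U \<tau>))) has_vector_derivative cls (weak_deriv \<alpha> v)) (at t within {0..})"
proof -
  let ?F = "at t within {0..}"
  have U: "in_H n (U t)" "\<forall>\<^sub>F \<tau> in ?F. in_H n (U \<tau>)" "in_H n v"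
    and lim: "((\<lambda>\<tau>. Hnorm n (\<lambda>x. (U \<tau> x - U t x) / (\<tau> - t) - v x)) \<longlongrightarrow> 0) ?F"
    using h by (auto simp: has_time_deriv_def)
  let ?W = "\<lambda>f. cls (weak_deriv \<alpha> f)"
  have "((\<lambda>\<tau>. (1 / (\<tau> - t)) *\<^sub>R (?W (U \<tau>) - ?W (U t)) - ?W v) \<longlongrightarrow> 0) ?F"
  proof (rule Lim_null_comparison[OF _ lim])
    show "\<forall>\<^sub>F \<tau> in ?F. norm ((1 / (\<tau> - t)) *\<^sub>R (?W (U \<tau>) - ?W (U t)) - ?W v)
        \<le> Hnorm n (\<lambda>x. (U \<tau> x - U t x) / (\<tau> - t) - v x)"
      using U(2)
    proof eventually_elim
      case (elim \<tau>)
      show ?case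
        using norm_weak_deriv_le_Hnorm[OF in_H_combine(1)[OF elim U(1) U(3), of "\<tau> - t"] len]
        by (simp only: in_H_combine(2)[OF elim U(1) U(3) len])
    qed
  qed
  then show ?thesis unfolding has_vector_derivative_quotient by (rule LIM_zero_cancel)
qed

lemma cls_weak_deriv_Nil: "L2 f \<Longrightarrow> cls (weak_deriv [] f) = cls f"
  by (rule weak_deriv_eqI(3)) (auto simp: wderiv_Nil)

lemma has_time_deriv_cls:
  assumes h: "has_time_deriv n U t v"
  shows "((\<lambda>\<tau>. cls (U \<tau>)) has_vector_derivative cls v) (at t within {0..})"
proof -
  have U: "L2 (U t)" "\<forall>\<^sub>F \<tau> in at t within {0..}. L2 (U \<tau>)" "L2 v"
    using h unfolding has_time_deriv_def in_H_def by (auto elim: eventually_mono)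
  have "((\<lambda>\<tau>. (1 / (\<tau> - t)) *\<^sub>R (cls (weak_deriv [] (U \<tau>)) - cls (weak_deriv [] (U t)))) \<longlongrightarrow> cls v) (at t within {0..})"
    using has_time_deriv_weak_deriv[OF h, of "[]"] U
    by (simp add: has_vector_derivative_quotient cls_weak_deriv_Nil)
  moreover have "\<forall>\<^sub>F \<tau> in at t within {0..}. (1 / (\<tau> - t)) *\<^sub>R (cls (weak_deriv [] (U \<tau>)) - cls (weak_deriv [] (U t)))
      = (1 / (\<tau> - t)) *\<^sub>R (cls (U \<tau>) - cls (U t))"
    using U(2) by eventually_elim (simp add: cls_weak_deriv_Nil U(1))
  ultimately show ?thesis unfolding has_vector_derivative_quotient by (rule Lim_transform_eventually)
qed

lemma has_time_deriv_0I:
  assumes U: "L2 (U t)" "\<forall>\<^sub>F \<tau> in at t within {0..}. L2 (U \<tau>)" "L2 v"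
    and d: "((\<lambda>\<tau>. cls (U \<tau>)) has_vector_derivative cls v) (at t within {0..})"
  shows "has_time_deriv 0 U t v"
  unfolding has_time_deriv_def in_H_0
proof (intro conjI U)
  have "((\<lambda>\<tau>. norm ((1 / (\<tau> - t)) *\<^sub>R (cls (U \<tau>) - cls (U t)) - cls v)) \<longlongrightarrow> 0) (at t within {0..})"
    using d unfolding has_vector_derivative_quotient by (intro tendsto_norm_zero LIM_zero)
  moreover have "\<forall>\<^sub>F \<tau> in at t within {0..}. norm ((1 / (\<tau> - t)) *\<^sub>R (cls (U \<tau>) - cls (U t)) - cls v) =
      Hnorm 0 (\<lambda>x. (U \<tau> x - U t x) / (\<tau> - t) - v x)"
    using U(2)
  proof eventually_elim
    case (elim \<tau>)
    have eq: "(\<lambda>x. (U \<tau> x - U t x) / (\<tau> - t) - v x) = (\<lambda>x. (1 / (\<tau> - t)) * (U \<tau> x - U t x) - v x)" by simp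
    have "L2 (\<lambda>x. (U \<tau> x - U t x) / (\<tau> - t) - v x)"
      unfolding eq by (intro L2_diff L2_scale elim U)
    then show ?case
      by (simp only: Hnorm_0) (simp only: eq cls_diff cls_scale L2_diff L2_scale elim U)
  qed
  ultimately show "((\<lambda>\<tau>. Hnorm 0 (\<lambda>x. (U \<tau> x - U t x) / (\<tau> - t) - v x)) \<longlongrightarrow> 0) (at t within {0..})"
    by (rule Lim_transform_eventually)
qed

text \<open>The time derivative chosen by \<open>dt\<close> is determined, as a class, by the strong derivative of the curve
  of classes.\<close>

lemma dt_eqI:
  assumes t: "t \<in> {0..<T}" and U: "\<And>\<tau>. \<tau> \<in> {0..<T} \<Longrightarrow> L2 (U \<tau>)"
    and d: "((\<lambda>\<tau>. cls (U \<tau>)) has_vector_derivative G) (at t within {0..<T})"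
  shows "has_time_deriv 0 U t (dt U t)" "L2 (dt U t)" "cls (dt U t) = G"
proof -
  obtain g where g: "G = cls g" "L2 g" by (rule cls_surj)
  have ev: "\<forall>\<^sub>F \<tau> in at t within {0..}. L2 (U \<tau>)"
    using eventually_time_interval[OF t] by eventually_elim (rule U)
  have d0: "((\<lambda>\<tau>. cls (U \<tau>)) has_vector_derivative cls g) (at t within {0..})"
    using d g(1) by (simp add: has_vector_derivative_quotient at_within_time[OF t])
  have "has_time_deriv 0 U t g" by (rule has_time_deriv_0I[OF U[OF t] ev g(2) d0])
  then show dt: "has_time_deriv 0 U t (dt U t)" unfolding dt_def by (rule someI[where P = "has_time_deriv 0 U t"])
  then show "L2 (dt U t)" by (simp add: has_time_deriv_def in_H_0)
  have "cls (dt U t) = cls g"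
    using at_time_nontrivial[of t] t has_time_deriv_cls[OF dt] d0
    by (intro vector_derivative_unique_within[of t "{0..}" "\<lambda>\<tau>. cls (U \<tau>)"]) auto
  then show "cls (dt U t) = G" by (simp add: g)
qed

lemma C_H_0_continuous:
  assumes "C_H 0 n T U" "length \<alpha> \<le> n"
  shows "continuous_on {0..<T} (\<lambda>\<tau>. cls (weak_deriv \<alpha> (U \<tau>)))"
  unfolding continuous_on_def
proof
  fix t assume t: "t \<in> {0..<T}"
  let ?W = "\<lambda>f. cls (weak_deriv \<alpha> f)"
  have U: "\<And>\<tau>. \<tau> \<in> {0..<T} \<Longrightarrow> in_H n (U \<tau>)" using assms(1) by simp
  have lim: "((\<lambda>\<tau>. Hnorm n (\<lambda>x. U \<tau> x - U t x)) \<longlongrightarrow> 0) (at t within {0..<T})"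
    using assms(1) t unfolding at_within_time[OF t, symmetric] by simp
  have "((\<lambda>\<tau>. ?W (U \<tau>) - ?W (U t)) \<longlongrightarrow> 0) (at t within {0..<T})"
  proof (rule Lim_null_comparison[OF _ lim])
    show "\<forall>\<^sub>F \<tau> in at t within {0..<T}. norm (?W (U \<tau>) - ?W (U t)) \<le> Hnorm n (\<lambda>x. U \<tau> x - U t x)"
      unfolding eventually_at_filter
    proof (intro always_eventually allI impI)
      fix \<tau> assume \<tau>: "\<tau> \<in> {0..<T}"
      show "norm (?W (U \<tau>) - ?W (U t)) \<le> Hnorm n (\<lambda>x. U \<tau> x - U t x)"
        using norm_weak_deriv_le_Hnorm[OF in_H_combine(1)[OF U[OF \<tau>] U[OF t] in_H_zero, of 1] assms(2)]
          in_H_combine(2)[OF U[OF \<tau>] U[OF t] in_H_zero assms(2), of 1]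
        by (simp add: weak_deriv_zero)
    qed
  qed
  then show "((\<lambda>\<tau>. ?W (U \<tau>)) \<longlongrightarrow> ?W (U t)) (at t within {0..<T})" by (rule LIM_zero_cancel)
qed

section \<open>The functionals in terms of classes\<close>

lemma L2norm_grad:
  fixes f :: "real^'n \<Rightarrow> real"
  assumes "\<And>i. L2 (weak_deriv [i] f)"
  shows "(L2norm (grad f))\<^sup>2 = (\<Sum>i\<in>UNIV. (norm (cls (weak_deriv [i] f)))\<^sup>2)"
proof -
  have "(\<integral>x. (norm (grad f x))\<^sup>2 \<partial>lebesgue) = (\<integral>x. (\<Sum>i\<in>UNIV. (weak_deriv [i] f x)\<^sup>2) \<partial>lebesgue)"
    by (simp add: grad_def norm_eq_sqrt_inner inner_vec_def sum_nonneg power2_eq_square)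
  also have "\<dots> = (\<Sum>i\<in>UNIV. (\<integral>x. (weak_deriv [i] f x)\<^sup>2 \<partial>lebesgue))"
    using assms by (intro Bochner_Integration.integral_sum) (auto simp: L2_def)
  also have "\<dots> = (\<Sum>i\<in>UNIV. (norm (cls (weak_deriv [i] f)))\<^sup>2)"
    by (simp add: norm_cls assms L2norm_def)
  finally show ?thesis by (simp add: L2norm_def sum_nonneg)
qed

lemma inner_grad:
  fixes f g :: "real^'n \<Rightarrow> real"
  assumes "\<And>i. L2 (weak_deriv [i] f)" "\<And>i. L2 (weak_deriv [i] g)"
  shows "(\<integral>x. grad f x \<bullet> grad g x \<partial>lebesgue) = (\<Sum>i\<in>UNIV. inner (cls (weak_deriv [i] f)) (cls (weak_deriv [i] g)))"
proof -
  have "(\<integral>x. grad f x \<bullet> grad g x \<partial>lebesgue) = (\<integral>x. (\<Sum>i\<in>UNIV. weak_deriv [i] f x * weak_deriv [i] g x) \<partial>lebesgue)"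
    by (simp add: grad_def inner_vec_def)
  also have "\<dots> = (\<Sum>i\<in>UNIV. (\<integral>x. weak_deriv [i] f x * weak_deriv [i] g x \<partial>lebesgue))"
    using assms by (intro Bochner_Integration.integral_sum L2_integrable_mult)
  finally show ?thesis by (simp add: inner_cls assms)
qed

lemma cls_lap:
  assumes "\<And>i. L2 (weak_deriv [i, i] f)"
  shows "L2 (lap f)" "cls (lap f) = (\<Sum>i\<in>UNIV. cls (weak_deriv [i, i] f))"
proof -
  have eq: "lap f = (\<lambda>x. \<Sum>i\<in>UNIV. weak_deriv [i, i] f x)" by (simp add: lap_def fun_eq_iff)
  show "L2 (lap f)" unfolding eq by (rule L2_sum[OF assms])
  show "cls (lap f) = (\<Sum>i\<in>UNIV. cls (weak_deriv [i, i] f))" unfolding eq by (rule cls_sum[OF assms])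
qed

lemma prime_t_eqI:
  assumes "t \<in> {0..<T}" "(f has_real_derivative D) (at t within {0..<T})"
    and "\<And>\<tau>. \<tau> \<in> {0..<T} \<Longrightarrow> g \<tau> = f \<tau>"
  shows "prime_t g t = D"
proof -
  have "(g has_real_derivative D) (at t within {0..<T})"
    by (rule has_field_derivative_transform_within[OF assms(2) zero_less_one assms(1)]) (simp add: assms(3))
  then have "(g has_vector_derivative D) (at t within {0..})"
    by (simp add: has_real_derivative_iff_has_vector_derivative has_vector_derivative_quotient at_within_time[OF assms(1)])
  then show ?thesis
    unfolding prime_t_def using at_time_nontrivial[of t] assms(1)
    by (intro vector_derivative_within) auto
qed

lemma potential_integral:
  fixes a b s :: real
  assumes "b > 0" "s \<ge> 0" "a * s + b > 0"
  shows "integral {0..s} (\<lambda>\<sigma>. 1 / (a * \<sigma> + b)\<^sup>2) = s / (b * (a * s + b))"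
proof -
  have pos: "a * \<sigma> + b > 0" if "\<sigma> \<in> {0..s}" for \<sigma>
  proof (cases "a \<ge> 0")
    case True
    then have "0 \<le> a * \<sigma>" using that by simp
    then show ?thesis using assms(1) by linarith
  next
    case False
    then have "a * s \<le> a * \<sigma>" using that by (simp add: mult_left_mono_neg)
    then show ?thesis using assms(3) by linarith
  qed
  have "((\<lambda>\<sigma>. 1 / (a * \<sigma> + b)\<^sup>2) has_integral s / (b * (a * s + b)) - 0 / (b * (a * 0 + b))) {0..s}"
  proof (rule fundamental_theorem_of_calculus[OF assms(2)])
    fix \<sigma> assume \<sigma>: "\<sigma> \<in> {0..s}"
    have nz: "a * \<sigma> + b \<noteq> 0" using pos[OF \<sigma>] by simp
    have "((\<lambda>\<sigma>. \<sigma> / (b * (a * \<sigma> + b))) has_real_derivative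
        (1 * (b * (a * \<sigma> + b)) - \<sigma> * (b * a)) / ((b * (a * \<sigma> + b)) * (b * (a * \<sigma> + b)))) (at \<sigma> within {0..s})"
      using nz assms(1) by (auto intro!: derivative_eq_intros)
    moreover have "(1 * (b * (a * \<sigma> + b)) - \<sigma> * (b * a)) / ((b * (a * \<sigma> + b)) * (b * (a * \<sigma> + b))) = 1 / (a * \<sigma> + b)\<^sup>2"
    proof -
      have "1 * (b * (a * \<sigma> + b)) - \<sigma> * (b * a) = b * b" by (simp add: algebra_simps)
      then show ?thesis using assms(1) by (simp add: power2_eq_square)
    qed
    ultimately show "((\<lambda>\<sigma>. \<sigma> / (b * (a * \<sigma> + b))) has_vector_derivative 1 / (a * \<sigma> + b)\<^sup>2) (at \<sigma> within {0..s})"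
      by (simp add: has_real_derivative_iff_has_vector_derivative)
  qed
  then show ?thesis by (simp add: integral_unique)
qed


section \<open>Solutions of the Kirchhoff equation\<close>

text \<open>A solution in the concrete sense; its derivatives, as classes, form an instance of
  \<open>kirchhoff_l2\<close>.\<close>

locale kirchhoff_flow =
  fixes a b T :: real and u :: "real \<Rightarrow> real^'n \<Rightarrow> real"
  assumes b_positive: "b > 0" and solution: "kirchhoff_solution a b T u"
begin

lemma spatial_regularity: "C_H 0 3 T u"
  using solution unfolding kirchhoff_solution_def by (metis diff_zero zero_le)

lemma u_H3: "t \<in> {0..<T} \<Longrightarrow> in_H 3 (u t)"
  using spatial_regularity by simp

lemma u_L2: "t \<in> {0..<T} \<Longrightarrow> L2 (u t)"
  by (rule in_H_L2[OF u_H3])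

text \<open>The \<open>H\<^sup>2\<close>-valued derivative \<open>v\<close> from the regularity assumption agrees almost everywhere with
  \<open>dt u\<close>, so \<open>dt u\<close> inherits its regularity.\<close>

lemma velocity:
  obtains v where "\<And>t. t \<in> {0..<T} \<Longrightarrow> has_time_deriv 2 u t (v t)" "C_H 0 2 T v"
    "\<And>t. t \<in> {0..<T} \<Longrightarrow> L2 (dt u t) \<and> in_H 2 (dt u t)"
    "\<And>t \<alpha>. t \<in> {0..<T} \<Longrightarrow> weak_deriv \<alpha> (dt u t) = weak_deriv \<alpha> (v t)"
    "\<And>t. t \<in> {0..<T} \<Longrightarrow> has_time_deriv 0 u t (dt u t)"
proof -
  have "\<forall>k\<le>1. C_H k (3 - k) T u" using solution by (simp add: kirchhoff_solution_def)
  from this[rule_format, of 1] have "C_H (Suc 0) 2 T u" by (simp add: numeral_3_eq_3 numeral_2_eq_2)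
  then obtain v where v: "\<forall>t\<in>{0..<T}. has_time_deriv 2 u t (v t)" and C: "C_H 0 2 T v"
    by (auto simp only: C_H.simps(2))
  have facts: "has_time_deriv 0 u t (dt u t)" "L2 (dt u t)" "cls (dt u t) = cls (v t)" "in_H 2 (v t)"
    if t: "t \<in> {0..<T}" for t
  proof -
    have "((\<lambda>\<tau>. cls (u \<tau>)) has_vector_derivative cls (v t)) (at t within {0..<T})"
      using has_time_deriv_cls[OF v[rule_format, OF t]] unfolding at_within_time[OF t] .
    from dt_eqI[OF t u_L2 this]
    show "has_time_deriv 0 u t (dt u t)" "L2 (dt u t)" "cls (dt u t) = cls (v t)" by auto
    show "in_H 2 (v t)" using C t by simp
  qed
  have wd: "weak_deriv \<alpha> (dt u t) = weak_deriv \<alpha> (v t)" if t: "t \<in> {0..<T}" for t \<alpha>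
    by (rule weak_deriv_cong_cls[OF facts(2)[OF t] in_H_L2[OF facts(4)[OF t]] facts(3)[OF t]])
  have H: "in_H 2 (dt u t)" if t: "t \<in> {0..<T}" for t
    unfolding in_H_def
  proof (intro conjI allI impI facts t)
    fix \<alpha> :: "'n list" assume "length \<alpha> \<le> 2"
    then have "wderiv \<alpha> (cls (dt u t)) (cls (weak_deriv \<alpha> (v t)))"
      using in_H_weak_deriv(2)[OF facts(4)[OF t]] by (simp add: facts(3)[OF t])
    then show "has_weak_deriv_L2 \<alpha> (dt u t)" by (rule weak_deriv_eqI(1)[OF facts(2)[OF t]])
  qed
  show ?thesis
    by (rule that[of v]) (use v C facts wd H in auto)
qed

lemma dt_u_H2: "t \<in> {0..<T} \<Longrightarrow> in_H 2 (dt u t)"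
  using velocity by metis

lemma dt_u_L2: "t \<in> {0..<T} \<Longrightarrow> L2 (dt u t)"
  by (rule in_H_L2[OF dt_u_H2])

lemma dt_u_time_deriv: "t \<in> {0..<T} \<Longrightarrow> has_time_deriv 0 u t (dt u t)"
  using velocity by metis

lemma spatial_time_derivative:
  assumes t: "t \<in> {0..<T}" and len: "length \<alpha> \<le> 2"
  shows "((\<lambda>t. cls (weak_deriv \<alpha> (u t))) has_vector_derivative cls (weak_deriv \<alpha> (dt u t))) (at t within {0..<T})"
proof -
  obtain v where v: "\<And>t. t \<in> {0..<T} \<Longrightarrow> has_time_deriv 2 u t (v t)"
    "\<And>t \<alpha>. t \<in> {0..<T} \<Longrightarrow> weak_deriv \<alpha> (dt u t) = weak_deriv \<alpha> (v t)"
    by (rule velocity) blast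
  show ?thesis
    using has_time_deriv_weak_deriv[OF v(1)[OF t] len] unfolding at_within_time[OF t] v(2)[OF t] .
qed

lemma velocity_continuous:
  assumes len: "length \<alpha> \<le> 2"
  shows "continuous_on {0..<T} (\<lambda>t. cls (weak_deriv \<alpha> (dt u t)))"
proof -
  obtain v where v: "C_H 0 2 T v"
    "\<And>t \<alpha>. t \<in> {0..<T} \<Longrightarrow> weak_deriv \<alpha> (dt u t) = weak_deriv \<alpha> (v t)"
    by (rule velocity) blast
  show ?thesis
    by (rule continuous_on_eq[OF C_H_0_continuous[OF v(1) len]]) (simp add: v(2))
qed

lemma weak_deriv_L2:
  assumes "t \<in> {0..<T}"
  shows "length \<alpha> \<le> 3 \<Longrightarrow> L2 (weak_deriv \<alpha> (u t))" "length \<alpha> \<le> 2 \<Longrightarrow> L2 (weak_deriv \<alpha> (dt u t))"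
  using in_H_weak_deriv(1)[OF u_H3[OF assms]] in_H_weak_deriv(1)[OF dt_u_H2[OF assms]] by auto

lemma wderiv_extend:
  assumes H: "in_H n f" and len: "length \<alpha> < n"
  shows "wderiv [i] (cls (weak_deriv \<alpha> f)) (cls (weak_deriv (\<alpha> @ [i]) f))"
  using wderiv_append[OF in_H_weak_deriv(2)[OF H], of \<alpha> "[i]"] in_H_weak_deriv(2)[OF H, of "\<alpha> @ [i]"] len
  by auto

lemma s_fun_eq:
  assumes "t \<in> {0..<T}"
  shows "s_fun u t = (\<Sum>i\<in>UNIV. (norm (cls (weak_deriv [i] (u t))))\<^sup>2)"
  unfolding s_fun_def by (rule L2norm_grad) (rule weak_deriv_L2(1)[OF assms], simp)

lemma lap_u:
  assumes "t \<in> {0..<T}"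
  shows "L2 (lap (u t))" "cls (lap (u t)) = (\<Sum>i\<in>UNIV. cls (weak_deriv [i, i] (u t)))"
    and "L2 (lap (dt u t))" "cls (lap (dt u t)) = (\<Sum>i\<in>UNIV. cls (weak_deriv [i, i] (dt u t)))"
  by (rule cls_lap, rule weak_deriv_L2[OF assms], simp)+

sublocale K: kirchhoff_l2 a b T "\<lambda>t. cls (u t)" "\<lambda>t. cls (dt u t)"
  "\<lambda>i t. cls (weak_deriv [i] (u t))" "\<lambda>i t. cls (weak_deriv [i] (dt u t))"
  "\<lambda>i j t. cls (weak_deriv [i, j] (u t))" "\<lambda>i j t. cls (weak_deriv [i, j] (dt u t))"
  "\<lambda>i j k t. cls (weak_deriv [i, j, k] (u t))" "{0..<T}"
  "\<lambda>t. \<Sum>i\<in>UNIV. (norm (cls (weak_deriv [i] (u t))))\<^sup>2"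
  "\<lambda>t. a * (\<Sum>i\<in>UNIV. (norm (cls (weak_deriv [i] (u t))))\<^sup>2) + b"
  "\<lambda>t. \<Sum>i\<in>UNIV. cls (weak_deriv [i, i] (u t))"
proof unfold_locales
  show "b > 0" by (rule b_positive)
  fix t assume t: "t \<in> {0..<T}"
  note u = u_H3[OF t] and p = dt_u_H2[OF t]
  show "wderiv [i] (cls (u t)) (cls (weak_deriv [i] (u t)))" for i
    by (rule in_H_weak_deriv(2)[OF u]) simp
  show "wderiv [i] (cls (dt u t)) (cls (weak_deriv [i] (dt u t)))" for i
    by (rule in_H_weak_deriv(2)[OF p]) simp
  show "wderiv [j] (cls (weak_deriv [i] (u t))) (cls (weak_deriv [i, j] (u t)))" for i j
    using wderiv_extend[OF u, of "[i]" j] by simp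
  show "wderiv [k] (cls (weak_deriv [i, j] (u t))) (cls (weak_deriv [i, j, k] (u t)))" for i j k
    using wderiv_extend[OF u, of "[i, j]" k] by simp
  show "wderiv [j] (cls (weak_deriv [i] (dt u t))) (cls (weak_deriv [i, j] (dt u t)))" for i j
    using wderiv_extend[OF p, of "[i]" j] by simp
  show "((\<lambda>t. cls (weak_deriv [i] (u t))) has_vector_derivative cls (weak_deriv [i] (dt u t))) (at t within {0..<T})" for i
    by (rule spatial_time_derivative[OF t]) simp
  show "((\<lambda>t. cls (weak_deriv [i, j] (u t))) has_vector_derivative cls (weak_deriv [i, j] (dt u t))) (at t within {0..<T})" for i j
    by (rule spatial_time_derivative[OF t]) simp
  show "(\<Sum>i\<in>UNIV. (norm (cls (weak_deriv [i] (u t))))\<^sup>2) < b / \<bar>a\<bar>" if "a < 0"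
  proof -
    have "(L2norm (grad (u t)))\<^sup>2 < b / \<bar>a\<bar>"
      using solution that t unfolding kirchhoff_solution_def by blast
    then show ?thesis by (simp only: s_fun_eq[OF t, unfolded s_fun_def])
  qed
  fix \<phi> :: "real^'n \<Rightarrow> real" assume \<phi>: "test_function \<phi>"
  let ?q = "a * (\<Sum>i\<in>UNIV. (norm (cls (weak_deriv [i] (u t))))\<^sup>2) + b"
  have q: "a * (\<integral>y. (norm (grad (u t) y))\<^sup>2 \<partial>lebesgue) + b = ?q"
    using s_fun_eq[OF t] by (simp add: s_fun_def L2norm_def)
  have "(\<integral>x. lap (u t) x / (a * (\<integral>y. (norm (grad (u t) y))\<^sup>2 \<partial>lebesgue) + b)\<^sup>2 * \<phi> x \<partial>lebesgue)
      = (1 / ?q\<^sup>2) * (\<integral>x. lap (u t) x * \<phi> x \<partial>lebesgue)"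
    unfolding q by (simp flip: integral_mult_right_zero)
  also have "\<dots> = inner ((1 / ?q\<^sup>2) *\<^sub>R (\<Sum>i\<in>UNIV. cls (weak_deriv [i, i] (u t)))) (cls \<phi>)"
    by (simp only: inner_scaleR_left lap_u(2)[OF t, symmetric] inner_cls[OF lap_u(1)[OF t] test_function_L2[OF \<phi>]])
  finally have rhs: "(\<integral>x. lap (u t) x / (a * (\<integral>y. (norm (grad (u t) y))\<^sup>2 \<partial>lebesgue) + b)\<^sup>2 * \<phi> x \<partial>lebesgue)
      = inner ((1 / ?q\<^sup>2) *\<^sub>R (\<Sum>i\<in>UNIV. cls (weak_deriv [i, i] (u t)))) (cls \<phi>)" .
  have "((\<lambda>\<tau>. \<integral>x. dt u \<tau> x * \<phi> x \<partial>lebesgue) has_real_derivative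
      inner ((1 / ?q\<^sup>2) *\<^sub>R (\<Sum>i\<in>UNIV. cls (weak_deriv [i, i] (u t)))) (cls \<phi>)) (at t within {0..<T})"
    using solution \<phi> t unfolding kirchhoff_solution_def rhs[symmetric] at_within_time[OF t, symmetric] by blast
  then show "((\<lambda>t. inner (cls (dt u t)) (cls \<phi>)) has_real_derivative
      inner ((1 / ?q\<^sup>2) *\<^sub>R (\<Sum>i\<in>UNIV. cls (weak_deriv [i, i] (u t)))) (cls \<phi>)) (at t within {0..<T})"
    by (rule has_field_derivative_transform_within[OF _ zero_less_one t])
      (simp add: inner_cls dt_u_L2 test_function_L2[OF \<phi>])
next
  show "continuous_on {0..<T} (\<lambda>t. cls (weak_deriv [i, j, k] (u t)))" for i j k
    by (rule C_H_0_continuous[OF spatial_regularity]) simp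
  show "continuous_on {0..<T} (\<lambda>t. cls (weak_deriv [i, j] (dt u t)))" for i j
    by (rule velocity_continuous) simp
qed

abbreviation "sK \<equiv> \<lambda>t. \<Sum>i\<in>UNIV. (norm (cls (weak_deriv [i] (u t))))\<^sup>2"
abbreviation "qK \<equiv> \<lambda>t. a * sK t + b"

context
  fixes t assumes t: "t \<in> {0..<T}"
begin

lemma q_fun_eq: "q_fun a b u t = qK t"
  by (simp add: q_fun_def s_fun_eq[OF t])

lemma grad_dt_eq: "(L2norm (grad (dt u t)))\<^sup>2 = K.N t"
  unfolding K.N_def by (rule L2norm_grad) (rule weak_deriv_L2(2)[OF t], simp)

lemma lap_eq: "(L2norm (lap (u t)))\<^sup>2 = K.L t" "(L2norm (lap (dt u t)))\<^sup>2 = (norm (K.lp t))\<^sup>2"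
  by (simp_all add: K.L_def K.lp_def lap_u(2,4)[OF t, symmetric] norm_cls lap_u(1,3)[OF t])

lemma grad_lap_eq: "(L2norm (grad (lap (u t))))\<^sup>2 = K.\<Gamma> t"
proof -
  have w: "wderiv [i] (cls (lap (u t))) (K.gl i t)" for i
    unfolding lap_u(2)[OF t] by (rule K.wderiv_gl[OF t])
  show ?thesis
    unfolding K.\<Gamma>_def using weak_deriv_eqI(2,3)[OF lap_u(1)[OF t] w] by (simp add: L2norm_grad)
qed

lemma E2_eq: "E2 a b u t = K.e2 t"
  by (simp add: E2_def K.e2_def grad_dt_eq lap_eq q_fun_eq)

lemma E3_eq: "E3 a b u t = K.e3 t"
  by (simp add: E3_def K.e3_def grad_lap_eq lap_eq q_fun_eq)

lemma I2_eq: "I2 a b u t = K.e2 t - a * (K.m t)\<^sup>2"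
  unfolding I2_def E2_eq K.m_def by (subst inner_grad) (simp_all add: weak_deriv_L2[OF t])

lemma I1_eq: "I1 a b u t = (norm (cls (dt u t)))\<^sup>2 + sK t / (b * qK t)"
proof -
  have "integral {0..s_fun u t} (\<lambda>\<sigma>. 1 / (a * \<sigma> + b)\<^sup>2) = sK t / (b * qK t)"
    unfolding s_fun_eq[OF t] using b_positive K.s_nonneg K.q_pos[OF t] by (intro potential_integral)
  then show ?thesis by (simp add: I1_def norm_cls dt_u_L2[OF t])
qed

lemma prime_s_eq: "prime_t (s_fun u) t = 2 * K.m t"
  by (rule prime_t_eqI[OF t K.s_deriv[OF t]]) (rule s_fun_eq)

lemma prime_q_eq: "prime_t (q_fun a b u) t = 2 * a * K.m t"
  by (rule prime_t_eqI[OF t K.q_deriv[OF t]]) (simp add: q_fun_def s_fun_eq)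

end

lemma prime_prime_s_eq:
  assumes t: "t \<in> {0..<T}" shows "prime_t (prime_t (s_fun u)) t = 2 * K.k t"
  by (rule prime_t_eqI[OF t DERIV_cmult[OF K.m_deriv[OF t]]]) (rule prime_s_eq)

lemma I3_eq: assumes t: "t \<in> {0..<T}" shows "I3 a b u t = K.i3 t"
proof -
  have X: "(\<integral>x. lap (u t) x * lap (dt u t) x \<partial>lebesgue) = K.X t"
    by (simp add: K.X_def K.lp_def lap_u(2,4)[OF t, symmetric] inner_cls lap_u(1,3)[OF t])
  show ?thesis
    unfolding I3_def X E3_eq[OF t] E2_eq[OF t] prime_s_eq[OF t] prime_q_eq[OF t] prime_prime_s_eq[OF t] q_fun_eq[OF t]
    by (simp add: K.i3_def K.low_def algebra_simps power2_eq_square power4_eq_xxxx power3_eq_cube)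
qed

lemma energy_estimates:
  assumes a: "a \<noteq> 0" and I1: "I1 a b u 0 \<le> 1 / (6 * \<bar>a * b\<bar>)" and t: "t \<in> {0..<T}"
  shows "b / 2 \<le> q_fun a b u t" "q_fun a b u t \<le> 3 / 2 * b"
    and "2 / 3 * I2 a b u t \<le> E2 a b u t" "E2 a b u t \<le> 2 * I2 a b u t"
    and "2 / 3 * I3 a b u t \<le> E3 a b u t" "E3 a b u t \<le> 2 * I3 a b u t"
proof -
  have 0: "0 \<in> {0..<T}" using t by simp
  note hyp = a I1[unfolded I1_eq[OF 0]]
  show "b / 2 \<le> q_fun a b u t" "q_fun a b u t \<le> 3 / 2 * b"
    using K.smallness_persists(3,4)[OF hyp t] b_positive unfolding q_fun_eq[OF t] by linarith+
  have I2: "2 / 3 * (e - x) \<le> e" "e \<le> 2 * (e - x)" if "\<bar>x\<bar> \<le> e / 5" "0 \<le> e" for e x :: real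
  proof -
    have x: "- x \<le> e / 5" "x \<le> e / 5" using that(1) by (simp_all add: abs_le_iff)
    show "2 / 3 * (e - x) \<le> e" using x(1) that(2) by (simp add: field_simps)
    show "e \<le> 2 * (e - x)" using x(2) that(2) by (simp add: field_simps)
  qed
  show "2 / 3 * I2 a b u t \<le> E2 a b u t" "E2 a b u t \<le> 2 * I2 a b u t"
    unfolding I2_eq[OF t] E2_eq[OF t]
    by (intro I2 K.energy_bounds(1)[OF hyp t] K.e2_nonneg[OF hyp t])+
  have I3: "2 / 3 * i \<le> e" "e \<le> 2 * i" if "\<bar>i - e\<bar> \<le> e / 2" for e i :: real
    using that by linarith+
  show "2 / 3 * I3 a b u t \<le> E3 a b u t" "E3 a b u t \<le> 2 * I3 a b u t"
    unfolding I3_eq[OF t] E3_eq[OF t] by (intro I3 K.energy_bounds(2)[OF hyp t])+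
qed

lemma iterated_time_derivatives:
  assumes t: "t \<in> {0..<T}"
  shows "j \<le> 3 \<Longrightarrow> L2 ((dt ^^ j) u t) \<and> cls ((dt ^^ j) u t) = K.time_deriv j t"
    and "j < 3 \<Longrightarrow> has_time_deriv 0 ((dt ^^ j) u) t ((dt ^^ Suc j) u t)"
proof -
  have step: "(K.time_deriv j has_vector_derivative K.time_deriv (Suc j) t) (at t within {0..<T})"
    if "j < 3" "t \<in> {0..<T}" for j t
  proof -
    have "j = 0 \<or> j = 1 \<or> j = 2" using that(1) by linarith
    moreover have "((\<lambda>t. cls (u t)) has_vector_derivative cls (dt u t)) (at t within {0..<T})"
      using has_time_deriv_cls[OF dt_u_time_deriv[OF that(2)]] unfolding at_within_time[OF that(2)] .
    ultimately show ?thesis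
      using K.p_deriv[OF that(2)] K.acceleration_deriv[OF that(2)] by (auto simp: K.time_deriv_def)
  qed
  have main: "\<forall>t\<in>{0..<T}. L2 ((dt ^^ j) u t) \<and> cls ((dt ^^ j) u t) = K.time_deriv j t" if "j \<le> 3" for j
    using that
  proof (induction j)
    case 0
    show ?case by (simp add: u_L2 K.time_deriv_def)
  next
    case (Suc j)
    show ?case
    proof
      fix t assume t: "t \<in> {0..<T}"
      have IH: "\<And>t. t \<in> {0..<T} \<Longrightarrow> L2 ((dt ^^ j) u t)"
          "\<And>t. t \<in> {0..<T} \<Longrightarrow> K.time_deriv j t = cls ((dt ^^ j) u t)" using Suc by auto
      have "((\<lambda>t. cls ((dt ^^ j) u t)) has_vector_derivative K.time_deriv (Suc j) t) (at t within {0..<T})"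
        by (rule has_vector_derivative_transform[OF t _ step[OF _ t]]) (use Suc.prems IH(2) in auto)
      from dt_eqI(2,3)[OF t IH(1) this]
      show "L2 ((dt ^^ Suc j) u t) \<and> cls ((dt ^^ Suc j) u t) = K.time_deriv (Suc j) t" by simp
    qed
  qed
  show "j \<le> 3 \<Longrightarrow> L2 ((dt ^^ j) u t) \<and> cls ((dt ^^ j) u t) = K.time_deriv j t" using main t by blast
  assume j: "j < 3"
  have L: "\<And>t. t \<in> {0..<T} \<Longrightarrow> L2 ((dt ^^ j) u t)"
    and eq: "\<And>t. t \<in> {0..<T} \<Longrightarrow> K.time_deriv j t = cls ((dt ^^ j) u t)" using main[of j] j by auto
  have "((\<lambda>t. cls ((dt ^^ j) u t)) has_vector_derivative K.time_deriv (Suc j) t) (at t within {0..<T})"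
    by (rule has_vector_derivative_transform[OF t _ step[OF j t]]) (simp add: eq)
  from dt_eqI(1)[OF t L this]
  show "has_time_deriv 0 ((dt ^^ j) u) t ((dt ^^ Suc j) u t)" by simp
qed

lemma derivative_bounds:
  assumes a: "a \<noteq> 0" and I1: "I1 a b u 0 \<le> 1 / (6 * \<bar>a * b\<bar>)" and t: "t \<in> {0..<T}"
    and len: "1 \<le> length \<alpha> + j" "length \<alpha> + j \<le> 3"
  shows "has_weak_deriv_L2 \<alpha> ((dt ^^ j) u t)"
    and "L2norm (weak_deriv \<alpha> ((dt ^^ j) u t)) \<le> data_bound a b (E2 a b u 0) (E3 a b u 0)"
proof -
  have 0: "0 \<in> {0..<T}" using t by simp
  have U: "L2 ((dt ^^ j) u t)" "cls ((dt ^^ j) u t) = K.time_deriv j t"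
    using iterated_time_derivatives(1)[OF t, of j] len by auto
  obtain G where G: "wderiv \<alpha> (K.time_deriv j t) G" "norm G \<le> data_bound a b (K.e2 0) (K.e3 0)"
    using K.derivatives_bounded[OF a I1[unfolded I1_eq[OF 0]] t len] by blast
  note W = weak_deriv_eqI[OF U(1), unfolded U(2), OF G(1)]
  show "has_weak_deriv_L2 \<alpha> ((dt ^^ j) u t)" by (rule W(1))
  show "L2norm (weak_deriv \<alpha> ((dt ^^ j) u t)) \<le> data_bound a b (E2 a b u 0) (E3 a b u 0)"
    using G(2) by (simp add: norm_cls[OF W(2), symmetric] W(3) E2_eq[OF 0] E3_eq[OF 0])
qed

text \<open>The leading energies at time \<open>0\<close> depend only on the initial data, because weak derivatives depend
  only on the almost-everywhere class.\<close>

lemma initial_functionals: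
  assumes "T > 0" and ae: "AE x in lebesgue. u 0 x = u0 x" "AE x in lebesgue. dt u 0 x = u1 x"
  shows "E2 a b u 0 = (a * (L2norm (grad u0))\<^sup>2 + b) * (L2norm (grad u1))\<^sup>2 +
      (L2norm (lap u0))\<^sup>2 / (a * (L2norm (grad u0))\<^sup>2 + b)"
    and "E3 a b u 0 = (a * (L2norm (grad u0))\<^sup>2 + b) * (L2norm (lap u1))\<^sup>2 +
      (L2norm (grad (lap u0)))\<^sup>2 / (a * (L2norm (grad u0))\<^sup>2 + b)"
proof -
  have 0: "0 \<in> {0..<T}" using assms(1) by simp
  have L: "L2 u0" "L2 u1"
    using L2_AE_cong[OF u_L2[OF 0] ae(1)] L2_AE_cong[OF dt_u_L2[OF 0] ae(2)] by auto
  have "weak_deriv \<alpha> (u 0) = weak_deriv \<alpha> u0" "weak_deriv \<alpha> (dt u 0) = weak_deriv \<alpha> u1" for \<alpha>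
    by (intro weak_deriv_cong_cls u_L2 dt_u_L2 0 L cls_eq_iff[THEN iffD2] ae)+
  then have "grad (u 0) = grad u0" "lap (u 0) = lap u0" "grad (dt u 0) = grad u1" "lap (dt u 0) = lap u1"
    by (simp_all add: grad_def[abs_def] lap_def[abs_def])
  then show "E2 a b u 0 = (a * (L2norm (grad u0))\<^sup>2 + b) * (L2norm (grad u1))\<^sup>2 +
      (L2norm (lap u0))\<^sup>2 / (a * (L2norm (grad u0))\<^sup>2 + b)"
    "E3 a b u 0 = (a * (L2norm (grad u0))\<^sup>2 + b) * (L2norm (lap u1))\<^sup>2 +
      (L2norm (grad (lap u0)))\<^sup>2 / (a * (L2norm (grad u0))\<^sup>2 + b)"
    by (simp_all add: E2_def E3_def q_fun_def s_fun_def)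
qed

end

theorem theorem1p5:
  fixes a b :: real and u0 u1 :: "real^'n \<Rightarrow> real"
  assumes "a \<noteq> 0" and "b > 0"
  shows
    "(\<forall>T>0. \<forall>u :: real \<Rightarrow> real^'n \<Rightarrow> real.
        kirchhoff_solution a b T u \<and> I1 a b u 0 \<le> 1 / (6 * \<bar>a * b\<bar>) \<longrightarrow>
        (\<forall>t\<in>{0..<T}.
           b / 2 \<le> q_fun a b u t \<and> q_fun a b u t \<le> 3 / 2 * b \<and>
           2 / 3 * I2 a b u t \<le>
             q_fun a b u t * (L2norm (grad (dt u t)))\<^sup>2 + (L2norm (lap (u t)))\<^sup>2 / q_fun a b u t \<and>
           q_fun a b u t * (L2norm (grad (dt u t)))\<^sup>2 + (L2norm (lap (u t)))\<^sup>2 / q_fun a b u t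
             \<le> 2 * I2 a b u t \<and>
           2 / 3 * I3 a b u t \<le>
             q_fun a b u t * (L2norm (lap (dt u t)))\<^sup>2 + (L2norm (grad (lap (u t))))\<^sup>2 / q_fun a b u t \<and>
           q_fun a b u t * (L2norm (lap (dt u t)))\<^sup>2 + (L2norm (grad (lap (u t))))\<^sup>2 / q_fun a b u t
             \<le> 2 * I3 a b u t)) \<and>
     (\<exists>C. \<forall>T>0. \<forall>u :: real \<Rightarrow> real^'n \<Rightarrow> real.
        kirchhoff_solution a b T u \<and> I1 a b u 0 \<le> 1 / (6 * \<bar>a * b\<bar>) \<and>
        (AE x in lebesgue. u 0 x = u0 x) \<and> (AE x in lebesgue. dt u 0 x = u1 x) \<longrightarrow>
        (\<forall>t\<in>{0..<T}. \<forall>\<alpha> k. 1 \<le> length \<alpha> + k \<and> length \<alpha> + k \<le> 3 \<longrightarrow>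
           (\<forall>j<k. \<exists>v. has_time_deriv 0 ((dt ^^ j) u) t v) \<and>
           has_weak_deriv_L2 \<alpha> ((dt ^^ k) u t) \<and>
           L2norm (weak_deriv \<alpha> ((dt ^^ k) u t)) \<le> C))"
proof (rule conjI)
  show "\<forall>T>0. \<forall>u :: real \<Rightarrow> real^'n \<Rightarrow> real.
        kirchhoff_solution a b T u \<and> I1 a b u 0 \<le> 1 / (6 * \<bar>a * b\<bar>) \<longrightarrow>
        (\<forall>t\<in>{0..<T}.
           b / 2 \<le> q_fun a b u t \<and> q_fun a b u t \<le> 3 / 2 * b \<and>
           2 / 3 * I2 a b u t \<le>
             q_fun a b u t * (L2norm (grad (dt u t)))\<^sup>2 + (L2norm (lap (u t)))\<^sup>2 / q_fun a b u t \<and>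
           q_fun a b u t * (L2norm (grad (dt u t)))\<^sup>2 + (L2norm (lap (u t)))\<^sup>2 / q_fun a b u t
             \<le> 2 * I2 a b u t \<and>
           2 / 3 * I3 a b u t \<le>
             q_fun a b u t * (L2norm (lap (dt u t)))\<^sup>2 + (L2norm (grad (lap (u t))))\<^sup>2 / q_fun a b u t \<and>
           q_fun a b u t * (L2norm (lap (dt u t)))\<^sup>2 + (L2norm (grad (lap (u t))))\<^sup>2 / q_fun a b u t
             \<le> 2 * I3 a b u t)"
    unfolding E2_def[symmetric] E3_def[symmetric]
  proof (intro allI impI ballI, elim conjE)
    fix T :: real and u :: "real \<Rightarrow> real^'n \<Rightarrow> real" and t
    assume sol: "kirchhoff_solution a b T u" and I1: "I1 a b u 0 \<le> 1 / (6 * \<bar>a * b\<bar>)" and t: "t \<in> {0..<T}"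
    interpret kirchhoff_flow a b T u by unfold_locales (rule \<open>b > 0\<close> sol)+
    show "b / 2 \<le> q_fun a b u t \<and> q_fun a b u t \<le> 3 / 2 * b \<and>
        2 / 3 * I2 a b u t \<le> E2 a b u t \<and> E2 a b u t \<le> 2 * I2 a b u t \<and>
        2 / 3 * I3 a b u t \<le> E3 a b u t \<and> E3 a b u t \<le> 2 * I3 a b u t"
      by (intro conjI energy_estimates[OF \<open>a \<noteq> 0\<close> I1 t])
  qed
  let ?q = "a * (L2norm (grad u0))\<^sup>2 + b"
  let ?C = "data_bound a b (?q * (L2norm (grad u1))\<^sup>2 + (L2norm (lap u0))\<^sup>2 / ?q)
    (?q * (L2norm (lap u1))\<^sup>2 + (L2norm (grad (lap u0)))\<^sup>2 / ?q)"
  show "\<exists>C. \<forall>T>0. \<forall>u :: real \<Rightarrow> real^'n \<Rightarrow> real.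
        kirchhoff_solution a b T u \<and> I1 a b u 0 \<le> 1 / (6 * \<bar>a * b\<bar>) \<and>
        (AE x in lebesgue. u 0 x = u0 x) \<and> (AE x in lebesgue. dt u 0 x = u1 x) \<longrightarrow>
        (\<forall>t\<in>{0..<T}. \<forall>\<alpha> k. 1 \<le> length \<alpha> + k \<and> length \<alpha> + k \<le> 3 \<longrightarrow>
           (\<forall>j<k. \<exists>v. has_time_deriv 0 ((dt ^^ j) u) t v) \<and>
           has_weak_deriv_L2 \<alpha> ((dt ^^ k) u t) \<and>
           L2norm (weak_deriv \<alpha> ((dt ^^ k) u t)) \<le> C)"
  proof (rule exI[of _ ?C], intro allI impI ballI, elim conjE)
    fix T :: real and u :: "real \<Rightarrow> real^'n \<Rightarrow> real" and t and \<alpha> :: "'n list" and k :: nat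
    assume "T > 0" and sol: "kirchhoff_solution a b T u" and I1: "I1 a b u 0 \<le> 1 / (6 * \<bar>a * b\<bar>)"
      and t: "t \<in> {0..<T}" and len: "1 \<le> length \<alpha> + k" "length \<alpha> + k \<le> 3"
      and ae: "AE x in lebesgue. u 0 x = u0 x" "AE x in lebesgue. dt u 0 x = u1 x"
    interpret kirchhoff_flow a b T u by unfold_locales (rule \<open>b > 0\<close> sol)+
    have "\<exists>v. has_time_deriv 0 ((dt ^^ j) u) t v" if "j < k" for j
    proof -
      have "j < 3" using that len by linarith
      then show ?thesis using iterated_time_derivatives(2)[OF t] by blast
    qed
    then show "(\<forall>j<k. \<exists>v. has_time_deriv 0 ((dt ^^ j) u) t v) \<and>
        has_weak_deriv_L2 \<alpha> ((dt ^^ k) u t) \<and> L2norm (weak_deriv \<alpha> ((dt ^^ k) u t)) \<le> ?C"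
      using derivative_bounds[OF \<open>a \<noteq> 0\<close> I1 t len] unfolding initial_functionals[OF \<open>T > 0\<close> ae] by blast
  qed
qed

end
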